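(* Let $U$ be a model of $\mathrm{ZFU}_{\mathrm R}$ + Collection + $\mathrm{AC}_\omega$, equipped with its definable classes. The following are equivalent. (1) $U \models$ "$\mathscr{A}$ is a set". (2) $U$ has a definable map (from classes to objects) that fulfills Basic Law V. (3) $U$ has a parametrically definable map (from classes to objects) that fulfills Basic Law V.
   Context: The language of urelement set theory has $\in$ and a unary predicate $\mathscr{A}$ for urelements; $\mathscr{A}$ also denotes the class of all urelements, and a set is an object that is not a urelement. $\mathrm{ZFU}_{\mathrm R}$ has the axioms: urelements have no members; Extensionality for sets (sets with the same members are equal); Foundation; Pairing; Union; Powerset; Infinity; the Separation schema; the Replacement schema. The urelements may form a proper class; "$\mathscr{A}$ is a set" means that some set has exactly the urelements as its members. Collection is the schema $\forall w,u\,(\forall x\in w\,\exists y\,\varphi(x,y,u)\to\exists v\,\forall x\in w\,\exists y\in v\,\varphi(x,y,u))$. $\mathrm{AC}_\omega$ states that every countable family of non-empty sets has a choice function. Given a model $U$, its definable classes are the collections $\{x\in U: U\models\psi(x,z)\}$ with $\psi$ a first-order formula and $z\in U$ a parameter. "Equipped with definable classes" means that we consider the two-sorted structure whose objects are the elements of $U$ and whose classes are the definable classes. A map $X\mapsto\epsilon X$ from classes to objects is definable if its graph is defined over this structure by a second-order formula $\varphi(X,y)$ (quantifiers over objects and over definable classes allowed, no parameters), and parametrically definable if it is defined by a second-order formula $\varphi(X,y,P)$ with a definable class $P$ of $U$ as parameter. It fulfills Basic Law V if for all classes $X,Y$: $\epsilon X=\epsilon Y\leftrightarrow\forall x\,(x\in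 X\leftrightarrow x\in Y)$. *)

theory Defs
  imports Main
begin

datatype fm =
    Mem nat nat
  | Eq nat nat
  | Ur nat
  | Neg fm
  | Conj fm fm
  | Ex nat fm

primrec fv :: "fm \<Rightarrow> nat set" where
  "fv (Mem i j) = {i, j}"
| "fv (Eq i j) = {i, j}"
| "fv (Ur i) = {i}"
| "fv (Neg p) = fv p"
| "fv (Conj p q) = fv p \<union> fv q"
| "fv (Ex i p) = fv p - {i}"

text \<open>Second-order formulas have two separate supplies of variables, both named by natural
  numbers: object variables and class variables. \<open>InCl i k\<close> says that object \<open>i\<close> belongs to
  class \<open>k\<close>. Equality of classes is not primitive, being expressible by coextensiveness.\<close>

datatype fm2 =
    Mem2 nat nat
  | Eq2 nat nat
  | Ur2 nat
  | InCl nat nat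
  | Neg2 fm2
  | Conj2 fm2 fm2
  | ExObj nat fm2
  | ExCl nat fm2

primrec fv_obj :: "fm2 \<Rightarrow> nat set" where
  "fv_obj (Mem2 i j) = {i, j}"
| "fv_obj (Eq2 i j) = {i, j}"
| "fv_obj (Ur2 i) = {i}"
| "fv_obj (InCl i k) = {i}"
| "fv_obj (Neg2 p) = fv_obj p"
| "fv_obj (Conj2 p q) = fv_obj p \<union> fv_obj q"
| "fv_obj (ExObj i p) = fv_obj p - {i}"
| "fv_obj (ExCl k p) = fv_obj p"

primrec fv_cl :: "fm2 \<Rightarrow> nat set" where
  "fv_cl (Mem2 i j) = {}"
| "fv_cl (Eq2 i j) = {}"
| "fv_cl (Ur2 i) = {}"
| "fv_cl (InCl i k) = {k}"
| "fv_cl (Neg2 p) = fv_cl p"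
| "fv_cl (Conj2 p q) = fv_cl p \<union> fv_cl q"
| "fv_cl (ExObj i p) = fv_cl p"
| "fv_cl (ExCl k p) = fv_cl p - {k}"

text \<open>The domain of the structure is the whole type \<^typ>\<open>'a\<close>. Single axioms are given by what
  their truth in the structure unfolds to; schemata quantify over \<^typ>\<open>fm\<close>.\<close>

locale urelement_structure =
  fixes mem :: "'a \<Rightarrow> 'a \<Rightarrow> bool" (infix "\<in>\<^sub>U" 50)
    and ur :: "'a \<Rightarrow> bool"
begin

primrec sat :: "(nat \<Rightarrow> 'a) \<Rightarrow> fm \<Rightarrow> bool" where
  "sat e (Mem i j) \<longleftrightarrow> e i \<in>\<^sub>U e j"
| "sat e (Eq i j) \<longleftrightarrow> e i = e j"
| "sat e (Ur i) \<longleftrightarrow> ur (e i)"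
| "sat e (Neg p) \<longleftrightarrow> \<not> sat e p"
| "sat e (Conj p q) \<longleftrightarrow> sat e p \<and> sat e q"
| "sat e (Ex i p) \<longleftrightarrow> (\<exists>a. sat (e(i := a)) p)"

definition is_set :: "'a \<Rightarrow> bool" where
  "is_set x \<longleftrightarrow> \<not> ur x"

definition is_empty :: "'a \<Rightarrow> bool" where
  "is_empty x \<longleftrightarrow> is_set x \<and> (\<forall>y. \<not> y \<in>\<^sub>U x)"

definition is_upair :: "'a \<Rightarrow> 'a \<Rightarrow> 'a \<Rightarrow> bool" where
  "is_upair p a b \<longleftrightarrow> is_set p \<and> (\<forall>x. x \<in>\<^sub>U p \<longleftrightarrow> x = a \<or> x = b)"

definition is_opair :: "'a \<Rightarrow> 'a \<Rightarrow> 'a \<Rightarrow> bool" where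
  "is_opair p a b \<longleftrightarrow> (\<exists>s t. is_upair s a a \<and> is_upair t a b \<and> is_upair p s t)"

definition is_succ :: "'a \<Rightarrow> 'a \<Rightarrow> bool" where
  "is_succ y x \<longleftrightarrow> is_set y \<and> (\<forall>z. z \<in>\<^sub>U y \<longleftrightarrow> z \<in>\<^sub>U x \<or> z = x)"

definition is_inductive :: "'a \<Rightarrow> bool" where
  "is_inductive w \<longleftrightarrow> is_set w \<and> (\<exists>z. is_empty z \<and> z \<in>\<^sub>U w) \<and>
     (\<forall>x. x \<in>\<^sub>U w \<longrightarrow> (\<exists>y. is_succ y x \<and> y \<in>\<^sub>U w))"

definition is_omega :: "'a \<Rightarrow> bool" where
  "is_omega w \<longleftrightarrow> is_inductive w \<and> (\<forall>v. is_inductive v \<longrightarrow> (\<forall>x. x \<in>\<^sub>U w \<longrightarrow> x \<in>\<^sub>U v))"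

definition maps :: "'a \<Rightarrow> 'a \<Rightarrow> 'a \<Rightarrow> bool" where
  "maps f x y \<longleftrightarrow> (\<exists>p. is_opair p x y \<and> p \<in>\<^sub>U f)"

definition is_function_on :: "'a \<Rightarrow> 'a \<Rightarrow> bool" where
  "is_function_on f d \<longleftrightarrow> is_set f \<and>
     (\<forall>p. p \<in>\<^sub>U f \<longrightarrow> (\<exists>x y. x \<in>\<^sub>U d \<and> is_opair p x y)) \<and>
     (\<forall>x. x \<in>\<^sub>U d \<longrightarrow> (\<exists>!y. maps f x y))"

text \<open>Countable means finite or countably infinite.\<close>

definition is_countable :: "'a \<Rightarrow> bool" where
  "is_countable s \<longleftrightarrow> (\<exists>w f. is_omega w \<and> is_function_on f s \<and>
     (\<forall>x y. maps f x y \<longrightarrow> y \<in>\<^sub>U w) \<and>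
     (\<forall>x x' y. maps f x y \<and> maps f x' y \<longrightarrow> x = x'))"

definition urelements_empty :: bool where
  "urelements_empty \<longleftrightarrow> (\<forall>a x. ur a \<longrightarrow> \<not> x \<in>\<^sub>U a)"

definition extensionality :: bool where
  "extensionality \<longleftrightarrow>
     (\<forall>s t. is_set s \<and> is_set t \<and> (\<forall>x. x \<in>\<^sub>U s \<longleftrightarrow> x \<in>\<^sub>U t) \<longrightarrow> s = t)"

definition foundation :: bool where
  "foundation \<longleftrightarrow> (\<forall>s. is_set s \<and> (\<exists>x. x \<in>\<^sub>U s) \<longrightarrow>
     (\<exists>x. x \<in>\<^sub>U s \<and> (\<forall>y. y \<in>\<^sub>U s \<longrightarrow> \<not> y \<in>\<^sub>U x)))"

definition pairing :: bool where
  "pairing \<longleftrightarrow> (\<forall>a b. \<exists>p. is_upair p a b)"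

definition union :: bool where
  "union \<longleftrightarrow> (\<forall>s. is_set s \<longrightarrow>
     (\<exists>u. is_set u \<and> (\<forall>x. x \<in>\<^sub>U u \<longleftrightarrow> (\<exists>y. y \<in>\<^sub>U s \<and> x \<in>\<^sub>U y))))"

definition powerset :: bool where
  "powerset \<longleftrightarrow> (\<forall>s. is_set s \<longrightarrow>
     (\<exists>p. is_set p \<and> (\<forall>t. t \<in>\<^sub>U p \<longleftrightarrow> is_set t \<and> (\<forall>x. x \<in>\<^sub>U t \<longrightarrow> x \<in>\<^sub>U s))))"

definition infinity :: bool where
  "infinity \<longleftrightarrow> (\<exists>w. is_inductive w)"

text \<open>In the schemata, variable 0 (and 1) of \<open>\<phi>\<close> plays the role of \<open>x\<close> (and \<open>y\<close>); the
  assignment \<open>e\<close> supplies the finitely many parameters.\<close>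

definition separation :: bool where
  "separation \<longleftrightarrow> (\<forall>\<phi> e w. is_set w \<longrightarrow>
     (\<exists>v. is_set v \<and> (\<forall>x. x \<in>\<^sub>U v \<longleftrightarrow> x \<in>\<^sub>U w \<and> sat (e(0 := x)) \<phi>)))"

definition replacement :: bool where
  "replacement \<longleftrightarrow> (\<forall>\<phi> e w. is_set w \<and> (\<forall>x. x \<in>\<^sub>U w \<longrightarrow> (\<exists>!y. sat (e(0 := x, 1 := y)) \<phi>)) \<longrightarrow>
     (\<exists>v. is_set v \<and> (\<forall>y. y \<in>\<^sub>U v \<longleftrightarrow> (\<exists>x. x \<in>\<^sub>U w \<and> sat (e(0 := x, 1 := y)) \<phi>))))"

definition ZFU_R :: bool where
  "ZFU_R \<longleftrightarrow> urelements_empty \<and> extensionality \<and> foundation \<and> pairing \<and> union \<and>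
     powerset \<and> infinity \<and> separation \<and> replacement"

definition collection :: bool where
  "collection \<longleftrightarrow> (\<forall>\<phi> e w. (\<forall>x. x \<in>\<^sub>U w \<longrightarrow> (\<exists>y. sat (e(0 := x, 1 := y)) \<phi>)) \<longrightarrow>
     (\<exists>v. \<forall>x. x \<in>\<^sub>U w \<longrightarrow> (\<exists>y. y \<in>\<^sub>U v \<and> sat (e(0 := x, 1 := y)) \<phi>)))"

definition AC_omega :: bool where
  "AC_omega \<longleftrightarrow>
     (\<forall>s. is_set s \<and> is_countable s \<and> (\<forall>x. x \<in>\<^sub>U s \<longrightarrow> is_set x \<and> (\<exists>y. y \<in>\<^sub>U x)) \<longrightarrow>
       (\<exists>f. is_function_on f s \<and> (\<forall>x y. maps f x y \<longrightarrow> y \<in>\<^sub>U x)))"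

definition urelements_form_set :: bool where
  "urelements_form_set \<longleftrightarrow> (\<exists>s. is_set s \<and> (\<forall>x. x \<in>\<^sub>U s \<longleftrightarrow> ur x))"

text \<open>In \<open>\<psi>\<close> variable 0 is the element and variable 1 the parameter.\<close>

definition definable_classes :: "'a set set" where
  "definable_classes = {{x. sat ((\<lambda>_. z)(0 := x)) \<psi>} |\<psi> z. fv \<psi> \<subseteq> {0, 1}}"

primrec sat2 :: "(nat \<Rightarrow> 'a) \<Rightarrow> (nat \<Rightarrow> 'a set) \<Rightarrow> fm2 \<Rightarrow> bool" where
  "sat2 e E (Mem2 i j) \<longleftrightarrow> e i \<in>\<^sub>U e j"
| "sat2 e E (Eq2 i j) \<longleftrightarrow> e i = e j"
| "sat2 e E (Ur2 i) \<longleftrightarrow> ur (e i)"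
| "sat2 e E (InCl i k) \<longleftrightarrow> e i \<in> E k"
| "sat2 e E (Neg2 p) \<longleftrightarrow> \<not> sat2 e E p"
| "sat2 e E (Conj2 p q) \<longleftrightarrow> sat2 e E p \<and> sat2 e E q"
| "sat2 e E (ExObj i p) \<longleftrightarrow> (\<exists>a. sat2 (e(i := a)) E p)"
| "sat2 e E (ExCl k p) \<longleftrightarrow> (\<exists>X \<in> definable_classes. sat2 e (E(k := X)) p)"

text \<open>A map from classes to objects is a function of which only the values on definable classes
  matter. In \<open>\<phi>\<close>, class variable 0 is the argument, object variable 0 the value and class
  variable 1 the parameter; the other variables are not free, so the constant assignments merely
  fill in irrelevant values.\<close>

definition definable_map :: "('a set \<Rightarrow> 'a) \<Rightarrow> bool" where
  "definable_map \<epsilon> \<longleftrightarrow> (\<exists>\<phi>. fv_obj \<phi> \<subseteq> {0} \<and> fv_cl \<phi> \<subseteq> {0} \<and>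
     (\<forall>X \<in> definable_classes. \<forall>y. \<epsilon> X = y \<longleftrightarrow> sat2 (\<lambda>_. y) (\<lambda>_. X) \<phi>))"

definition parametrically_definable_map :: "('a set \<Rightarrow> 'a) \<Rightarrow> bool" where
  "parametrically_definable_map \<epsilon> \<longleftrightarrow> (\<exists>\<phi>. \<exists>P \<in> definable_classes.
     fv_obj \<phi> \<subseteq> {0} \<and> fv_cl \<phi> \<subseteq> {0, 1} \<and>
     (\<forall>X \<in> definable_classes. \<forall>y. \<epsilon> X = y \<longleftrightarrow> sat2 (\<lambda>_. y) ((\<lambda>_. P)(0 := X)) \<phi>))"

definition basic_law_V :: "('a set \<Rightarrow> 'a) \<Rightarrow> bool" where
  "basic_law_V \<epsilon> \<longleftrightarrow> (\<forall>X \<in> definable_classes. \<forall>Y \<in> definable_classes.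
     \<epsilon> X = \<epsilon> Y \<longleftrightarrow> (\<forall>x. x \<in> X \<longleftrightarrow> x \<in> Y))"

end

end

theory Submission
  imports Defs
begin

text \<open>If the urelements form a set, the levels of the cumulative hierarchy over them are sets.
  Every definable class is a section \<open>{x. (x, w) \<in> T\<^sub>n}\<close> of one of the partial truth classes
  \<open>T\<^sub>0, T\<^sub>1, \<dots>\<close>, where \<open>T\<^sub>n\<close> is determined by \<open>n\<close> through Tarski's clauses. Send a class to the
  least such \<open>n\<close> together with the set of all \<open>w\<close> of least rank (Scott's trick).

  Conversely, let \<open>\<epsilon>\<close> be definable from a class with parameter \<open>p\<close> and suppose that the urelements
  do not form a set. An automorphism of the model that fixes \<open>p\<close> fixes a class \<open>X\<close> if and only if it
  fixes \<open>\<epsilon> X\<close>. By Collection and countable choice there are two disjoint sequences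
  \<open>s, t\<close> of distinct urelements outside the transitive closure of \<open>p\<close>. Let \<open>X\<close> consist of the \<open>C\<close>
  that contain all but finitely many \<open>s n\<close>. Every transposition of urelements outside the
  closure of \<open>p\<close> fixes \<open>X\<close>, hence \<open>\<epsilon> X\<close>; as the urelements are not a set, the support of
  \<open>\<epsilon> X\<close> is contained in that of \<open>p\<close>. Thus \<open>\<epsilon> X\<close> is also fixed by the automorphism that swaps
  \<open>s n\<close> and \<open>t n\<close> for all \<open>n\<close>, but \<open>X\<close> is not.\<close>

section \<open>Definable relations\<close>

text \<open>The model may be ill-founded and its \<open>om\<close> nonstandard, so induction,
  recursion and comprehension must take place inside it, for relations given by formulas. The
  calculus of \<open>df\<close> and \<open>dt\<close> supplies these formulas by rules that follow
  the shape of a HOL term. Its flag separates two needs: the schemata admit parameters, the map of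
  condition (2) admits none.

  No formula singles out the standard levels of the truth hierarchy. The value of a class is
  therefore described by means of any definable class that obeys Tarski's clauses up to n; two such
  classes agree by induction inside the model, and the least level of a class is standard because
  some standard level contains it.

  In the converse, X has to be blind to each single transposition and yet sensitive to an infinite
  product of them; containment up to finitely many exceptions achieves this. Without choice a proper
  class of urelements may have no countably infinite subset, so the sequences have to be assembled
  from finite lists, one chosen for each length.\<close>

lemma finite_fv: "finite (fv \<phi>)" by (induction \<phi>) auto
lemma finite_fv_obj: "finite (fv_obj \<phi>)" by (induction \<phi>) auto
lemma finite_fv_cl: "finite (fv_cl \<phi>)" by (induction \<phi>) auto

lemma fresh_var:
  assumes "finite A" obtains N :: nat where "N \<notin> A"
  using assms that ex_new_if_finite[OF infinite_UNIV_nat] by blast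

primrec elementary :: "fm2 \<Rightarrow> bool" where
  "elementary (Mem2 i j) \<longleftrightarrow> True"
| "elementary (Eq2 i j) \<longleftrightarrow> True"
| "elementary (Ur2 i) \<longleftrightarrow> True"
| "elementary (InCl i k) \<longleftrightarrow> True"
| "elementary (Neg2 p) \<longleftrightarrow> elementary p"
| "elementary (Conj2 p q) \<longleftrightarrow> elementary p \<and> elementary q"
| "elementary (ExObj i p) \<longleftrightarrow> elementary p"
| "elementary (ExCl k p) \<longleftrightarrow> False"

definition mix :: "(nat \<Rightarrow> 'b) \<Rightarrow> (nat \<Rightarrow> 'b) \<Rightarrow> nat \<Rightarrow> 'b" where
  "mix e p n = (if even n then e (n div 2) else p (n div 2))"

lemma mix_simps [simp]: "mix e p (2 * n) = e n" "mix e p (Suc (2 * n)) = p n"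
  "mix e p 0 = e 0" "mix e p (Suc 0) = p 0"
  by (auto simp: mix_def)

named_theorems dfs

context urelement_structure
begin

section \<open>Coincidence and renaming of variables\<close>

lemma sat_cong: "(\<And>n. n \<in> fv \<phi> \<Longrightarrow> e n = e' n) \<Longrightarrow> sat e \<phi> = sat e' \<phi>"
proof (induction \<phi> arbitrary: e e')
  case (Ex i p)
  have "sat (e(i := a)) p = sat (e'(i := a)) p" for a
    by (rule Ex.IH) (use Ex.prems in auto)
  then show ?case by simp
next
  case (Neg p)
  have "sat e p = sat e' p" by (rule Neg.IH) (use Neg.prems in auto)
  then show ?case by simp
next
  case (Conj p q)
  have "sat e p = sat e' p" "sat e q = sat e' q"
    by (rule Conj.IH; use Conj.prems in auto)+
  then show ?case by simp
qed auto

lemma sat2_cong: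
  "(\<And>n. n \<in> fv_obj \<phi> \<Longrightarrow> e n = e' n) \<Longrightarrow> (\<And>k. k \<in> fv_cl \<phi> \<Longrightarrow> E k = E' k) \<Longrightarrow> sat2 e E \<phi> = sat2 e' E' \<phi>"
proof (induction \<phi> arbitrary: e e' E E')
  case (ExObj i p)
  have "sat2 (e(i := a)) E p = sat2 (e'(i := a)) E' p" for a
    by (rule ExObj.IH) (use ExObj.prems in auto)
  then show ?case by simp
next
  case (ExCl i p)
  have "sat2 e (E(i := a)) p = sat2 e' (E'(i := a)) p" for a
    by (rule ExCl.IH) (use ExCl.prems in auto)
  then show ?case by simp
next
  case (Neg2 p)
  have "sat2 e E p = sat2 e' E' p" by (rule Neg2.IH) (use Neg2.prems in auto)
  then show ?case by simp
next
  case (Conj2 p q)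
  have "sat2 e E p = sat2 e' E' p" "sat2 e E q = sat2 e' E' q"
    by (rule Conj2.IH; use Conj2.prems in auto)+
  then show ?case by simp
qed auto

text \<open>The map \<open>f\<close> may identify variables. Capture is avoided at a quantifier by
  applying the induction hypothesis to \<open>f(i := N)\<close> with \<open>N\<close> outside the
  image of the remaining free variables.\<close>

lemma sat_rename: "\<exists>\<phi>'. fv \<phi>' \<subseteq> f ` fv \<phi> \<and> (\<forall>e. sat e \<phi>' = sat (\<lambda>n. e (f n)) \<phi>)"
proof (induction \<phi> arbitrary: f)
  case (Mem i j)
  show ?case by (rule exI[of _ "Mem (f i) (f j)"]) auto
next
  case (Eq i j)
  show ?case by (rule exI[of _ "Eq (f i) (f j)"]) auto
next
  case (Ur i)
  show ?case by (rule exI[of _ "Ur (f i)"]) auto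
next
  case (Neg p)
  obtain p' where "fv p' \<subseteq> f ` fv p" "\<forall>e. sat e p' = sat (\<lambda>n. e (f n)) p" using Neg by blast
  then show ?case by (intro exI[of _ "Neg p'"]) auto
next
  case (Conj p q)
  obtain p' where "fv p' \<subseteq> f ` fv p" "\<forall>e. sat e p' = sat (\<lambda>n. e (f n)) p" using Conj by blast
  moreover obtain q' where "fv q' \<subseteq> f ` fv q" "\<forall>e. sat e q' = sat (\<lambda>n. e (f n)) q" using Conj by blast
  ultimately show ?case by (intro exI[of _ "Conj p' q'"]) auto
next
  case (Ex i p)
  obtain N where N: "N \<notin> f ` (fv p - {i})" using fresh_var finite_fv by (metis finite_Diff finite_imageI)
  obtain p' where p': "fv p' \<subseteq> (f(i := N)) ` fv p" "\<forall>e. sat e p' = sat (\<lambda>n. e ((f(i := N)) n)) p"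
    using Ex by blast
  have "sat (e(N := a)) p' = sat ((\<lambda>n. e (f n))(i := a)) p" for e a
    unfolding p'(2)[rule_format] by (rule sat_cong) (use N in auto)
  moreover have "fv p' - {N} \<subseteq> f ` (fv p - {i})" using p'(1) by (auto split: if_splits)
  ultimately show ?case by (intro exI[of _ "Ex N p'"]) auto
qed

lemma sat2_rename:
  "\<exists>\<phi>'. (elementary \<phi> \<longrightarrow> elementary \<phi>') \<and> fv_obj \<phi>' \<subseteq> f ` fv_obj \<phi> \<and> fv_cl \<phi>' \<subseteq> h ` fv_cl \<phi> \<and>
     (\<forall>e E. sat2 e E \<phi>' = sat2 (\<lambda>n. e (f n)) (\<lambda>k. E (h k)) \<phi>)"
proof (induction \<phi> arbitrary: f h)
  case (Mem2 i j)
  show ?case by (rule exI[of _ "Mem2 (f i) (f j)"]) auto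
next
  case (Eq2 i j)
  show ?case by (rule exI[of _ "Eq2 (f i) (f j)"]) auto
next
  case (Ur2 i)
  show ?case by (rule exI[of _ "Ur2 (f i)"]) auto
next
  case (InCl i k)
  show ?case by (rule exI[of _ "InCl (f i) (h k)"]) auto
next
  case (Neg2 p)
  obtain p' where "elementary p \<longrightarrow> elementary p'" "fv_obj p' \<subseteq> f ` fv_obj p" "fv_cl p' \<subseteq> h ` fv_cl p"
    "\<forall>e E. sat2 e E p' = sat2 (\<lambda>n. e (f n)) (\<lambda>k. E (h k)) p" using Neg2 by blast
  then show ?case by (intro exI[of _ "Neg2 p'"]) auto
next
  case (Conj2 p q)
  obtain p' where "elementary p \<longrightarrow> elementary p'" "fv_obj p' \<subseteq> f ` fv_obj p" "fv_cl p' \<subseteq> h ` fv_cl p"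
    "\<forall>e E. sat2 e E p' = sat2 (\<lambda>n. e (f n)) (\<lambda>k. E (h k)) p" using Conj2 by blast
  moreover obtain q' where "elementary q \<longrightarrow> elementary q'" "fv_obj q' \<subseteq> f ` fv_obj q"
    "fv_cl q' \<subseteq> h ` fv_cl q"
    "\<forall>e E. sat2 e E q' = sat2 (\<lambda>n. e (f n)) (\<lambda>k. E (h k)) q" using Conj2 by blast
  ultimately show ?case by (intro exI[of _ "Conj2 p' q'"]) auto
next
  case (ExObj i p)
  obtain N where N: "N \<notin> f ` (fv_obj p - {i})"
    using fresh_var finite_fv_obj by (metis finite_Diff finite_imageI)
  obtain p' where p': "elementary p \<longrightarrow> elementary p'" "fv_obj p' \<subseteq> (f(i := N)) ` fv_obj p"
    "fv_cl p' \<subseteq> h ` fv_cl p"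
    "\<forall>e E. sat2 e E p' = sat2 (\<lambda>n. e ((f(i := N)) n)) (\<lambda>k. E (h k)) p"
    using ExObj[of "f(i := N)" h] by blast
  have "sat2 (e(N := a)) E p' = sat2 ((\<lambda>n. e (f n))(i := a)) (\<lambda>k. E (h k)) p" for e E a
    unfolding p'(4)[rule_format] by (rule sat2_cong) (use N in auto)
  moreover have "fv_obj p' - {N} \<subseteq> f ` (fv_obj p - {i})" using p'(2) by (auto split: if_splits)
  ultimately show ?case using p' by (intro exI[of _ "ExObj N p'"]) auto
next
  case (ExCl i p)
  obtain N where N: "N \<notin> h ` (fv_cl p - {i})"
    using fresh_var finite_fv_cl by (metis finite_Diff finite_imageI)
  obtain p' where p': "elementary p \<longrightarrow> elementary p'" "fv_obj p' \<subseteq> f ` fv_obj p"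
    "fv_cl p' \<subseteq> (h(i := N)) ` fv_cl p"
    "\<forall>e E. sat2 e E p' = sat2 (\<lambda>n. e (f n)) (\<lambda>k. E ((h(i := N)) k)) p"
    using ExCl[of f "h(i := N)"] by blast
  have "sat2 e (E(N := a)) p' = sat2 (\<lambda>n. e (f n)) ((\<lambda>k. E (h k))(i := a)) p" for e E a
    unfolding p'(4)[rule_format] by (rule sat2_cong) (use N in auto)
  moreover have "fv_cl p' - {N} \<subseteq> h ` (fv_cl p - {i})" using p'(3) by (auto split: if_splits)
  ultimately show ?case using p' by (intro exI[of _ "ExCl N p'"]) auto
qed

text \<open>\<open>df b Q\<close> says that the relation \<open>Q\<close> on assignments is definable without quantification over
  classes; if \<open>b\<close> is false, fixed object and class parameters are allowed. They are read from
  the odd positions of a mixed assignment. If \<open>b\<close> is true, the formula must not depend on them.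
  \<open>dt b t\<close> says the same of the graph of the term \<open>t\<close>. Binders are treated as with de Bruijn
  indices: see \<open>df_ex\<close>.\<close>

definition df :: "bool \<Rightarrow> ((nat \<Rightarrow> 'a) \<Rightarrow> (nat \<Rightarrow> 'a set) \<Rightarrow> bool) \<Rightarrow> bool" where
  "df b Q \<longleftrightarrow> (\<exists>\<phi> p P. elementary \<phi> \<and> (\<forall>k. P k \<in> definable_classes) \<and>
     (\<forall>e E p' P'. b \<or> p' = p \<and> P' = P \<longrightarrow> Q e E = sat2 (mix e p') (mix E P') \<phi>))"

definition dt :: "bool \<Rightarrow> ((nat \<Rightarrow> 'a) \<Rightarrow> (nat \<Rightarrow> 'a set) \<Rightarrow> 'a) \<Rightarrow> bool" where
  "dt b t \<longleftrightarrow> df b (\<lambda>e E. t (\<lambda>n. e (Suc n)) E = e 0)"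

lemma UNIV_definable: "UNIV \<in> definable_classes"
proof -
  have "UNIV = {x. sat ((\<lambda>_. undefined)(0 := x)) (Eq 0 0)}" "fv (Eq 0 0) \<subseteq> {0,1}" by auto
  then show ?thesis unfolding definable_classes_def by blast
qed

lemma dfI:
  assumes "elementary \<phi>" "\<And>e E p' P'. Q e E = sat2 (mix e p') (mix E P') \<phi>"
  shows "df b Q"
  unfolding df_def using assms UNIV_definable
  by (intro exI[of _ \<phi>] exI[of _ "\<lambda>_. undefined"] exI[of _ "\<lambda>_. UNIV"]) simp

lemma dfI':
  assumes "elementary \<phi>" "\<forall>k. P k \<in> definable_classes"
    "\<And>e E p' P'. b \<or> p' = p \<and> P' = P \<Longrightarrow> Q e E = sat2 (mix e p') (mix E P') \<phi>"
  shows "df b Q"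
  unfolding df_def
  by (intro exI[of _ \<phi>] exI[of _ p] exI[of _ P] conjI allI impI) (fact assms(1), use assms(2) in blast, fact assms(3))

lemma df_mem_var: "df b (\<lambda>e E. e i \<in>\<^sub>U e j)"
  by (rule dfI[of "Mem2 (2 * i) (2 * j)"]) auto

lemma df_eq_var: "df b (\<lambda>e E. e i = e j)"
  by (rule dfI[of "Eq2 (2 * i) (2 * j)"]) auto

lemma df_ur_var: "df b (\<lambda>e E. ur (e i))"
  by (rule dfI[of "Ur2 (2 * i)"]) auto

lemma df_cl_var: "df b (\<lambda>e E. e i \<in> E k)"
  by (rule dfI[of "InCl (2 * i) (2 * k)"]) auto

lemma df_True: "df b (\<lambda>e E. True)"
  by (rule dfI[of "Eq2 0 0"]) auto

lemma df_ren:
  assumes "df b Q"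
  shows "df b (\<lambda>e E. Q (\<lambda>n. e (f n)) (\<lambda>n. E (h n)))"
proof -
  obtain \<phi> p P where 1: "elementary \<phi>" "\<forall>k. P k \<in> definable_classes"
    "\<And>e E p' P'. b \<or> p' = p \<and> P' = P \<Longrightarrow> Q e E = sat2 (mix e p') (mix E P') \<phi>"
    using assms unfolding df_def by blast
  \<comment> \<open>Only the even positions are renamed; the odd ones carry the parameters.\<close>
  let ?f = "\<lambda>f n. if even n then 2 * f (n div 2) else (n::nat)"
  obtain \<phi>' where 2: "elementary \<phi>'"
    "\<And>e E. sat2 e E \<phi>' = sat2 (\<lambda>n. e (?f f n)) (\<lambda>k. E (?f h k)) \<phi>"
    using sat2_rename[of \<phi> "?f f" "?f h"] 1(1) by blast
  have 3: "(\<lambda>n. mix e p' (?f f n)) = mix (\<lambda>n. e (f n)) p'" for f p' and e :: "nat \<Rightarrow> 'b"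
    by (auto simp: mix_def fun_eq_iff)
  have "Q (\<lambda>n. e (f n)) (\<lambda>n. E (h n)) = sat2 (mix e p') (mix E P') \<phi>'"
    if "b \<or> p' = p \<and> P' = P" for e E p' P'
    unfolding 2(2) 3 by (rule 1(3)[OF that])
  with 2(1) 1(2) show ?thesis by (rule dfI')
qed

lemma df_neg:
  assumes "df b Q"
  shows "df b (\<lambda>e E. \<not> Q e E)"
proof -
  obtain \<phi> p P where 1: "elementary \<phi>" "\<forall>k. P k \<in> definable_classes"
    "\<And>e E p' P'. b \<or> p' = p \<and> P' = P \<Longrightarrow> Q e E = sat2 (mix e p') (mix E P') \<phi>"
    using assms unfolding df_def by blast
  have 2: "(\<not> Q e E) = sat2 (mix e p') (mix E P') (Neg2 \<phi>)" if "b \<or> p' = p \<and> P' = P" for e E p' P'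
    using 1(3)[OF that, of e E] by simp
  have 3: "elementary (Neg2 \<phi>)" using 1(1) by simp
  show ?thesis by (rule dfI'[OF 3 1(2) 2])
qed

lemma df_conj:
  assumes "df b Q" "df b R"
  shows "df b (\<lambda>e E. Q e E \<and> R e E)"
proof -
  obtain \<phi>1 p1 P1 where 1: "elementary \<phi>1" "\<forall>k. P1 k \<in> definable_classes"
    "\<And>e E p' P'. b \<or> p' = p1 \<and> P' = P1 \<Longrightarrow> Q e E = sat2 (mix e p') (mix E P') \<phi>1"
    using assms(1) unfolding df_def by blast
  obtain \<phi>2 p2 P2 where 2: "elementary \<phi>2" "\<forall>k. P2 k \<in> definable_classes"
    "\<And>e E p' P'. b \<or> p' = p2 \<and> P' = P2 \<Longrightarrow> R e E = sat2 (mix e p') (mix E P') \<phi>2"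
    using assms(2) unfolding df_def by blast
  \<comment> \<open>Each conjunct has parameters of its own. They are interleaved into one sequence,
    and the odd positions of each formula are redirected to its half of it.\<close>
  let ?f = "\<lambda>n. if even n then n else Suc (2 * (2 * (n div 2)))"
  let ?g = "\<lambda>n. if even n then n else Suc (2 * Suc (2 * (n div 2)))"
  obtain \<psi>1 where 3: "elementary \<psi>1"
    "\<And>e E. sat2 e E \<psi>1 = sat2 (\<lambda>n. e (?f n)) (\<lambda>k. E (?f k)) \<phi>1"
    using sat2_rename[of \<phi>1 "?f" "?f"] 1(1) by blast
  obtain \<psi>2 where 4: "elementary \<psi>2"
    "\<And>e E. sat2 e E \<psi>2 = sat2 (\<lambda>n. e (?g n)) (\<lambda>k. E (?g k)) \<phi>2"
    using sat2_rename[of \<phi>2 "?g" "?g"] 2(1) by blast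
  have 5: "(\<lambda>n. mix e p' (?f n)) = mix e (\<lambda>n. p' (2 * n))" for p' and e :: "nat \<Rightarrow> 'b"
    by (auto simp: mix_def fun_eq_iff)
  have 6: "(\<lambda>n. mix e p' (?g n)) = mix e (\<lambda>n. p' (Suc (2 * n)))" for p' and e :: "nat \<Rightarrow> 'b"
    by (auto simp: mix_def fun_eq_iff)
  have 7: "(Q e E \<and> R e E) = sat2 (mix e p') (mix E P') (Conj2 \<psi>1 \<psi>2)"
    if "b \<or> p' = mix p1 p2 \<and> P' = mix P1 P2" for e E p' P'
  proof -
    have "Q e E = sat2 (mix e (\<lambda>n. p' (2 * n))) (mix E (\<lambda>n. P' (2 * n))) \<phi>1"
      by (rule 1(3)) (use that in auto)
    moreover have "R e E = sat2 (mix e (\<lambda>n. p' (Suc (2 * n)))) (mix E (\<lambda>n. P' (Suc (2 * n)))) \<phi>2"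
      by (rule 2(3)) (use that in auto)
    ultimately show ?thesis by (simp only: sat2.simps 3 4 5 6)
  qed
  have 8: "\<forall>k. mix P1 P2 k \<in> definable_classes" using 1(2) 2(2) by (simp add: mix_def)
  have "elementary (Conj2 \<psi>1 \<psi>2)" using 3 4 by simp
  then show ?thesis using 8 7 by (rule dfI')
qed

lemma df_ex:
  assumes "df b (\<lambda>e E. P (\<lambda>n. e (Suc n)) E (e 0))"
  shows "df b (\<lambda>e E. \<exists>a. P e E a)"
proof -
  obtain \<phi> p R where 1: "elementary \<phi>" "\<forall>k. R k \<in> definable_classes"
    "\<And>e E p' P'. b \<or> p' = p \<and> P' = R \<Longrightarrow> P (\<lambda>n. e (Suc n)) E (e 0) = sat2 (mix e p') (mix E P') \<phi>"
    using assms unfolding df_def by blast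
  \<comment> \<open>The bound variable occupies position 0, so outer variable k sits at position 2k
    + 2 and must return to 2k. Position 0 is also sent to 0, but the quantifier overwrites
    it.\<close>
  let ?f = "\<lambda>n. if even n then n - 2 else n"
  obtain \<phi>' where 2: "elementary \<phi>'"
    "\<And>e E. sat2 e E \<phi>' = sat2 (\<lambda>n. e (?f n)) (\<lambda>k. E (id k)) (ExObj 0 \<phi>)"
    using sat2_rename[of "ExObj 0 \<phi>" ?f id] 1(1) elementary.simps(7)[of 0 \<phi>] by blast
  have 3: "(\<lambda>n. mix e p' (?f n))(0 := a) = mix (case_nat a e) p'" for e a p'
  proof
    fix n show "((\<lambda>n. mix e p' (?f n))(0 := a)) n = mix (case_nat a e) p' n"
      by (cases "n div 2") (auto simp: mix_def)
  qed
  have "(\<exists>a. P e E a) = sat2 (mix e p') (mix E P') \<phi>'" if "b \<or> p' = p \<and> P' = R" for e E p' P'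
  proof -
    have "P e E a = sat2 (mix (case_nat a e) p') (mix E P') \<phi>" for a
      using 1(3)[OF that, of "case_nat a e" E] by simp
    then show ?thesis unfolding 2(2) sat2.simps 3 id_def by simp
  qed
  with 2(1) 1(2) show ?thesis by (rule dfI')
qed

lemma df_disj:
  assumes "df b Q" "df b R" shows "df b (\<lambda>e E. Q e E \<or> R e E)"
proof -
  have "df b (\<lambda>e E. \<not> (\<not> Q e E \<and> \<not> R e E))" by (rule df_neg df_conj assms)+
  then show ?thesis by simp
qed

lemma df_imp:
  assumes "df b Q" "df b R" shows "df b (\<lambda>e E. Q e E \<longrightarrow> R e E)"
proof -
  have "df b (\<lambda>e E. \<not> Q e E \<or> R e E)" by (rule df_disj df_neg assms)+
  then show ?thesis by simp
qed

lemma df_iff: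
  assumes "df b Q" "df b R" shows "df b (\<lambda>e E. Q e E \<longleftrightarrow> R e E)"
proof -
  have "df b (\<lambda>e E. (Q e E \<longrightarrow> R e E) \<and> (R e E \<longrightarrow> Q e E))" by (rule df_conj df_imp assms)+
  then show ?thesis by (simp add: iff_conv_conj_imp)
qed

lemma df_all:
  assumes "df b (\<lambda>e E. P (\<lambda>n. e (Suc n)) E (e 0))"
  shows "df b (\<lambda>e E. \<forall>a. P e E a)"
proof -
  have "df b (\<lambda>e E. \<not> (\<exists>a. \<not> P e E a))" by (rule df_neg, rule df_ex, rule df_neg, rule assms)
  then show ?thesis by simp
qed

lemma dt_var: "dt b (\<lambda>e E. e i)"
  unfolding dt_def by (rule df_eq_var)

lemma dt_const [dfs]: "dt False (\<lambda>e E. c)"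
  unfolding dt_def
  by (rule dfI'[of "Eq2 1 0" "\<lambda>_. UNIV" _ "\<lambda>_. c"]) (auto simp: UNIV_definable)

lemma dt_ren: "dt b t \<Longrightarrow> dt b (\<lambda>e E. t (\<lambda>n. e (f n)) (\<lambda>n. E (h n)))"
  unfolding dt_def by (drule df_ren[where f = "case_nat 0 (\<lambda>n. Suc (f n))" and h = h]) simp

text \<open>A term may replace a variable because its graph is definable: an existential quantifier
  names its value.\<close>

lemma df_sub:
  assumes "df b (\<lambda>e E. R (e 0) (\<lambda>n. e (Suc n)) E)" "dt b t"
  shows "df b (\<lambda>e E. R (t e E) e E)"
proof -
  have "df b (\<lambda>e E. \<exists>a. t e E = a \<and> R a e E)"
    by (rule df_ex, rule df_conj, rule assms(2)[unfolded dt_def], rule assms(1))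
  then show ?thesis by simp
qed

lemma df_app1: "df b (\<lambda>e E. P (e 0) E) \<Longrightarrow> dt b t \<Longrightarrow> df b (\<lambda>e E. P (t e E) E)"
  by (rule df_sub)

lemma df_app2:
  assumes "df b (\<lambda>e E. P (e 0) (e (Suc 0)) E)" "dt b t" "dt b u"
  shows "df b (\<lambda>e E. P (t e E) (u e E) E)"
proof -
  have "df b (\<lambda>e E. P (e (Suc 0)) (e 0) E)"
    \<comment> \<open>Truncated subtraction exchanges positions 0 and 1; the relation reads no
      others.\<close>
    using df_ren[OF assms(1), of "\<lambda>n. Suc 0 - n" id] by simp
  moreover have "dt b (\<lambda>e E. u (\<lambda>n. e (Suc n)) E)"
    using dt_ren[OF assms(3), of Suc id] by simp
  ultimately have "df b (\<lambda>e E. P (e 0) (u (\<lambda>n. e (Suc n)) E) E)"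
    by (rule df_sub[of b "\<lambda>a e E. P (e 0) a E"])
  then show ?thesis using assms(2) by (rule df_sub)
qed

lemma df_app3:
  assumes "df b (\<lambda>e E. P (e 0) (e (Suc 0)) (e (Suc (Suc 0))) E)" "dt b t" "dt b u" "dt b v"
  shows "df b (\<lambda>e E. P (t e E) (u e E) (v e E) E)"
proof -
  have "df b (\<lambda>e E. P (e (Suc (Suc 0))) (e (Suc 0)) (e 0) E)"
    using df_ren[OF assms(1), of "\<lambda>n. Suc (Suc 0) - n" id] by simp
  moreover have "df b (\<lambda>e E. t (\<lambda>n. e (Suc (Suc (Suc n)))) E = e (Suc (Suc 0)))"
    using df_ren[OF assms(2)[unfolded dt_def], of "case_nat (Suc (Suc 0)) (\<lambda>n. Suc (Suc (Suc n)))" id] by simp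
  moreover have "df b (\<lambda>e E. u (\<lambda>n. e (Suc (Suc (Suc n)))) E = e (Suc 0))"
    using df_ren[OF assms(3)[unfolded dt_def], of "case_nat (Suc 0) (\<lambda>n. Suc (Suc (Suc n)))" id] by simp
  moreover have "df b (\<lambda>e E. v (\<lambda>n. e (Suc (Suc (Suc n)))) E = e 0)"
    using df_ren[OF assms(4)[unfolded dt_def], of "case_nat 0 (\<lambda>n. Suc (Suc (Suc n)))" id] by simp
  ultimately have "df b (\<lambda>e E. \<exists>x y z. t e E = x \<and> u e E = y \<and> v e E = z \<and> P x y z E)"
    by (intro df_ex df_conj) simp_all
  then show ?thesis by simp
qed

lemma dt_app1:
  assumes "dt b (\<lambda>e E. g (e 0) E)" "dt b t"
  shows "dt b (\<lambda>e E. g (t e E) E)"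
  unfolding dt_def
proof (rule df_app2[of b "\<lambda>x y E. g x E = y"])
  show "df b (\<lambda>e E. g (e 0) E = e (Suc 0))"
    using df_ren[OF assms(1)[unfolded dt_def], of "\<lambda>n. Suc 0 - n" id] by simp
qed (use dt_ren[OF assms(2), of Suc id] dt_var in simp_all)

lemma dt_app2:
  assumes "dt b (\<lambda>e E. g (e 0) (e (Suc 0)) E)" "dt b t" "dt b u"
  shows "dt b (\<lambda>e E. g (t e E) (u e E) E)"
  unfolding dt_def
proof (rule df_app3[of b "\<lambda>x y z E. g x y E = z"])
  show "df b (\<lambda>e E. g (e 0) (e (Suc 0)) E = e (Suc (Suc 0)))"
    using df_ren[OF assms(1)[unfolded dt_def], of "case_nat (Suc (Suc 0)) (\<lambda>n. n)" id] by simp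
qed (use dt_ren[OF assms(2), of Suc id] dt_ren[OF assms(3), of Suc id] dt_var in simp_all)

lemma dt_app3:
  assumes "dt b (\<lambda>e E. g (e 0) (e (Suc 0)) (e (Suc (Suc 0))) E)" "dt b t" "dt b u" "dt b v"
  shows "dt b (\<lambda>e E. g (t e E) (u e E) (v e E) E)"
proof -
  have "df b (\<lambda>e E. t (\<lambda>n. e (Suc (Suc (Suc (Suc n))))) E = e (Suc (Suc 0)))"
    using df_ren[OF assms(2)[unfolded dt_def], of "case_nat (Suc (Suc 0)) (\<lambda>n. Suc (Suc (Suc (Suc n))))" id] by simp
  moreover have "df b (\<lambda>e E. u (\<lambda>n. e (Suc (Suc (Suc (Suc n))))) E = e (Suc 0))"
    using df_ren[OF assms(3)[unfolded dt_def], of "case_nat (Suc 0) (\<lambda>n. Suc (Suc (Suc (Suc n))))" id] by simp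
  moreover have "df b (\<lambda>e E. v (\<lambda>n. e (Suc (Suc (Suc (Suc n))))) E = e 0)"
    using df_ren[OF assms(4)[unfolded dt_def], of "case_nat 0 (\<lambda>n. Suc (Suc (Suc (Suc n))))" id] by simp
  moreover have "df b (\<lambda>e E. g (e (Suc (Suc 0))) (e (Suc 0)) (e 0) E = e (Suc (Suc (Suc 0))))"
    using df_ren[OF assms(1)[unfolded dt_def], of "case_nat (Suc (Suc (Suc 0))) (\<lambda>n. Suc (Suc 0) - n)" id] by simp
  ultimately have "df b (\<lambda>e E. \<exists>x y z. t (\<lambda>n. e (Suc n)) E = x \<and> u (\<lambda>n. e (Suc n)) E = y \<and>
      v (\<lambda>n. e (Suc n)) E = z \<and> g x y z E = e 0)"
    by (intro df_ex df_conj) simp_all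
  then show ?thesis unfolding dt_def by simp
qed

lemma df_mem: "dt b t \<Longrightarrow> dt b u \<Longrightarrow> df b (\<lambda>e E. t e E \<in>\<^sub>U u e E)"
  by (rule df_app2[of b "\<lambda>x y E. x \<in>\<^sub>U y", OF df_mem_var])
lemma df_eq: "dt b t \<Longrightarrow> dt b u \<Longrightarrow> df b (\<lambda>e E. t e E = u e E)"
  by (rule df_app2[of b "\<lambda>x y E. x = y", OF df_eq_var])
lemma df_ur: "dt b t \<Longrightarrow> df b (\<lambda>e E. ur (t e E))"
  by (rule df_app1[of b "\<lambda>x E. ur x", OF df_ur_var])
lemma df_cl: "dt b t \<Longrightarrow> df b (\<lambda>e E. t e E \<in> E k)"
  by (rule df_app1[of b "\<lambda>x E. x \<in> E k", OF df_cl_var])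
lemma df_is_set: "dt b t \<Longrightarrow> df b (\<lambda>e E. is_set (t e E))"
  unfolding is_set_def by (intro df_neg df_ur)

lemma df_const_class:
  assumes "T \<in> definable_classes" "dt False t"
  shows "df False (\<lambda>e E. t e E \<in> T)"
proof -
  have "df False (\<lambda>e E. e 0 \<in> T)"
    by (rule dfI'[of "InCl 0 1" "\<lambda>_. T" _ "\<lambda>_. undefined"]) (auto simp: assms(1))
  then show ?thesis using assms(2) by (rule df_app1[of False "\<lambda>x E. x \<in> T"])
qed

section \<open>From elementary second-order formulas to first-order ones\<close>

primrec emb :: "fm \<Rightarrow> fm2" where
  "emb (Mem i j) = Mem2 i j"
| "emb (Eq i j) = Eq2 i j"
| "emb (Ur i) = Ur2 i"
| "emb (Neg p) = Neg2 (emb p)"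
| "emb (Conj p q) = Conj2 (emb p) (emb q)"
| "emb (Ex i p) = ExObj i (emb p)"

lemma df_sat: "df b (\<lambda>e E. sat (\<lambda>n. e (f n)) \<phi>)"
proof -
  have 1: "elementary (emb \<phi>)" by (induction \<phi>) auto
  have 2: "sat2 e E (emb \<phi>) = sat e \<phi>" for e E by (induction \<phi> arbitrary: e) auto
  obtain \<phi>' where 3: "elementary \<phi>'" "\<And>e E. sat2 e E \<phi>' = sat2 (\<lambda>n. e (2 * f n)) (\<lambda>k. E (id k)) (emb \<phi>)"
    using sat2_rename[of "emb \<phi>" "\<lambda>n. 2 * f n" id] 1 by blast
  show ?thesis by (rule dfI[OF 3(1)]) (simp add: 2 3(2))
qed

text \<open>Each atom \<open>InCl i k\<close> is replaced by the first-order definition of the class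
  \<open>P k\<close>. Its single parameter \<open>z k\<close> is stored at an odd position, which no
  quantifier of the translated formula touches, since these bind even positions only.\<close>

lemma sat2_to_sat:
  assumes "elementary \<phi>" "\<forall>k. P k \<in> definable_classes"
  obtains \<psi> z where "\<And>e. sat2 e P \<phi> = sat (mix e z) \<psi>"
proof -
  have "\<forall>k. \<exists>\<psi> z. P k = {x. sat ((\<lambda>_. z)(0 := x)) \<psi>}"
    using assms(2) unfolding definable_classes_def by blast
  then obtain \<psi> z where P: "\<And>k. P k = {x. sat ((\<lambda>_. z k)(0 := x)) (\<psi> k)}" by metis
  have "\<exists>\<psi>'. \<forall>e. sat2 e P \<phi> = sat (mix e z) \<psi>'" using assms(1)
  proof (induction \<phi>)
    case (Mem2 i j)
    show ?case by (rule exI[of _ "Mem (2*i) (2*j)"]) simp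
  next
    case (Eq2 i j)
    show ?case by (rule exI[of _ "Eq (2*i) (2*j)"]) simp
  next
    case (Ur2 i)
    show ?case by (rule exI[of _ "Ur (2*i)"]) simp
  next
    case (InCl i k)
    let ?f = "case_nat (2*i) (\<lambda>_. Suc (2*k))"
    obtain \<psi>' where \<psi>': "\<forall>e. sat e \<psi>' = sat (\<lambda>n. e (?f n)) (\<psi> k)"
      using sat_rename[of ?f "\<psi> k"] by blast
    have "(\<lambda>n. mix e z (?f n)) = (\<lambda>_. z k)(0 := e i)" for e
      by (auto simp: fun_eq_iff split: nat.split)
    then show ?case using \<psi>' by (intro exI[of _ \<psi>']) (simp add: P)
  next
    case (Neg2 \<phi>)
    then show ?case by (metis elementary.simps(5) sat.simps(4) sat2.simps(5))
  next
    case (Conj2 \<phi>1 \<phi>2)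
    then show ?case by (metis elementary.simps(6) sat.simps(5) sat2.simps(6))
  next
    case (ExObj i \<phi>)
    then obtain \<psi>' where \<psi>': "\<forall>e. sat2 e P \<phi> = sat (mix e z) \<psi>'" by auto
    have "mix (e(i := a)) z = (mix e z)(2 * i := a)" for e a
      by (auto simp: mix_def fun_eq_iff)
    then show ?case using \<psi>' by (intro exI[of _ "Ex (2*i) \<psi>'"]) simp
  qed simp
  then show ?thesis using that by blast
qed

lemma df_imp_sat:
  assumes "df False Q" "\<forall>k. E k \<in> definable_classes"
  obtains \<psi> z where "\<And>e. Q e E = sat (mix e z) \<psi>"
proof -
  obtain \<phi> p P where 1: "elementary \<phi>" "\<forall>k. P k \<in> definable_classes"
    "\<And>e E p' P'. False \<or> p' = p \<and> P' = P \<Longrightarrow> Q e E = sat2 (mix e p') (mix E P') \<phi>"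
    using assms(1) unfolding df_def by blast
  have 4: "Q e E = sat2 (mix e p) (mix E P) \<phi>" for e by (rule 1(3)) simp
  have "\<forall>k. mix E P k \<in> definable_classes" using 1(2) assms(2) by (simp add: mix_def)
  then obtain \<psi> z where 2: "\<And>e. sat2 e (mix E P) \<phi> = sat (mix e z) \<psi>"
    using sat2_to_sat[OF 1(1), of "mix E P"] by blast
  \<comment> \<open>There are two layers of parameters, \<open>p\<close> from the relation and
    \<open>z\<close> from the definitions of the classes. The renaming regroups
    \<open>mix (mix e p) z\<close> as \<open>mix e (mix p z)\<close>.\<close>
  let ?f = "\<lambda>n. if even n then if even (n div 2) then n div 2 else Suc (2 * (2 * (n div 2 div 2)))
    else Suc (2 * (Suc (2 * (n div 2))))"
  obtain \<psi>' where \<psi>': "\<forall>e. sat e \<psi>' = sat (\<lambda>n. e (?f n)) \<psi>"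
    using sat_rename[of ?f \<psi>] by blast
  have "mix e (mix p z) (?f n) = mix (mix e p) z n" for e n
  proof -
    consider k where "n = 2 * (2 * k)" | k where "n = 2 * Suc (2 * k)" | k where "n = Suc (2 * k)"
      by (metis evenE oddE Suc_eq_plus1)
    then show ?thesis by cases (simp_all add: mix_def)
  qed
  then have 3: "(\<lambda>n. mix e (mix p z) (?f n)) = mix (mix e p) z" for e by (rule ext)
  have "Q e E = sat (mix e (mix p z)) \<psi>'" for e
    unfolding 4 2 \<psi>'[rule_format] 3 by (rule refl)
  then show ?thesis by (rule that)
qed

lemma df_True_imp_sat:
  assumes "df True Q"
  obtains \<psi> where "\<And>e. Q e (\<lambda>_. UNIV) = sat e \<psi>"
proof -
  obtain \<phi> where 1: "elementary \<phi>" "\<And>e E p' P'. Q e E = sat2 (mix e p') (mix E P') \<phi>"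
    using assms unfolding df_def by blast
  have "\<exists>\<psi>. \<forall>e. sat2 e (\<lambda>_. UNIV) \<phi> = sat e \<psi>" using 1(1)
  proof (induction \<phi>)
    case (Mem2 i j)
    show ?case by (rule exI[of _ "Mem i j"]) simp
  next
    case (Eq2 i j)
    show ?case by (rule exI[of _ "Eq i j"]) simp
  next
    case (Ur2 i)
    show ?case by (rule exI[of _ "Ur i"]) simp
  next
    case (InCl i k)
    show ?case by (rule exI[of _ "Eq i i"]) simp
  next
    case (Neg2 \<phi>)
    then obtain \<psi> where "\<forall>e. sat2 e (\<lambda>_. UNIV) \<phi> = sat e \<psi>" by auto
    then show ?case by (intro exI[of _ "Neg \<psi>"]) simp
  next
    case (Conj2 \<phi>1 \<phi>2)
    then obtain \<psi>1 \<psi>2 where "\<forall>e. sat2 e (\<lambda>_. UNIV) \<phi>1 = sat e \<psi>1" "\<forall>e. sat2 e (\<lambda>_. UNIV) \<phi>2 = sat e \<psi>2" by auto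
    then show ?case by (intro exI[of _ "Conj \<psi>1 \<psi>2"]) simp
  next
    case (ExObj i \<phi>)
    then obtain \<psi> where "\<forall>e. sat2 e (\<lambda>_. UNIV) \<phi> = sat e \<psi>" by auto
    then show ?case by (intro exI[of _ "Ex i \<psi>"]) simp
  qed simp
  then obtain \<psi> where 2: "\<And>e. sat2 e (\<lambda>_. UNIV) \<phi> = sat e \<psi>" by blast
  obtain \<psi>' where 3: "\<And>e. sat e \<psi>' = sat (\<lambda>n. e (n div 2)) \<psi>"
    using sat_rename[of "\<lambda>n. n div 2" \<psi>] by blast
  have "Q e (\<lambda>_. UNIV) = sat e \<psi>'" for e
  proof -
    \<comment> \<open>The odd positions do not influence the truth value, so they may repeat the
      even ones; the renaming by \<open>n div 2\<close> then removes the repetition.\<close>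
    have 4: "mix e e = (\<lambda>n. e (n div 2))" "mix (\<lambda>_. UNIV) (\<lambda>_. UNIV) = (\<lambda>_. UNIV)"
      by (auto simp: mix_def)
    show ?thesis using 1(2)[of e "\<lambda>_. UNIV" e "\<lambda>_. UNIV"] unfolding 4 2 3 .
  qed
  then show ?thesis using that by blast
qed

lemma is_opair_inj: "is_opair p a b \<Longrightarrow> is_opair p a' b' \<Longrightarrow> a = a' \<and> b = b'"
  unfolding is_opair_def is_upair_def by metis

lemma is_opair_ex: "pairing \<Longrightarrow> \<exists>p. is_opair p a b"
  unfolding pairing_def is_opair_def by metis

text \<open>A tuple of parameters is compressed into a single one, two entries at a time.\<close>

lemma merge_parameters:
  assumes pairing
  shows "\<forall>e e'. (\<forall>n \<le> Suc N. e n = e' n) \<longrightarrow> sat e \<phi> = sat e' \<phi> \<Longrightarrow>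
   {x. sat (e(0 := x)) \<phi>} \<in> definable_classes"
proof (induction N arbitrary: \<phi> e)
  case 0
  let ?f = "\<lambda>n::nat. if n = 0 then 0 else Suc 0"
  obtain \<phi>' where \<phi>': "fv \<phi>' \<subseteq> ?f ` fv \<phi>" "\<forall>e. sat e \<phi>' = sat (\<lambda>n. e (?f n)) \<phi>"
    using sat_rename[of ?f \<phi>] by blast
  have "sat (e(0 := x)) \<phi> = sat ((\<lambda>_. e 1)(0 := x)) \<phi>'" for x
    unfolding \<phi>'(2)[rule_format] by (rule 0(1)[rule_format]) (auto simp: le_Suc_eq)
  moreover have "fv \<phi>' \<subseteq> {0,1}" using \<phi>'(1) by auto
  ultimately show ?case unfolding definable_classes_def by blast
next
  case (Suc N)
  \<comment> \<open>\<open>?Q\<close> reads its position 1 as the pair of the entries that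
    \<open>\<phi>\<close> expects at positions 1 and 2, and moves all later parameters down by
    one.\<close>
  let ?c = "\<lambda>x a b e. case_nat x (case_nat a (case_nat b (\<lambda>n. e (Suc (Suc n)))))"
  let ?Q = "\<lambda>e. \<exists>a b. is_opair (e (Suc 0)) a b \<and> sat (?c (e 0) a b e) \<phi>"
  let ?f = "case_nat (Suc (Suc 0)) (case_nat (Suc 0) (case_nat 0 (\<lambda>n. Suc (Suc (Suc (Suc n))))))"
  have 1: "(\<lambda>n. e (?f n)) = case_nat (e (Suc (Suc 0))) (case_nat (e (Suc 0)) (case_nat (e 0) (\<lambda>n. e (Suc (Suc (Suc (Suc n)))))))"
    for e :: "nat \<Rightarrow> 'a"
  proof
    fix n
    consider "n = 0" | "n = Suc 0" | "n = Suc (Suc 0)" | k where "n = Suc (Suc (Suc k))"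
      by (metis not0_implies_Suc)
    then show "e (?f n) = case_nat (e (Suc (Suc 0))) (case_nat (e (Suc 0)) (case_nat (e 0) (\<lambda>n. e (Suc (Suc (Suc (Suc n))))))) n"
      by cases simp_all
  qed
  have "(\<lambda>e E. sat (\<lambda>n. e (?f n)) \<phi>) = (\<lambda>e (E :: nat \<Rightarrow> 'a set). sat (case_nat (e (Suc (Suc 0)))
      (case_nat (e (Suc 0)) (case_nat (e 0) (\<lambda>n. e (Suc (Suc (Suc (Suc n)))))))) \<phi>)"
    by (intro ext) (rule arg_cong[where f = "\<lambda>x. sat x \<phi>"], rule 1)
  note 2 = df_sat[of True ?f \<phi>, unfolded this]
  have "df True (\<lambda>e E. ?Q e)"
    unfolding is_opair_def is_upair_def
    by (intro df_ex df_all df_conj df_iff df_disj df_mem df_eq df_is_set dt_var 2)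
  then obtain \<psi> where 3: "\<And>e. ?Q e = sat e \<psi>" using df_True_imp_sat[of "\<lambda>e E. ?Q e"] by blast
  \<comment> \<open>\<open>df_True_imp_sat\<close> gives no bound on the free variables of
    \<open>\<psi>\<close>. This is why the induction measures dependence by truth values and not by
    \<open>fv\<close>.\<close>
  have "\<forall>e e'. (\<forall>n \<le> Suc N. e n = e' n) \<longrightarrow> sat e \<psi> = sat e' \<psi>"
  proof (intro allI impI)
    fix e e' :: "nat \<Rightarrow> 'a" assume e: "\<forall>n \<le> Suc N. e n = e' n"
    have "sat (?c (e 0) a b e) \<phi> = sat (?c (e' 0) a b e') \<phi>" for a b
      by (rule Suc.prems[rule_format]) (use e in \<open>auto split: nat.split\<close>)
    then show "sat e \<psi> = sat e' \<psi>" unfolding 3[symmetric] using e by simp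
  qed
  note 4 = Suc.IH[OF this]
  obtain d where d: "is_opair d (e (Suc 0)) (e (Suc (Suc 0)))" using is_opair_ex assms by blast
  let ?e = "case_nat (e 0) (case_nat d (\<lambda>n. e (Suc (Suc (Suc n)))))"
  have 5: "?c x (e (Suc 0)) (e (Suc (Suc 0))) (?e(0 := x)) = e(0 := x)" for x
  proof
    fix n
    consider "n = 0" | "n = Suc 0" | "n = Suc (Suc 0)" | k where "n = Suc (Suc (Suc k))"
      by (metis not0_implies_Suc)
    then show "?c x (e (Suc 0)) (e (Suc (Suc 0))) (?e(0 := x)) n = (e(0 := x)) n"
      by cases simp_all
  qed
  have "sat (?e(0 := x)) \<psi> = sat (e(0 := x)) \<phi>" for x
  proof -
    have "is_opair ((?e(0 := x)) (Suc 0)) a b \<longleftrightarrow> a = e (Suc 0) \<and> b = e (Suc (Suc 0))" for a b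
    proof -
      have "(?e(0 := x)) (Suc 0) = d" by simp
      then show ?thesis using d is_opair_inj[OF d] by metis
    qed
    moreover have "(?e(0 := x)) 0 = x" by simp
    ultimately have "?Q (?e(0 := x)) = sat (?c x (e (Suc 0)) (e (Suc (Suc 0))) (?e(0 := x))) \<phi>"
      by (simp only:) blast
    then show ?thesis unfolding 3 5 .
  qed
  then show ?case using 4[of ?e] by (simp only:)
qed

text \<open>A definable class has one parameter, \<open>df False\<close> allows any finite number of
  them; pairing bridges the gap.\<close>

lemma df_imp_definable:
  assumes "df False (\<lambda>e E. P (e 0))" pairing
  shows "{x. P x} \<in> definable_classes"
proof -
  obtain \<psi> z where 1: "\<And>e. P (e 0) = sat (mix e z) \<psi>"
    using df_imp_sat[OF assms(1), of "\<lambda>_. UNIV", OF allI, OF UNIV_definable] by blast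
  obtain N where N: "\<forall>n \<in> fv \<psi>. n \<le> Suc N"
    using finite_fv[of \<psi>] by (metis finite_nat_set_iff_bounded_le le_SucI)
  have "{x. sat ((mix undefined z)(0 := x)) \<psi>} \<in> definable_classes"
  proof (rule merge_parameters[OF assms(2), of N], intro allI impI)
    fix e e' :: "nat \<Rightarrow> 'a" assume "\<forall>n \<le> Suc N. e n = e' n"
    then show "sat e \<psi> = sat e' \<psi>" using N by (intro sat_cong) simp
  qed
  moreover have "sat ((mix undefined z)(0 := x)) \<psi> = P x" for x
  proof -
    have "(mix undefined z)(0 := x) = mix (undefined(0 := x)) z"
    proof
      fix n show "((mix undefined z)(0 := x)) n = mix (undefined(0 := x)) z n"
        by (cases "n div 2") (auto simp: mix_def)
    qed
    then show ?thesis using 1[of "undefined(0 := x)"] by simp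
  qed
  ultimately show ?thesis by simp
qed

lemmas df_connectives [dfs] = df_conj df_disj df_imp df_iff df_neg df_ex df_all df_True
  df_mem df_eq df_ur df_is_set df_cl dt_var

lemma df_imp_sat2:
  assumes "df False (\<lambda>e E. P (e 0) (e (Suc 0)))"
  shows "\<exists>\<psi> e. \<forall>x y. P x y = sat (e(0 := x, Suc 0 := y)) \<psi>"
proof -
  obtain \<psi> z where 1: "\<And>e. P (e 0) (e (Suc 0)) = sat (mix e z) \<psi>"
    using df_imp_sat[OF assms, of "\<lambda>_. UNIV", OF allI, OF UNIV_definable] by blast
  \<comment> \<open>The two arguments stand at positions 0 and 2 of the mixed assignment, whereas
    the schemata expect them at 0 and 1. Everything else moves up by two, out of the way.\<close>
  let ?f = "\<lambda>n. if n = 0 then 0 else if n = 2 then Suc 0 else Suc (Suc n)"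
  obtain \<psi>' where 2: "\<And>e. sat e \<psi>' = sat (\<lambda>n. e (?f n)) \<psi>"
    using sat_rename[of ?f \<psi>] by blast
  define e where "e = (\<lambda>n. mix undefined z (n - 2))"
  define d where "d x y = (undefined(0 := x, Suc 0 := y) :: nat \<Rightarrow> 'a)" for x y
  have 3: "(\<lambda>n. (e(0 := x, Suc 0 := y)) (?f n)) = mix (d x y) z" for x y
  proof
    fix n :: nat
    consider "n = 0" | "n = 2" | "n \<noteq> 0" "n \<noteq> 2" by blast
    then show "(e(0 := x, Suc 0 := y)) (?f n) = mix (d x y) z n"
      by cases (auto simp: mix_def e_def d_def)
  qed
  have "P x y = sat (e(0 := x, Suc 0 := y)) \<psi>'" for x y
    unfolding 2 3 1[of "d x y", symmetric] by (simp add: d_def)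
  then show ?thesis by (intro exI allI)
qed

lemma dt_if [dfs]:
  assumes "df b C" "dt b t" "dt b u"
  shows "dt b (\<lambda>e E. if C e E then t e E else u e E)"
proof -
  have "df b (\<lambda>e E. (C (\<lambda>n. e (Suc n)) E \<and> t (\<lambda>n. e (Suc n)) E = e 0) \<or>
      (\<not> C (\<lambda>n. e (Suc n)) E \<and> u (\<lambda>n. e (Suc n)) E = e 0))"
    using df_ren[OF assms(1), of Suc id] assms(2,3) unfolding dt_def id_def
    by (intro df_disj df_conj df_neg)
  moreover have "(\<lambda>e E. (C (\<lambda>n. e (Suc n)) E \<and> t (\<lambda>n. e (Suc n)) E = e 0) \<or>
      (\<not> C (\<lambda>n. e (Suc n)) E \<and> u (\<lambda>n. e (Suc n)) E = e 0)) =
    (\<lambda>e E. (if C (\<lambda>n. e (Suc n)) E then t (\<lambda>n. e (Suc n)) E else u (\<lambda>n. e (Suc n)) E) = e 0)"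
    by (intro ext) (rule if_bool_eq_disj[symmetric, of _ "_ = _" "_ = _", THEN trans], simp)
  ultimately show ?thesis unfolding dt_def by (simp only:)
qed

lemma df_is_empty [dfs]: "dt b t \<Longrightarrow> df b (\<lambda>e E. is_empty (t e E))"
  by (rule df_app1[of b "\<lambda>x E. is_empty x"], unfold is_empty_def, intro df_connectives)

lemma df_is_succ: "dt b t \<Longrightarrow> dt b u \<Longrightarrow> df b (\<lambda>e E. is_succ (t e E) (u e E))"
  by (rule df_app2[of b "\<lambda>x y E. is_succ x y"], unfold is_succ_def, intro df_connectives)

lemma df_is_inductive: "dt b t \<Longrightarrow> df b (\<lambda>e E. is_inductive (t e E))"
  by (rule df_app1[of b "\<lambda>x E. is_inductive x"], unfold is_inductive_def,
      intro df_connectives df_is_empty df_is_succ)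

lemma df_is_omega [dfs]: "dt b t \<Longrightarrow> df b (\<lambda>e E. is_omega (t e E))"
  by (rule df_app1[of b "\<lambda>x E. is_omega x"], unfold is_omega_def,
      intro df_connectives df_is_inductive)

end

section \<open>Basic set theory\<close>

locale zfu = urelement_structure +
  assumes zfu: ZFU_R and coll: collection and ac: AC_omega
begin

lemma axioms: urelements_empty extensionality foundation pairing union powerset infinity
    separation replacement
  using zfu unfolding ZFU_R_def by blast+

lemma mem_is_set: "x \<in>\<^sub>U y \<Longrightarrow> is_set y"
  using axioms(1) unfolding urelements_empty_def is_set_def by blast

lemma set_extI: "is_set s \<Longrightarrow> is_set t \<Longrightarrow> (\<And>x. x \<in>\<^sub>U s \<longleftrightarrow> x \<in>\<^sub>U t) \<Longrightarrow> s = t"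
  using axioms(2) unfolding extensionality_def by blast

definition small :: "('a \<Rightarrow> bool) \<Rightarrow> bool" where
  "small Q \<longleftrightarrow> (\<exists>s. is_set s \<and> (\<forall>x. x \<in>\<^sub>U s \<longleftrightarrow> Q x))"

lemma small_sep_set:
  assumes "df False (\<lambda>e E. P (e 0))" "is_set w"
  shows "small (\<lambda>x. x \<in>\<^sub>U w \<and> P x)"
proof -
  obtain \<psi> e where 1: "\<forall>x y. P x = sat (e(0 := x, Suc 0 := y)) \<psi>"
    using df_imp_sat2[of "\<lambda>x y. P x", OF assms(1)] by (elim exE) (rule that, assumption)
  have "e(0 := x, Suc 0 := y) = (e(Suc 0 := y))(0 := x)" for x y
    by (rule fun_upd_twist) simp
  then have 2: "sat ((e(Suc 0 := undefined))(0 := x)) \<psi> = P x" for x using 1[rule_format, of x undefined] by simp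
  show ?thesis
    using axioms(8)[unfolded separation_def, rule_format, OF assms(2), of "e(Suc 0 := undefined)" \<psi>]
    unfolding small_def 2 .
qed

lemma ex1_empty: "\<exists>!x. is_empty x"
proof -
  obtain w where "is_set w" using axioms(7) unfolding infinity_def is_inductive_def by blast
  then have "small (\<lambda>x. x \<in>\<^sub>U w \<and> \<not> True)" by (intro small_sep_set df_neg df_True)
  then obtain z where "is_empty z" unfolding small_def is_empty_def by blast
  moreover have "x = y" if "is_empty x" "is_empty y" for x y
    using that set_extI unfolding is_empty_def by blast
  ultimately show ?thesis by blast
qed

lemma small_sep:
  assumes "df False (\<lambda>e E. P (e 0))" "\<And>x. P x \<Longrightarrow> x \<in>\<^sub>U w"
  shows "small P"
proof (cases "is_set w")
  case True
  have "(\<lambda>x. x \<in>\<^sub>U w \<and> P x) = P" using assms(2) by blast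
  then show ?thesis using small_sep_set[OF assms(1) True] by simp
next
  case False
  then have "\<not> P x" for x using assms(2) mem_is_set by blast
  then show ?thesis using ex1_empty unfolding small_def is_empty_def by blast
qed

text \<open>A definite description with the empty set as default value, so that a definable
  condition always yields a definable term.\<close>

definition pick :: "('a \<Rightarrow> bool) \<Rightarrow> 'a" where
  "pick Q = (if \<exists>!y. Q y then THE y. Q y else THE y. is_empty y)"

lemma pick_default:
  assumes "\<And>y. \<not> Q y"
  shows "is_empty (pick Q)"
proof -
  have "\<not> (\<exists>!y. Q y)" using assms by blast
  then show ?thesis unfolding pick_def using theI'[OF ex1_empty] by simp
qed

lemma pick_eq: "Q y \<Longrightarrow> (\<And>z. Q z \<Longrightarrow> z = y) \<Longrightarrow> pick Q = y"
  unfolding pick_def by (metis (full_types) the_equality)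

lemma pickI: "Q y \<Longrightarrow> (\<And>z z'. Q z \<Longrightarrow> Q z' \<Longrightarrow> z = z') \<Longrightarrow> Q (pick Q)"
  using pick_eq by metis

text \<open>Eliminates the description operator and unique existence, so that the closure rules in
  \<open>dfs\<close> apply to the graph of \<open>pick\<close>.\<close>

lemma pick_iff: "pick Q = y \<longleftrightarrow> (Q y \<and> (\<forall>z. Q z \<longrightarrow> z = y)) \<or> (\<not> (\<exists>z. Q z \<and> (\<forall>z'. Q z' \<longrightarrow> z' = z)) \<and> is_empty y)"
proof (cases "\<exists>!y. Q y")
  case True
  then show ?thesis using pick_eq[of Q] by metis
next
  case False
  then have "pick Q = (THE y. is_empty y)" unfolding pick_def by (rule if_not_P)
  moreover have "is_empty (THE y. is_empty y)" using ex1_empty by (rule theI')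
  ultimately have "pick Q = y \<longleftrightarrow> is_empty y" using ex1_empty by metis
  then show ?thesis using False by metis
qed

lemma dt_pick [dfs]:
  assumes "df b (\<lambda>e E. Q (\<lambda>n. e (Suc n)) E (e 0))"
  shows "dt b (\<lambda>e E. pick (Q e E))"
proof -
  note 1 = df_ren[OF assms, of "case_nat 0 (\<lambda>n. Suc (Suc n))" id, simplified]
  note 2 = df_ren[OF assms, of "case_nat 0 (\<lambda>n. Suc (Suc (Suc n)))" id, simplified]
  show ?thesis unfolding dt_def pick_iff
    by (intro df_connectives df_is_empty assms 1 2)
qed

text \<open>Since the comprehension term is total, \<open>dt_col\<close> asks for no proof that
  \<open>Q\<close> is small: definability and existence can be settled separately.\<close>

definition col :: "('a \<Rightarrow> bool) \<Rightarrow> 'a" where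
  "col Q = pick (\<lambda>s. is_set s \<and> (\<forall>x. x \<in>\<^sub>U s \<longleftrightarrow> Q x))"

lemma col: assumes "small Q" shows "is_set (col Q) \<and> (\<forall>x. x \<in>\<^sub>U col Q \<longleftrightarrow> Q x)"
proof -
  obtain s where "is_set s \<and> (\<forall>x. x \<in>\<^sub>U s \<longleftrightarrow> Q x)" using assms unfolding small_def by blast
  then show ?thesis unfolding col_def by (rule pickI) (blast intro: set_extI)
qed

lemma mem_col: "small Q \<Longrightarrow> x \<in>\<^sub>U col Q \<longleftrightarrow> Q x"
  using col by blast

lemma is_set_col: "is_set (col Q)"
proof (cases "small Q")
  case False
  then have "is_empty (col Q)"
    unfolding col_def small_def by (intro pick_default) blast
  then show ?thesis unfolding is_empty_def by blast
qed (use col in blast)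

lemma col_eqI:
  assumes "is_set s" "\<And>x. x \<in>\<^sub>U s \<longleftrightarrow> Q x"
  shows "col Q = s"
proof -
  have "small Q" unfolding small_def by (rule exI[of _ s]) (use assms in simp)
  from mem_col[OF this] show ?thesis
    by (intro set_extI[OF is_set_col assms(1)]) (simp add: assms(2))
qed

lemma dt_col [dfs]:
  assumes "df b (\<lambda>e E. Q (\<lambda>n. e (Suc n)) E (e 0))"
  shows "dt b (\<lambda>e E. col (\<lambda>x. Q e E x))"
proof -
  note 1 = df_ren[OF assms, of "case_nat 0 (\<lambda>n. Suc (Suc n))" id, simplified]
  show ?thesis unfolding col_def by (rule dt_pick) (intro df_connectives 1)
qed

definition emp :: 'a where "emp = pick is_empty"

lemma is_empty_iff: "is_empty x \<longleftrightarrow> x = emp"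
  unfolding emp_def using ex1_empty pickI[of is_empty] by metis

lemma not_mem_emp [simp]: "\<not> x \<in>\<^sub>U emp" and is_set_emp [simp]: "is_set emp"
  using is_empty_iff unfolding is_empty_def by blast+

lemma dt_emp [dfs]: "dt b (\<lambda>e E. emp)"
  unfolding emp_def by (rule dt_pick) (intro df_is_empty dt_var)

lemma emp_eqI: "is_set x \<Longrightarrow> (\<And>y. \<not> y \<in>\<^sub>U x) \<Longrightarrow> x = emp"
  by (rule set_extI) auto

definition upair :: "'a \<Rightarrow> 'a \<Rightarrow> 'a" where "upair a b = col (\<lambda>x. x = a \<or> x = b)"

lemma small_upair: "small (\<lambda>x. x = a \<or> x = b)"
  using axioms(4) unfolding pairing_def is_upair_def small_def by blast

lemma mem_upair [simp]: "x \<in>\<^sub>U upair a b \<longleftrightarrow> x = a \<or> x = b"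
  unfolding upair_def by (rule mem_col[OF small_upair])

lemma is_set_upair [simp]: "is_set (upair a b)"
  unfolding upair_def by (rule is_set_col)

lemma is_upair_iff: "is_upair p a b \<longleftrightarrow> p = upair a b"
proof
  assume "is_upair p a b"
  then show "p = upair a b" unfolding is_upair_def by (intro set_extI) auto
qed (auto simp: is_upair_def)

lemma dt_upair [dfs]: "dt b t \<Longrightarrow> dt b u \<Longrightarrow> dt b (\<lambda>e E. upair (t e E) (u e E))"
  by (rule dt_app2[of b "\<lambda>x y E. upair x y"], unfold upair_def, intro dt_col df_connectives)

definition opair :: "'a \<Rightarrow> 'a \<Rightarrow> 'a" where "opair a b = upair (upair a a) (upair a b)"

lemma is_opair_iff: "is_opair p a b \<longleftrightarrow> p = opair a b"
  unfolding is_opair_def is_upair_iff opair_def by blast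

lemma opair_inject [simp]: "opair a b = opair a' b' \<longleftrightarrow> a = a' \<and> b = b'"
  using is_opair_inj[of "opair a b" a b] unfolding is_opair_iff by blast

lemma dt_opair [dfs]: "dt b t \<Longrightarrow> dt b u \<Longrightarrow> dt b (\<lambda>e E. opair (t e E) (u e E))"
  by (rule dt_app2[of b "\<lambda>x y E. opair x y"], unfold opair_def, intro dt_upair dt_var)

definition un :: "'a \<Rightarrow> 'a" where "un s = col (\<lambda>x. \<exists>y. y \<in>\<^sub>U s \<and> x \<in>\<^sub>U y)"

lemma small_un: "small (\<lambda>x. \<exists>y. y \<in>\<^sub>U s \<and> x \<in>\<^sub>U y)"
proof (cases "is_set s")
  case True
  then show ?thesis using axioms(5) unfolding union_def small_def by blast
next
  case False
  then have "\<not> y \<in>\<^sub>U s" for y using mem_is_set by blast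
  then show ?thesis using is_set_emp not_mem_emp unfolding small_def by blast
qed

lemma mem_un [simp]: "x \<in>\<^sub>U un s \<longleftrightarrow> (\<exists>y. y \<in>\<^sub>U s \<and> x \<in>\<^sub>U y)"
  unfolding un_def by (rule mem_col[OF small_un])

lemma dt_un [dfs]: "dt b t \<Longrightarrow> dt b (\<lambda>e E. un (t e E))"
  by (rule dt_app1[of b "\<lambda>x E. un x"], unfold un_def, intro dt_col df_connectives)

definition bcup :: "'a \<Rightarrow> 'a \<Rightarrow> 'a" where "bcup x y = un (upair x y)"

lemma mem_bcup [simp]: "z \<in>\<^sub>U bcup x y \<longleftrightarrow> z \<in>\<^sub>U x \<or> z \<in>\<^sub>U y"
  unfolding bcup_def by auto

lemma is_set_bcup [simp]: "is_set (bcup x y)"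
  unfolding bcup_def un_def by (rule is_set_col)

lemma dt_bcup [dfs]: "dt b t \<Longrightarrow> dt b u \<Longrightarrow> dt b (\<lambda>e E. bcup (t e E) (u e E))"
  by (rule dt_app2[of b "\<lambda>x y E. bcup x y"], unfold bcup_def, intro dt_un dt_upair dt_var)

definition ins :: "'a \<Rightarrow> 'a \<Rightarrow> 'a" where "ins a x = bcup x (upair a a)"

lemma mem_ins [simp]: "z \<in>\<^sub>U ins a x \<longleftrightarrow> z \<in>\<^sub>U x \<or> z = a"
  unfolding ins_def by auto

lemma is_set_ins [simp]: "is_set (ins a x)"
  unfolding ins_def by simp

lemma dt_ins [dfs]: "dt b t \<Longrightarrow> dt b u \<Longrightarrow> dt b (\<lambda>e E. ins (t e E) (u e E))"
  by (rule dt_app2[of b "\<lambda>x y E. ins x y"], unfold ins_def, intro dt_bcup dt_upair dt_var)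

definition suc :: "'a \<Rightarrow> 'a" where "suc x = ins x x"

lemma mem_suc [simp]: "z \<in>\<^sub>U suc x \<longleftrightarrow> z \<in>\<^sub>U x \<or> z = x"
  unfolding suc_def by simp

lemma is_succ_iff: "is_succ y x \<longleftrightarrow> y = suc x"
proof
  assume "is_succ y x"
  then show "y = suc x" unfolding is_succ_def by (intro set_extI) (auto simp: suc_def)
qed (auto simp: is_succ_def suc_def)

lemma dt_suc [dfs]: "dt b t \<Longrightarrow> dt b (\<lambda>e E. suc (t e E))"
  by (rule dt_app1[of b "\<lambda>x E. suc x"], unfold suc_def, intro dt_ins dt_var)

definition pow :: "'a \<Rightarrow> 'a" where "pow s = col (\<lambda>t. is_set t \<and> (\<forall>x. x \<in>\<^sub>U t \<longrightarrow> x \<in>\<^sub>U s))"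

lemma small_pow: "small (\<lambda>t. is_set t \<and> (\<forall>x. x \<in>\<^sub>U t \<longrightarrow> x \<in>\<^sub>U s))"
proof (cases "is_set s")
  case True
  then show ?thesis using axioms(6) unfolding powerset_def small_def by blast
next
  case False
  then have "\<not> y \<in>\<^sub>U s" for y using mem_is_set by blast
  then have "(\<lambda>t. is_set t \<and> (\<forall>x. x \<in>\<^sub>U t \<longrightarrow> x \<in>\<^sub>U s)) = (\<lambda>t. t = emp \<or> t = emp)"
    using emp_eqI by auto
  then show ?thesis using small_upair[of emp emp] by simp
qed

lemma mem_pow [simp]: "t \<in>\<^sub>U pow s \<longleftrightarrow> is_set t \<and> (\<forall>x. x \<in>\<^sub>U t \<longrightarrow> x \<in>\<^sub>U s)"
  unfolding pow_def by (rule mem_col[OF small_pow])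

lemma small_image:
  assumes "dt False (\<lambda>e E. F (e 0))"
  shows "small (\<lambda>y. \<exists>x. x \<in>\<^sub>U w \<and> y = F x)"
proof (cases "is_set w")
  case True
  obtain \<psi> e where 1: "\<forall>x y. (F x = y) = sat (e(0 := x, Suc 0 := y)) \<psi>"
    using df_imp_sat2[of "\<lambda>x y. F x = y", OF df_ren[OF assms[unfolded dt_def], of "\<lambda>n. Suc 0 - n", simplified]]
    by (elim exE) (rule that, assumption)
  have "\<exists>v. is_set v \<and> (\<forall>y. y \<in>\<^sub>U v \<longleftrightarrow> (\<exists>x. x \<in>\<^sub>U w \<and> sat (e(0 := x, 1 := y)) \<psi>))"
    by (rule axioms(9)[unfolded replacement_def, rule_format])
       (use True in \<open>simp add: 1[rule_format, symmetric] One_nat_def\<close>)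
  then show ?thesis unfolding small_def One_nat_def 1[rule_format, symmetric] by (simp add: eq_commute)
next
  case False
  then have "\<not> y \<in>\<^sub>U w" for y using mem_is_set by blast
  then show ?thesis using is_set_emp not_mem_emp unfolding small_def by blast
qed

lemma collect:
  assumes "df False (\<lambda>e E. P (e 0) (e (Suc 0)))" "\<And>x. x \<in>\<^sub>U w \<Longrightarrow> \<exists>y. P x y"
  shows "\<exists>v. \<forall>x. x \<in>\<^sub>U w \<longrightarrow> (\<exists>y. y \<in>\<^sub>U v \<and> P x y)"
proof -
  obtain \<psi> e where 1: "\<forall>x y. P x y = sat (e(0 := x, Suc 0 := y)) \<psi>"
    using df_imp_sat2[OF assms(1)] by (elim exE) (rule that, assumption)
  have "\<exists>v. \<forall>x. x \<in>\<^sub>U w \<longrightarrow> (\<exists>y. y \<in>\<^sub>U v \<and> sat (e(0 := x, 1 := y)) \<psi>)"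
    by (rule coll[unfolded collection_def, rule_format]) (use assms(2) in \<open>simp add: 1[rule_format, symmetric]\<close>)
  then show ?thesis unfolding One_nat_def 1[rule_format, symmetric] .
qed

section \<open>Natural numbers and recursion\<close>

lemma is_inductive_iff: "is_inductive w \<longleftrightarrow> emp \<in>\<^sub>U w \<and> (\<forall>x. x \<in>\<^sub>U w \<longrightarrow> suc x \<in>\<^sub>U w)"
  unfolding is_inductive_def is_empty_iff is_succ_iff using mem_is_set by auto

definition om :: 'a where "om = pick is_omega"

lemma dt_om [dfs]: "dt b (\<lambda>e E. om)"
  unfolding om_def by (intro dfs)

lemma is_omega_om: "is_omega om"
proof -
  obtain w where w: "is_inductive w" using axioms(7) unfolding infinity_def by blast
  have "small (\<lambda>x. \<forall>v. is_inductive v \<longrightarrow> x \<in>\<^sub>U v)"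
    by (rule small_sep[of _ w], intro dfs df_is_inductive, use w in blast)
  then obtain I where I: "\<And>x. x \<in>\<^sub>U I \<longleftrightarrow> (\<forall>v. is_inductive v \<longrightarrow> x \<in>\<^sub>U v)"
    unfolding small_def by blast
  have "is_inductive I"
    unfolding is_inductive_iff[of I] I unfolding is_inductive_iff by blast
  then have "is_omega I" unfolding is_omega_def using I by blast
  moreover have "s = t" if "is_omega s" "is_omega t" for s t
  proof (rule set_extI)
    have "is_inductive s" "is_inductive t" using that unfolding is_omega_def by blast+
    then show "is_set s" "is_set t" unfolding is_inductive_def by blast+
    show "x \<in>\<^sub>U s \<longleftrightarrow> x \<in>\<^sub>U t" for x using that unfolding is_omega_def by blast
  qed
  ultimately show ?thesis unfolding om_def by (rule pickI)
qed

lemma emp_om [simp]: "emp \<in>\<^sub>U om" and suc_om [simp]: "n \<in>\<^sub>U om \<Longrightarrow> suc n \<in>\<^sub>U om"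
  using is_omega_om unfolding is_omega_def is_inductive_iff by blast+

text \<open>The elements of \<open>om\<close> need not be standard, so the property has to be
  definable: Separation turns it into an inductive set.\<close>

lemma om_induct [consumes 2, case_names emp suc]:
  assumes "df False (\<lambda>e E. P (e 0))" "n \<in>\<^sub>U om" "P emp" "\<And>n. n \<in>\<^sub>U om \<Longrightarrow> P n \<Longrightarrow> P (suc n)"
  shows "P n"
proof -
  have "small (\<lambda>x. x \<in>\<^sub>U om \<and> P x)"
    by (rule small_sep[of _ om]) (intro dfs assms(1), blast)
  note * = mem_col[OF this]
  have "is_inductive (col (\<lambda>x. x \<in>\<^sub>U om \<and> P x))"
    unfolding is_inductive_iff * using assms(3,4) by simp
  then have "n \<in>\<^sub>U col (\<lambda>x. x \<in>\<^sub>U om \<and> P x)"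
    using is_omega_om assms(2) unfolding is_omega_def by blast
  then show ?thesis unfolding * by simp
qed

lemma minimal_mem:
  assumes "x \<in>\<^sub>U s"
  obtains m where "m \<in>\<^sub>U s" "\<And>y. y \<in>\<^sub>U s \<Longrightarrow> \<not> y \<in>\<^sub>U m"
  using axioms(3) assms mem_is_set[OF assms] unfolding foundation_def by blast

lemma mem_asym: "x \<in>\<^sub>U y \<Longrightarrow> \<not> y \<in>\<^sub>U x"
  using minimal_mem[of x "upair x y"] by (metis mem_upair)

lemma mem_irrefl [simp]: "\<not> x \<in>\<^sub>U x"
  using mem_asym by blast

lemma suc_inject [simp]: "suc k = suc l \<longleftrightarrow> k = l"
  using mem_asym mem_suc by metis

lemma suc_neq_emp [simp]: "suc k \<noteq> emp" "emp \<noteq> suc k"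
  using mem_suc not_mem_emp by metis+

lemma om_mem: 
  assumes "n \<in>\<^sub>U om" shows "k \<in>\<^sub>U n \<Longrightarrow> k \<in>\<^sub>U om"
proof -
  have "\<forall>k. k \<in>\<^sub>U n \<longrightarrow> k \<in>\<^sub>U om"
    by (rule om_induct[where P = "\<lambda>n. \<forall>k. k \<in>\<^sub>U n \<longrightarrow> k \<in>\<^sub>U om"])
       (intro dfs, use assms in auto)
  then show "k \<in>\<^sub>U n \<Longrightarrow> k \<in>\<^sub>U om" by blast
qed

lemma nat_trans:
  assumes "n \<in>\<^sub>U om" shows "k \<in>\<^sub>U n \<Longrightarrow> l \<in>\<^sub>U k \<Longrightarrow> l \<in>\<^sub>U n"
proof -
  have "\<forall>k l. k \<in>\<^sub>U n \<longrightarrow> l \<in>\<^sub>U k \<longrightarrow> l \<in>\<^sub>U n"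
    by (rule om_induct[where P = "\<lambda>n. \<forall>k l. k \<in>\<^sub>U n \<longrightarrow> l \<in>\<^sub>U k \<longrightarrow> l \<in>\<^sub>U n"])
       (intro dfs, use assms in auto)
  then show "k \<in>\<^sub>U n \<Longrightarrow> l \<in>\<^sub>U k \<Longrightarrow> l \<in>\<^sub>U n" by blast
qed

lemma nat_linear:
  assumes "n \<in>\<^sub>U om" "m \<in>\<^sub>U om"
  shows "m \<in>\<^sub>U n \<or> m = n \<or> n \<in>\<^sub>U m"
proof -
  have 0: "m = emp \<or> emp \<in>\<^sub>U m" if "m \<in>\<^sub>U om" for m
    by (rule om_induct[where P = "\<lambda>m. m = emp \<or> emp \<in>\<^sub>U m"]) (intro dfs, use that in auto)
  have S: "suc k \<in>\<^sub>U suc m" if "m \<in>\<^sub>U om" "k \<in>\<^sub>U m" for k m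
  proof -
    have "\<forall>k. k \<in>\<^sub>U m \<longrightarrow> suc k \<in>\<^sub>U suc m"
      by (rule om_induct[where P = "\<lambda>m. \<forall>k. k \<in>\<^sub>U m \<longrightarrow> suc k \<in>\<^sub>U suc m"])
         (intro dfs, use that in auto)
    then show ?thesis using that by blast
  qed
  have "\<forall>m. m \<in>\<^sub>U om \<longrightarrow> m \<in>\<^sub>U n \<or> m = n \<or> n \<in>\<^sub>U m"
  proof (rule om_induct[where P = "\<lambda>n. \<forall>m. m \<in>\<^sub>U om \<longrightarrow> m \<in>\<^sub>U n \<or> m = n \<or> n \<in>\<^sub>U m"])
    fix n assume "n \<in>\<^sub>U om" and IH: "\<forall>m. m \<in>\<^sub>U om \<longrightarrow> m \<in>\<^sub>U n \<or> m = n \<or> n \<in>\<^sub>U m"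
    show "\<forall>m. m \<in>\<^sub>U om \<longrightarrow> m \<in>\<^sub>U suc n \<or> m = suc n \<or> suc n \<in>\<^sub>U m"
    proof (intro allI impI)
      fix m assume m: "m \<in>\<^sub>U om"
      have "suc n \<in>\<^sub>U suc m" if "n \<in>\<^sub>U m" using S[OF m that] .
      then show "m \<in>\<^sub>U suc n \<or> m = suc n \<or> suc n \<in>\<^sub>U m" using IH m by auto
    qed
  qed (intro dfs, use assms 0 in auto)
  then show ?thesis using assms(2) by blast
qed

section \<open>Transitive supersets and membership induction\<close>

definition transitive :: "'a \<Rightarrow> bool" where
  "transitive t \<longleftrightarrow> (\<forall>y z. y \<in>\<^sub>U t \<longrightarrow> z \<in>\<^sub>U y \<longrightarrow> z \<in>\<^sub>U t)"

lemma df_transitive [dfs]: "dt b t \<Longrightarrow> df b (\<lambda>e E. transitive (t e E))"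
  by (rule df_app1[of b "\<lambda>x E. transitive x"], unfold transitive_def, intro dfs)

text \<open>The pair \<^term>\<open>opair n z\<close> belongs to some \<^term>\<open>R\<close> with \<^term>\<open>descent x R\<close> iff
  there is an \<open>\<in>\<close>-chain of length \<^term>\<open>n\<close> from \<^term>\<open>z\<close> up to \<^term>\<open>x\<close>.\<close>

definition descent :: "'a \<Rightarrow> 'a \<Rightarrow> bool" where
  "descent x R \<longleftrightarrow> (\<forall>n z. opair n z \<in>\<^sub>U R \<longrightarrow>
     n = emp \<and> z = x \<or> (\<exists>k y. n = suc k \<and> opair k y \<in>\<^sub>U R \<and> z \<in>\<^sub>U y))"

lemma df_descent [dfs]: "dt b t \<Longrightarrow> dt b u \<Longrightarrow> df b (\<lambda>e E. descent (t e E) (u e E))"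
  by (rule df_app2[of b "\<lambda>x y E. descent x y"], unfold descent_def, intro dfs)

text \<open>Recursion is not yet available, since it rests on this lemma through
  \<open>mem_induct\<close>. Hence chains are coded by sets \<open>R\<close>. For each length the
  ends of the chains are bounded, a union leading from one bound to the next, and Collection gathers
  the bounds for all lengths.\<close>

lemma transitive_superset: "\<exists>t. x \<in>\<^sub>U t \<and> transitive t"
proof -
  define reach where "reach n z \<longleftrightarrow> (\<exists>R. descent x R \<and> opair n z \<in>\<^sub>U R)" for n z
  have step: "reach (suc k) z" if k: "reach k y" and z: "z \<in>\<^sub>U y" for k y z
  proof -
    obtain R where R: "descent x R" "opair k y \<in>\<^sub>U R" using k unfolding reach_def by blast
    have "descent x (ins (opair (suc k) z) R)"
      using R z unfolding descent_def mem_ins opair_inject by blast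
    then show ?thesis unfolding reach_def by auto
  qed
  have zero: "reach emp x"
    unfolding reach_def descent_def
    by (rule exI[of _ "ins (opair emp x) emp"]) auto
  have dreach: "df False (\<lambda>e E. reach (e i) (e j))" for i j
    unfolding reach_def by (intro dfs)
  have bound: "\<exists>w. \<forall>z. reach n z \<longrightarrow> z \<in>\<^sub>U w" if "n \<in>\<^sub>U om" for n
  proof (rule om_induct[where P = "\<lambda>n. \<exists>w. \<forall>z. reach n z \<longrightarrow> z \<in>\<^sub>U w", OF _ that])
    show "df False (\<lambda>e E. \<exists>w. \<forall>z. reach (e 0) z \<longrightarrow> z \<in>\<^sub>U w)" by (intro dfs dreach)
    have "reach emp z \<longrightarrow> z \<in>\<^sub>U upair x x" for z
      unfolding reach_def descent_def mem_upair using suc_neq_emp by metis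
    then show "\<exists>w. \<forall>z. reach emp z \<longrightarrow> z \<in>\<^sub>U w" by blast
  next
    fix n assume "\<exists>w. \<forall>z. reach n z \<longrightarrow> z \<in>\<^sub>U w"
    then obtain w where w: "\<forall>z. reach n z \<longrightarrow> z \<in>\<^sub>U w" by blast
    have "reach (suc n) z \<longrightarrow> z \<in>\<^sub>U un w" for z
    proof
      assume "reach (suc n) z"
      then obtain R where R: "descent x R" "opair (suc n) z \<in>\<^sub>U R" unfolding reach_def by blast
      then obtain y where "opair n y \<in>\<^sub>U R" "z \<in>\<^sub>U y" unfolding descent_def by (metis suc_neq_emp(1) suc_inject)
      then show "z \<in>\<^sub>U un w" using R(1) w unfolding reach_def by auto
    qed
    then show "\<exists>w. \<forall>z. reach (suc n) z \<longrightarrow> z \<in>\<^sub>U w" by blast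
  qed
  have "\<exists>v. \<forall>n. n \<in>\<^sub>U om \<longrightarrow> (\<exists>w. w \<in>\<^sub>U v \<and> (\<forall>z. reach n z \<longrightarrow> z \<in>\<^sub>U w))"
    by (rule collect[OF _ bound]) (intro dfs dreach)
  then obtain v where v: "\<forall>n. n \<in>\<^sub>U om \<longrightarrow> (\<exists>w. w \<in>\<^sub>U v \<and> (\<forall>z. reach n z \<longrightarrow> z \<in>\<^sub>U w))" by blast
  have "small (\<lambda>z. \<exists>n. n \<in>\<^sub>U om \<and> reach n z)"
    by (rule small_sep[of _ "un v"], intro dfs dreach) (use v in auto)
  note * = mem_col[OF this]
  show ?thesis
    by (rule exI[of _ "col (\<lambda>z. \<exists>n. n \<in>\<^sub>U om \<and> reach n z)"])
       (use step zero suc_om emp_om in \<open>unfold transitive_def *, blast\<close>)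
qed

lemma mem_induct:
  assumes "df False (\<lambda>e E. P (e 0))" "\<And>x. (\<And>y. y \<in>\<^sub>U x \<Longrightarrow> P y) \<Longrightarrow> P x"
  shows "P x"
proof (rule ccontr)
  assume "\<not> P x"
  obtain t where t: "x \<in>\<^sub>U t" "transitive t" using transitive_superset by blast
  have "small (\<lambda>x. x \<in>\<^sub>U t \<and> \<not> P x)"
    by (rule small_sep[of _ t]) (intro dfs assms(1), blast)
  note * = mem_col[OF this]
  obtain m where "m \<in>\<^sub>U col (\<lambda>x. x \<in>\<^sub>U t \<and> \<not> P x)"
    "\<And>y. y \<in>\<^sub>U col (\<lambda>x. x \<in>\<^sub>U t \<and> \<not> P x) \<Longrightarrow> \<not> y \<in>\<^sub>U m"
    using minimal_mem[of x "col (\<lambda>x. x \<in>\<^sub>U t \<and> \<not> P x)"] t(1) \<open>\<not> P x\<close> unfolding * by metis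
  then show False using t(2) assms(2)[of m] unfolding * transitive_def by blast
qed

section \<open>Recursion on membership\<close>

definition recursive :: "('a \<Rightarrow> 'a \<Rightarrow> 'a) \<Rightarrow> 'a \<Rightarrow> bool" where
  "recursive G R \<longleftrightarrow> (\<forall>x y. opair x y \<in>\<^sub>U R \<longrightarrow> (\<exists>r. is_set r \<and> y = G x r \<and>
     (\<forall>u. u \<in>\<^sub>U x \<longrightarrow> (\<exists>v. v \<in>\<^sub>U r \<and> opair u v \<in>\<^sub>U R)) \<and>
     (\<forall>v. v \<in>\<^sub>U r \<longrightarrow> (\<exists>u. u \<in>\<^sub>U x \<and> opair u v \<in>\<^sub>U R))))"

definition rec :: "('a \<Rightarrow> 'a \<Rightarrow> 'a) \<Rightarrow> 'a \<Rightarrow> 'a" where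
  "rec G x = pick (\<lambda>y. \<exists>R. recursive G R \<and> opair x y \<in>\<^sub>U R)"

definition img :: "('a \<Rightarrow> 'a) \<Rightarrow> 'a \<Rightarrow> 'a" where
  "img F x = col (\<lambda>y. \<exists>u. u \<in>\<^sub>U x \<and> y = F u)"

lemma df_recursive:
  assumes "dt b (\<lambda>e E. G (e 0) (e (Suc 0)))" "dt b t"
  shows "df b (\<lambda>e E. recursive G (t e E))"
  by (rule df_app1[of b "\<lambda>x E. recursive G x"], unfold recursive_def,
      intro dfs dt_app2[of b "\<lambda>x y E. G x y", OF assms(1)] assms(2))
    (rule assms(2))

lemma dt_rec:
  assumes "dt b (\<lambda>e E. G (e 0) (e (Suc 0)))" "dt b t"
  shows "dt b (\<lambda>e E. rec G (t e E))"
  by (rule dt_app1[of b "\<lambda>x E. rec G x"], unfold rec_def, intro dfs df_recursive assms(1))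
    (rule assms(2))

lemma dt_img:
  assumes "dt b (\<lambda>e E. F (e 0))" "dt b t"
  shows "dt b (\<lambda>e E. img F (t e E))"
  by (rule dt_app1[of b "\<lambda>x E. img F x"], unfold img_def,
      intro dfs dt_app1[of b "\<lambda>x E. F x", OF assms(1)]) (rule assms(2))

lemma mem_img: "dt False (\<lambda>e E. F (e 0)) \<Longrightarrow> y \<in>\<^sub>U img F x \<longleftrightarrow> (\<exists>u. u \<in>\<^sub>U x \<and> y = F u)"
  unfolding img_def by (rule mem_col[OF small_image])

lemma is_set_img [simp]: "is_set (img F x)"
  unfolding img_def by (rule is_set_col)

context
  fixes G :: "'a \<Rightarrow> 'a \<Rightarrow> 'a"
  assumes G: "dt False (\<lambda>e E. G (e 0) (e (Suc 0)))"
begin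

lemma recursive_unique:
  assumes "recursive G R" "recursive G R'" "opair x y \<in>\<^sub>U R" "opair x y' \<in>\<^sub>U R'"
  shows "y = y'"
proof -
  have "\<forall>y y'. opair x y \<in>\<^sub>U R \<longrightarrow> opair x y' \<in>\<^sub>U R' \<longrightarrow> y = y'"
  proof (rule mem_induct[where P = "\<lambda>x. \<forall>y y'. opair x y \<in>\<^sub>U R \<longrightarrow> opair x y' \<in>\<^sub>U R' \<longrightarrow> y = y'"])
    fix x assume IH: "\<And>u. u \<in>\<^sub>U x \<Longrightarrow> \<forall>y y'. opair u y \<in>\<^sub>U R \<longrightarrow> opair u y' \<in>\<^sub>U R' \<longrightarrow> y = y'"
    show "\<forall>y y'. opair x y \<in>\<^sub>U R \<longrightarrow> opair x y' \<in>\<^sub>U R' \<longrightarrow> y = y'"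
    proof (intro allI impI)
      fix y y' assume y: "opair x y \<in>\<^sub>U R" "opair x y' \<in>\<^sub>U R'"
      obtain r where r: "is_set r" "y = G x r" "\<forall>u. u \<in>\<^sub>U x \<longrightarrow> (\<exists>v. v \<in>\<^sub>U r \<and> opair u v \<in>\<^sub>U R)"
        "\<forall>v. v \<in>\<^sub>U r \<longrightarrow> (\<exists>u. u \<in>\<^sub>U x \<and> opair u v \<in>\<^sub>U R)"
        using assms(1) y(1) unfolding recursive_def by blast
      obtain r' where r': "is_set r'" "y' = G x r'" "\<forall>u. u \<in>\<^sub>U x \<longrightarrow> (\<exists>v. v \<in>\<^sub>U r' \<and> opair u v \<in>\<^sub>U R')"
        "\<forall>v. v \<in>\<^sub>U r' \<longrightarrow> (\<exists>u. u \<in>\<^sub>U x \<and> opair u v \<in>\<^sub>U R')"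
        using assms(2) y(2) unfolding recursive_def by blast
      have "r = r'" by (rule set_extI[OF r(1) r'(1)]) (metis r(3,4) r'(3,4) IH)
      then show "y = y'" using r(2) r'(2) by simp
    qed
  qed (intro dfs)
  then show ?thesis using assms(3,4) by blast
qed

text \<open>In \<open>recursive\<close>, every pair of \<open>R\<close> is justified by further
  pairs of \<open>R\<close>. This condition is preserved by unions, and single-valuedness comes for
  free from \<open>recursive_unique\<close>; so approximations at the members of x can be united and
  one pair added for x.\<close>

lemma recursive_ex: "\<exists>R y. recursive G R \<and> opair x y \<in>\<^sub>U R"
proof (rule mem_induct[where P = "\<lambda>x. \<exists>R y. recursive G R \<and> opair x y \<in>\<^sub>U R"])
  fix x assume IH: "\<And>u. u \<in>\<^sub>U x \<Longrightarrow> \<exists>R y. recursive G R \<and> opair u y \<in>\<^sub>U R"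
  \<comment> \<open>Collection avoids choosing one approximation for each member: all those that lie
    in \<open>v\<close> are used together.\<close>
  have "\<exists>v. \<forall>u. u \<in>\<^sub>U x \<longrightarrow> (\<exists>R. R \<in>\<^sub>U v \<and> recursive G R \<and> (\<exists>y. opair u y \<in>\<^sub>U R))"
    by (rule collect) (intro dfs df_recursive G, use IH in blast)
  then obtain v where v: "\<forall>u. u \<in>\<^sub>U x \<longrightarrow> (\<exists>R. R \<in>\<^sub>U v \<and> recursive G R \<and> (\<exists>y. opair u y \<in>\<^sub>U R))" by blast
  have "small (\<lambda>p. \<exists>R. R \<in>\<^sub>U v \<and> recursive G R \<and> p \<in>\<^sub>U R)"
    by (rule small_sep[of _ "un v"], intro dfs df_recursive G) auto
  note * = mem_col[OF this]
  define R where "R = col (\<lambda>p. \<exists>R. R \<in>\<^sub>U v \<and> recursive G R \<and> p \<in>\<^sub>U R)"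
  have R: "p \<in>\<^sub>U R \<longleftrightarrow> (\<exists>R. R \<in>\<^sub>U v \<and> recursive G R \<and> p \<in>\<^sub>U R)" for p
    unfolding R_def by (rule *)
  have "recursive G R"
    unfolding recursive_def
  proof (intro allI impI)
    fix a b assume "opair a b \<in>\<^sub>U R"
    then obtain R' where R': "R' \<in>\<^sub>U v" "recursive G R'" "opair a b \<in>\<^sub>U R'" unfolding R by blast
    then obtain r where "is_set r" "b = G a r"
      "\<forall>u. u \<in>\<^sub>U a \<longrightarrow> (\<exists>v. v \<in>\<^sub>U r \<and> opair u v \<in>\<^sub>U R')"
      "\<forall>v. v \<in>\<^sub>U r \<longrightarrow> (\<exists>u. u \<in>\<^sub>U a \<and> opair u v \<in>\<^sub>U R')"
      unfolding recursive_def by blast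
    then show "\<exists>r. is_set r \<and> b = G a r \<and> (\<forall>u. u \<in>\<^sub>U a \<longrightarrow> (\<exists>v. v \<in>\<^sub>U r \<and> opair u v \<in>\<^sub>U R)) \<and>
        (\<forall>v. v \<in>\<^sub>U r \<longrightarrow> (\<exists>u. u \<in>\<^sub>U a \<and> opair u v \<in>\<^sub>U R))"
      using R'(1,2) unfolding R by blast
  qed
  have "small (\<lambda>y. \<exists>u. u \<in>\<^sub>U x \<and> opair u y \<in>\<^sub>U R)"
  proof (rule small_sep[of _ "un (un R)"])
    fix y assume "\<exists>u. u \<in>\<^sub>U x \<and> opair u y \<in>\<^sub>U R"
    then show "y \<in>\<^sub>U un (un R)" unfolding mem_un opair_def by (metis mem_upair)
  qed (intro dfs)
  note ** = mem_col[OF this]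
  define r where "r = col (\<lambda>y. \<exists>u. u \<in>\<^sub>U x \<and> opair u y \<in>\<^sub>U R)"
  have r: "y \<in>\<^sub>U r \<longleftrightarrow> (\<exists>u. u \<in>\<^sub>U x \<and> opair u y \<in>\<^sub>U R)" "is_set r" for y
    unfolding r_def by (rule **, rule is_set_col)
  have x: "\<exists>y. opair u y \<in>\<^sub>U R" if "u \<in>\<^sub>U x" for u
    using v that unfolding R by blast
  have "recursive G (ins (opair x (G x r)) R)"
    unfolding recursive_def
  proof (intro allI impI)
    fix a b assume "opair a b \<in>\<^sub>U ins (opair x (G x r)) R"
    then consider "opair a b \<in>\<^sub>U R" | "a = x" "b = G x r" by auto
    then show "\<exists>r'. is_set r' \<and> b = G a r' \<and>
        (\<forall>u. u \<in>\<^sub>U a \<longrightarrow> (\<exists>v. v \<in>\<^sub>U r' \<and> opair u v \<in>\<^sub>U ins (opair x (G x r)) R)) \<and>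
        (\<forall>v. v \<in>\<^sub>U r' \<longrightarrow> (\<exists>u. u \<in>\<^sub>U a \<and> opair u v \<in>\<^sub>U ins (opair x (G x r)) R))"
    proof cases
      case 1
      then obtain r' where "is_set r'" "b = G a r'" "\<forall>u. u \<in>\<^sub>U a \<longrightarrow> (\<exists>v. v \<in>\<^sub>U r' \<and> opair u v \<in>\<^sub>U R)"
        "\<forall>v. v \<in>\<^sub>U r' \<longrightarrow> (\<exists>u. u \<in>\<^sub>U a \<and> opair u v \<in>\<^sub>U R)"
        using \<open>recursive G R\<close> unfolding recursive_def by blast
      then show ?thesis by (intro exI[of _ r']) (simp only: mem_ins, blast)
    next
      case 2
      show ?thesis
        by (rule exI[of _ r]) (use 2 r x in \<open>simp only: mem_ins, blast\<close>)
    qed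
  qed
  then show "\<exists>R y. recursive G R \<and> opair x y \<in>\<^sub>U R" by (metis mem_ins)
qed (intro dfs df_recursive G)

lemma rec_eq: "rec G x = G x (img (rec G) x)"
proof -
  have rec: "rec G x = y" if "recursive G R" "opair x y \<in>\<^sub>U R" for x y R
    unfolding rec_def using that recursive_unique by (intro pick_eq) blast+
  obtain R y where R: "recursive G R" "opair x y \<in>\<^sub>U R" using recursive_ex by blast
  then obtain r where r: "is_set r" "y = G x r" "\<forall>u. u \<in>\<^sub>U x \<longrightarrow> (\<exists>v. v \<in>\<^sub>U r \<and> opair u v \<in>\<^sub>U R)"
        "\<forall>v. v \<in>\<^sub>U r \<longrightarrow> (\<exists>u. u \<in>\<^sub>U x \<and> opair u v \<in>\<^sub>U R)"
    unfolding recursive_def by blast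
  have "v \<in>\<^sub>U r \<longleftrightarrow> (\<exists>u. u \<in>\<^sub>U x \<and> v = rec G u)" for v
    using r(3,4) rec[OF R(1)] by metis
  then have "img (rec G) x = r" unfolding img_def by (intro col_eqI r(1))
  then show ?thesis using rec[OF R] r(2) by simp
qed

end

section \<open>From a set of urelements to Basic Law V\<close>

definition stage_step :: "'a \<Rightarrow> 'a \<Rightarrow> 'a" where
  "stage_step x r = col (\<lambda>z. ur z \<or> is_set z \<and> (\<exists>M. M \<in>\<^sub>U r \<and> (\<forall>w. w \<in>\<^sub>U z \<longrightarrow> w \<in>\<^sub>U M)))"

text \<open>\<open>stage x\<close> is the level of the cumulative hierarchy over the set of urelements
  whose index is the rank of \<open>x\<close>; it replaces the ordinals in Scott's trick.\<close>

definition stage :: "'a \<Rightarrow> 'a" where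
  "stage = rec stage_step"

lemma dt_stage_step: "dt b (\<lambda>e E. stage_step (e 0) (e (Suc 0)))"
  unfolding stage_step_def by (intro dfs)

lemma dt_stage [dfs]: "dt b t \<Longrightarrow> dt b (\<lambda>e E. stage (t e E))"
  unfolding stage_def by (rule dt_rec[OF dt_stage_step])

definition least_stage :: "('a \<Rightarrow> bool) \<Rightarrow> 'a" where
  "least_stage Q = col (\<lambda>z. Q z \<and> (\<forall>y. Q y \<longrightarrow> (\<forall>w. w \<in>\<^sub>U stage z \<longrightarrow> w \<in>\<^sub>U stage y)))"

context
  assumes ur_set: urelements_form_set
begin

text \<open>Every level contains all urelements, so its being a set depends on theirs. The sets in
  it are bounded by a powerset, as the earlier levels form a set by Replacement.\<close>

lemma mem_stage:
  "z \<in>\<^sub>U stage x \<longleftrightarrow> ur z \<or> is_set z \<and> (\<exists>u. u \<in>\<^sub>U x \<and> (\<forall>w. w \<in>\<^sub>U z \<longrightarrow> w \<in>\<^sub>U stage u))"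
proof -
  obtain s where s: "\<forall>x. x \<in>\<^sub>U s \<longleftrightarrow> ur x" using ur_set unfolding urelements_form_set_def by blast
  define r where "r = img stage x"
  have r: "M \<in>\<^sub>U r \<longleftrightarrow> (\<exists>u. u \<in>\<^sub>U x \<and> M = stage u)" for M
    unfolding r_def by (rule mem_img) (intro dfs)
  have "small (\<lambda>z. ur z \<or> is_set z \<and> (\<exists>M. M \<in>\<^sub>U r \<and> (\<forall>w. w \<in>\<^sub>U z \<longrightarrow> w \<in>\<^sub>U M)))"
  proof (rule small_sep[of _ "bcup s (pow (un r))"])
    fix z assume "ur z \<or> is_set z \<and> (\<exists>M. M \<in>\<^sub>U r \<and> (\<forall>w. w \<in>\<^sub>U z \<longrightarrow> w \<in>\<^sub>U M))"
    then show "z \<in>\<^sub>U bcup s (pow (un r))" unfolding mem_bcup mem_pow mem_un using s by blast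
  qed (intro dfs)
  note * = mem_col[OF this]
  have "stage x = stage_step x r"
    unfolding stage_def r_def by (rule rec_eq[OF dt_stage_step])
  then have "z \<in>\<^sub>U stage x \<longleftrightarrow> ur z \<or> is_set z \<and> (\<exists>M. M \<in>\<^sub>U r \<and> (\<forall>w. w \<in>\<^sub>U z \<longrightarrow> w \<in>\<^sub>U M))"
    unfolding stage_step_def by (simp only: *)
  then show ?thesis unfolding r by blast
qed

text \<open>Comparability of ranks without ordinals. \<open>flip\<close> derives the claim for one
  order of the arguments from the claim in the other order for members. Used twice, it leads from
  the members of x to x itself, so induction on one argument suffices.\<close>

lemma stage_linear:
  "(\<forall>w. w \<in>\<^sub>U stage x \<longrightarrow> w \<in>\<^sub>U stage y) \<or> (\<exists>u. u \<in>\<^sub>U x \<and> (\<forall>w. w \<in>\<^sub>U stage y \<longrightarrow> w \<in>\<^sub>U stage u))"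
proof -
  define le where "le x y \<longleftrightarrow> (\<forall>w. w \<in>\<^sub>U stage x \<longrightarrow> w \<in>\<^sub>U stage y)" for x y
  have trans: "le x z" if "le x y" "le y z" for x y z using that unfolding le_def by blast
  have leI: "le x y" if "\<forall>u. u \<in>\<^sub>U x \<longrightarrow> (\<exists>v. v \<in>\<^sub>U y \<and> le u v)" for x y
    unfolding le_def
  proof (intro allI impI)
    fix w assume "w \<in>\<^sub>U stage x"
    then show "w \<in>\<^sub>U stage y"
      unfolding mem_stage[of w] using that unfolding le_def by blast
  qed
  have flip: "le x y \<or> (\<exists>u. u \<in>\<^sub>U x \<and> le y u)"
    if "\<forall>u. u \<in>\<^sub>U x \<longrightarrow> le y u \<or> (\<exists>v. v \<in>\<^sub>U y \<and> le u v)" for x y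
    using that leI by blast
  have "\<forall>y. le x y \<or> (\<exists>u. u \<in>\<^sub>U x \<and> le y u)"
  proof (rule mem_induct[where P = "\<lambda>x. \<forall>y. le x y \<or> (\<exists>u. u \<in>\<^sub>U x \<and> le y u)"])
    show "df False (\<lambda>e E. \<forall>y. le (e 0) y \<or> (\<exists>u. u \<in>\<^sub>U e 0 \<and> le y u))"
      unfolding le_def by (intro dfs)
  next
    fix x assume IH: "\<And>u. u \<in>\<^sub>U x \<Longrightarrow> \<forall>y. le u y \<or> (\<exists>v. v \<in>\<^sub>U u \<and> le y v)"
    have "le y u \<or> (\<exists>v. v \<in>\<^sub>U y \<and> le u v)" if "u \<in>\<^sub>U x" for u y
      by (rule flip) (use IH[OF that] in blast)
    then show "\<forall>y. le x y \<or> (\<exists>u. u \<in>\<^sub>U x \<and> le y u)" using flip by blast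
  qed
  then show ?thesis unfolding le_def by blast
qed

lemma subset_stage: "u \<in>\<^sub>U x \<Longrightarrow> u \<in>\<^sub>U stage x"
proof -
  have "\<forall>u. u \<in>\<^sub>U x \<longrightarrow> u \<in>\<^sub>U stage x"
  proof (rule mem_induct[where P = "\<lambda>x. \<forall>u. u \<in>\<^sub>U x \<longrightarrow> u \<in>\<^sub>U stage x"])
    fix x assume "\<And>y. y \<in>\<^sub>U x \<Longrightarrow> \<forall>u. u \<in>\<^sub>U y \<longrightarrow> u \<in>\<^sub>U stage y"
    then show "\<forall>u. u \<in>\<^sub>U x \<longrightarrow> u \<in>\<^sub>U stage x"
      unfolding mem_stage[of _ x] is_set_def by blast
  qed (intro dfs)
  then show "u \<in>\<^sub>U x \<Longrightarrow> u \<in>\<^sub>U stage x" by blast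
qed

lemma least_stage:
  assumes Q: "df False (\<lambda>e E. Q (e 0))" and "Q z0"
  shows "z \<in>\<^sub>U least_stage Q \<Longrightarrow> Q z" "\<exists>z. z \<in>\<^sub>U least_stage Q"
proof -
  define le where "le x y \<longleftrightarrow> (\<forall>w. w \<in>\<^sub>U stage x \<longrightarrow> w \<in>\<^sub>U stage y)" for x y
  define R where "R z \<longleftrightarrow> Q z \<and> (\<forall>y. Q y \<longrightarrow> le z y)" for z
  have Q2: "dt False t \<Longrightarrow> df False (\<lambda>e E. Q (t e E))" for t
    by (rule df_app1[of False "\<lambda>x E. Q x", OF Q])
  have le: "dt False t \<Longrightarrow> dt False u \<Longrightarrow> df False (\<lambda>e E. le (t e E) (u e E))" for t u
    by (rule df_app2[of False "\<lambda>x y E. le x y"], unfold le_def, intro dfs)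
  have "\<exists>z. R z"
  proof -
    \<comment> \<open>The minimal \<open>z\<close> need not satisfy \<open>Q\<close>; it serves as a
      bound on the stage of some \<open>x\<close> that does. By linearity, an element of
      \<open>Q\<close> whose stage does not include that of \<open>z\<close> would lie below a
      member of \<open>z\<close>, against minimality.\<close>
    have "\<exists>z. (\<exists>x. Q x \<and> le x z) \<and> (\<forall>u. u \<in>\<^sub>U z \<longrightarrow> \<not> (\<exists>x. Q x \<and> le x u))"
    proof (rule ccontr)
      assume *: "\<not> ?thesis"
      have "\<not> (\<exists>x. Q x \<and> le x z)" for z
        by (rule mem_induct[where P = "\<lambda>z. \<not> (\<exists>x. Q x \<and> le x z)"])
          (intro dfs Q2 le, use * in blast)
      then show False using \<open>Q z0\<close> unfolding le_def by blast
    qed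
    then obtain z x where z: "Q x" "le x z" "\<forall>u. u \<in>\<^sub>U z \<longrightarrow> \<not> (\<exists>x. Q x \<and> le x u)" by blast
    have "le x y" if "Q y" for y
    proof -
      have "le z y \<or> (\<exists>u. u \<in>\<^sub>U z \<and> le y u)" unfolding le_def by (rule stage_linear)
      then have "le z y" using z(3) that by blast
      then show ?thesis using z(2) unfolding le_def by blast
    qed
    then show ?thesis unfolding R_def using z(1) by blast
  qed
  then obtain x where x: "R x" by blast
  obtain s where s: "\<forall>x. x \<in>\<^sub>U s \<longleftrightarrow> ur x" using ur_set unfolding urelements_form_set_def by blast
  have "small R"
  \<comment> \<open>An object whose stage is included in that of \<open>x\<close> has all its
    members there, by \<open>subset_stage\<close>. Urelements are covered by
    \<open>s\<close>.\<close>
  proof (rule small_sep[of _ "bcup s (pow (stage x))"])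
    show "df False (\<lambda>e E. R (e 0))" unfolding R_def by (intro dfs Q2 le)
    fix z assume "R z"
    then have "le z x" using x unfolding R_def by blast
    then have "\<forall>w. w \<in>\<^sub>U z \<longrightarrow> w \<in>\<^sub>U stage x" using subset_stage unfolding le_def by blast
    then show "z \<in>\<^sub>U bcup s (pow (stage x))" using s unfolding mem_bcup mem_pow is_set_def by blast
  qed
  moreover have "least_stage Q = col R" unfolding least_stage_def R_def le_def ..
  ultimately have *: "z \<in>\<^sub>U least_stage Q \<longleftrightarrow> R z" for z using mem_col by simp
  show "z \<in>\<^sub>U least_stage Q \<Longrightarrow> Q z" "\<exists>z. z \<in>\<^sub>U least_stage Q"
    unfolding * using x by (auto simp: R_def)
qed

end

section \<open>Numerals and partial truth classes\<close>

primrec nm :: "nat \<Rightarrow> 'a" where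
  "nm 0 = emp"
| "nm (Suc i) = suc (nm i)"

lemma dt_nm [dfs]: "dt b (\<lambda>e E. nm i)"
  by (induction i) (simp_all add: dt_emp dt_suc)

lemma nm_om [simp]: "nm i \<in>\<^sub>U om"
  by (induction i) auto

lemma mem_nm: "k \<in>\<^sub>U nm i \<longleftrightarrow> (\<exists>j<i. k = nm j)"
  by (induction i) (auto simp: less_Suc_eq)

lemma nm_inject [simp]: "nm i = nm j \<longleftrightarrow> i = j"
  by (metis mem_nm mem_irrefl linorder_neqE_nat)

definition upd :: "'a \<Rightarrow> 'a \<Rightarrow> 'a \<Rightarrow> 'a" where
  "upd g i a = col (\<lambda>p. p = opair i a \<or> (p \<in>\<^sub>U g \<and> \<not> (\<exists>b. p = opair i b)))"

lemma mem_upd: "p \<in>\<^sub>U upd g i a \<longleftrightarrow> p = opair i a \<or> (p \<in>\<^sub>U g \<and> \<not> (\<exists>b. p = opair i b))"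
  unfolding upd_def by (rule mem_col, rule small_sep[of _ "ins (opair i a) g"]) (intro dfs, auto)

lemma dt_upd [dfs]: "dt b t \<Longrightarrow> dt b u \<Longrightarrow> dt b v \<Longrightarrow> dt b (\<lambda>e E. upd (t e E) (u e E) (v e E))"
  by (rule dt_app3[of b "\<lambda>x y z E. upd x y z"], unfold upd_def, intro dfs)

text \<open>One step of Tarski's truth definition: \<open>S g u\<close> is the truth value of the
  formula coded by \<open>u\<close> under the assignment \<open>g\<close>, a set of pairs of variables and values.\<close>

definition truth_step :: "('a \<Rightarrow> 'a \<Rightarrow> bool) \<Rightarrow> 'a \<Rightarrow> 'a \<Rightarrow> bool" where
  "truth_step S g y \<longleftrightarrow>
     (\<exists>i j a b. y = opair (nm 0) (opair i j) \<and> opair i a \<in>\<^sub>U g \<and> opair j b \<in>\<^sub>U g \<and> a \<in>\<^sub>U b) \<or>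
     (\<exists>i j a. y = opair (nm 1) (opair i j) \<and> opair i a \<in>\<^sub>U g \<and> opair j a \<in>\<^sub>U g) \<or>
     (\<exists>i a. y = opair (nm 2) i \<and> opair i a \<in>\<^sub>U g \<and> ur a) \<or>
     (\<exists>u. y = opair (nm 3) u \<and> \<not> S g u) \<or>
     (\<exists>u v. y = opair (nm 4) (opair u v) \<and> S g u \<and> S g v) \<or>
     (\<exists>i u a. y = opair (nm 5) (opair i u) \<and> S (upd g i a) u)"

abbreviation slice :: "'a set \<Rightarrow> 'a \<Rightarrow> 'a \<Rightarrow> 'a \<Rightarrow> bool" where
  "slice T k g y \<equiv> opair k (opair g y) \<in> T"

text \<open>Truth of all formulas at once is undefinable by Tarski's theorem, but a finite number of
  levels is within reach. Nothing is true at level \<open>emp\<close>; each further level is correct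
  for formulas of one more step of complexity.\<close>

definition truth_levels :: "'a \<Rightarrow> 'a set \<Rightarrow> bool" where
  "truth_levels n T \<longleftrightarrow> (\<forall>g y. \<not> slice T emp g y) \<and>
     (\<forall>k. k \<in>\<^sub>U n \<longrightarrow> (\<forall>g y. slice T (suc k) g y \<longleftrightarrow> truth_step (slice T k) g y))"

lemma truth_step_cong: "(\<And>g u. S g u = S' g u) \<Longrightarrow> truth_step S g y = truth_step S' g y"
  by (rule arg_cong[where f = "\<lambda>S. truth_step S g y"]) (intro ext, blast)

text \<open>Here \<open>n\<close> may be nonstandard. Both classes are definable, so agreement of
  their slices is a definable property of \<open>k\<close> and induction inside the model
  applies.\<close>

lemma truth_levels_unique:
  assumes "T \<in> definable_classes" "T' \<in> definable_classes" "n \<in>\<^sub>U om"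
    "truth_levels n T" "truth_levels n T'" "k \<in>\<^sub>U suc n"
  shows "slice T k g y = slice T' k g y"
proof -
  have "k \<in>\<^sub>U om" using assms(3,6) om_mem[of "suc n" k] by simp
  have "k \<in>\<^sub>U suc n \<longrightarrow> (\<forall>g y. slice T k g y = slice T' k g y)"
  proof (rule om_induct[where P = "\<lambda>k. k \<in>\<^sub>U suc n \<longrightarrow> (\<forall>g y. slice T k g y = slice T' k g y)", OF _ \<open>k \<in>\<^sub>U om\<close>])
    show "df False (\<lambda>e E. e 0 \<in>\<^sub>U suc n \<longrightarrow> (\<forall>g y. slice T (e 0) g y = slice T' (e 0) g y))"
      by (intro dfs df_const_class[OF assms(1)] df_const_class[OF assms(2)])
    show "emp \<in>\<^sub>U suc n \<longrightarrow> (\<forall>g y. slice T emp g y = slice T' emp g y)"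
      using assms(4,5) unfolding truth_levels_def by blast
  next
    fix k assume "k \<in>\<^sub>U om" and IH: "k \<in>\<^sub>U suc n \<longrightarrow> (\<forall>g y. slice T k g y = slice T' k g y)"
    show "suc k \<in>\<^sub>U suc n \<longrightarrow> (\<forall>g y. slice T (suc k) g y = slice T' (suc k) g y)"
    proof
      assume "suc k \<in>\<^sub>U suc n"
      then have k: "k \<in>\<^sub>U n" using nat_trans[OF assms(3), of "suc k" k] by auto
      then have "\<forall>g y. slice T k g y = slice T' k g y" using IH by simp
      then have "truth_step (slice T k) g y = truth_step (slice T' k) g y" for g y
        by (intro truth_step_cong) blast
      then show "\<forall>g y. slice T (suc k) g y = slice T' (suc k) g y"
        using assms(4,5) k unfolding truth_levels_def by blast
    qed
  qed
  then show ?thesis using assms(6) by blast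
qed

lemma truth_levels_mono: "truth_levels n T \<Longrightarrow> n \<in>\<^sub>U om \<Longrightarrow> k \<in>\<^sub>U n \<Longrightarrow> truth_levels k T"
  unfolding truth_levels_def using nat_trans by blast

text \<open>Recursion on the natural numbers of HOL: each \<open>truth i\<close> is definable by a
  formula that grows with i. The lower slices are kept because \<open>truth_levels\<close> speaks of
  them.\<close>

primrec truth :: "nat \<Rightarrow> 'a set" where
  "truth 0 = {}"
| "truth (Suc i) = {p. p \<in> truth i \<or>
     (\<exists>g y. p = opair (suc (nm i)) (opair g y) \<and> truth_step (slice (truth i) (nm i)) g y)}"

lemma truth_definable: "truth i \<in> definable_classes"
proof (induction i)
  case 0
  have "{x. \<not> True} \<in> definable_classes"
    by (rule df_imp_definable[OF _ axioms(4)]) (intro dfs)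
  then show ?case by simp
next
  case (Suc i)
  show ?case unfolding truth.simps truth_step_def
    by (rule df_imp_definable[OF _ axioms(4)]) (intro dfs df_const_class[OF Suc])
qed

lemma truth_index: "p \<in> truth i \<Longrightarrow> \<exists>j q. j \<le> i \<and> p = opair (nm j) q"
proof (induction i)
  case (Suc i)
  then show ?case unfolding truth.simps mem_Collect_eq
    by (metis le_SucI nm.simps(2) order_refl)
qed simp

lemma truth_stable: "j \<le> i \<Longrightarrow> slice (truth i) (nm j) g y = slice (truth j) (nm j) g y"
proof (induction i)
  case (Suc i)
  show ?case
  proof (cases "j = Suc i")
    case False
    then have "j \<le> i" using Suc by simp
    moreover have "nm j \<noteq> suc (nm i)" using False nm_inject[of j "Suc i"] by simp
    ultimately show ?thesis using Suc.IH by simp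
  qed simp
qed simp

lemma truth_Suc: "slice (truth (Suc i)) (nm (Suc i)) g y = truth_step (slice (truth i) (nm i)) g y"
proof -
  have "\<not> slice (truth i) (nm (Suc i)) g y"
    using truth_index[of _ i] nm_inject opair_inject by (metis not_less_eq_eq order_refl)
  then show ?thesis by simp
qed

lemma truth_levels_truth: "truth_levels (nm i) (truth i)"
  unfolding truth_levels_def
proof (intro conjI allI impI)
  show "\<not> slice (truth i) emp g y" for g y using truth_stable[of 0 i g y] by simp
next
  fix k g y assume "k \<in>\<^sub>U nm i"
  then obtain j where j: "j < i" "k = nm j" unfolding mem_nm by blast
  have "truth_step (slice (truth j) (nm j)) g y = truth_step (slice (truth i) (nm j)) g y"
    by (rule truth_step_cong) (use truth_stable[of j i] j in simp)
  then show "slice (truth i) (suc k) g y = truth_step (slice (truth i) k) g y"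
    using truth_Suc[of j g y] truth_stable[of "Suc j" i g y] j by simp
qed

primrec code :: "fm \<Rightarrow> 'a" where
  "code (Mem i j) = opair (nm 0) (opair (nm i) (nm j))"
| "code (Eq i j) = opair (nm 1) (opair (nm i) (nm j))"
| "code (Ur i) = opair (nm 2) (nm i)"
| "code (Neg p) = opair (nm 3) (code p)"
| "code (Conj p q) = opair (nm 4) (opair (code p) (code q))"
| "code (Ex i p) = opair (nm 5) (opair (nm i) (code p))"

text \<open>Each connective consumes one level, so any level above the size is high enough. Only the
  free variables matter for \<open>g\<close>, so a finite set can stand for the infinite assignment
  \<open>e\<close>.\<close>

lemma truth_sat:
  "size \<phi> < i \<Longrightarrow> (\<And>n a. n \<in> fv \<phi> \<Longrightarrow> opair (nm n) a \<in>\<^sub>U g \<longleftrightarrow> a = e n) \<Longrightarrow>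
   slice (truth i) (nm i) g (code \<phi>) \<longleftrightarrow> sat e \<phi>"
proof (induction \<phi> arbitrary: i g e)
  case (Mem k l)
  from Mem(1) obtain j where j: "i = Suc j" by (cases i) auto
  have g: "opair (nm k) a \<in>\<^sub>U g \<longleftrightarrow> a = e k" "opair (nm l) a \<in>\<^sub>U g \<longleftrightarrow> a = e l" for a
    by (rule Mem(2), simp)+
  show ?case unfolding j truth_Suc truth_step_def by (simp add: g eq_commute del: nm.simps)
next
  case (Eq k l)
  from Eq(1) obtain j where j: "i = Suc j" by (cases i) auto
  have g: "opair (nm k) a \<in>\<^sub>U g \<longleftrightarrow> a = e k" "opair (nm l) a \<in>\<^sub>U g \<longleftrightarrow> a = e l" for a
    by (rule Eq(2), simp)+
  show ?case unfolding j truth_Suc truth_step_def by (simp add: g eq_commute del: nm.simps)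
next
  case (Ur k)
  from Ur(1) obtain j where j: "i = Suc j" by (cases i) auto
  have g: "opair (nm k) a \<in>\<^sub>U g \<longleftrightarrow> a = e k" for a by (rule Ur(2), simp)
  show ?case unfolding j truth_Suc truth_step_def by (simp add: g del: nm.simps)
next
  case (Neg p)
  from Neg.prems(1) obtain j where j: "i = Suc j" "size p < j" by (cases i) auto
  have "slice (truth j) (nm j) g (code p) \<longleftrightarrow> sat e p" by (rule Neg.IH[OF j(2)], rule Neg.prems(2)) simp
  then show ?case unfolding j truth_Suc truth_step_def by (simp del: nm.simps)
next
  case (Conj p q)
  from Conj.prems(1) obtain j where j: "i = Suc j" "size p < j" "size q < j" by (cases i) auto
  have "slice (truth j) (nm j) g (code p) \<longleftrightarrow> sat e p" by (rule Conj.IH(1)[OF j(2)], rule Conj.prems(2)) simp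
  moreover have "slice (truth j) (nm j) g (code q) \<longleftrightarrow> sat e q"
    by (rule Conj.IH(2)[OF j(3)], rule Conj.prems(2)) simp
  ultimately show ?case unfolding j truth_Suc truth_step_def by (simp del: nm.simps)
next
  case (Ex k p)
  from Ex.prems(1) obtain j where j: "i = Suc j" "size p < j" by (cases i) auto
  have "slice (truth j) (nm j) (upd g (nm k) a) (code p) \<longleftrightarrow> sat (e(k := a)) p" for a
  proof (rule Ex.IH[OF j(2)])
    fix n b assume n: "n \<in> fv p"
    show "opair (nm n) b \<in>\<^sub>U upd g (nm k) a \<longleftrightarrow> b = (e(k := a)) n"
    proof (cases "n = k")
      case True
      then show ?thesis unfolding mem_upd by auto
    next
      case False
      then have "opair (nm n) b \<in>\<^sub>U g \<longleftrightarrow> b = e n" using n by (intro Ex.prems(2)) simp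
      then show ?thesis using False unfolding mem_upd by auto
    qed
  qed
  then show ?case unfolding j truth_Suc truth_step_def by (simp del: nm.simps)
qed

section \<open>The map from classes to objects\<close>

definition assignment2 :: "'a \<Rightarrow> 'a \<Rightarrow> 'a" where
  "assignment2 x z = upair (opair (nm 0) x) (opair (nm 1) z)"

lemma dt_assignment2 [dfs]: "dt b t \<Longrightarrow> dt b u \<Longrightarrow> dt b (\<lambda>e E. assignment2 (t e E) (u e E))"
  by (rule dt_app2[of b "\<lambda>x y E. assignment2 x y"], unfold assignment2_def, intro dfs)

definition section_at :: "'a set \<Rightarrow> 'a \<Rightarrow> 'a \<Rightarrow> 'a set \<Rightarrow> bool" where
  "section_at T n w X \<longleftrightarrow> (\<exists>z y. w = opair z y \<and> (\<forall>x. x \<in> X \<longleftrightarrow> slice T n (assignment2 x z) y))"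

lemma definable_class_is_section:
  assumes "X \<in> definable_classes"
  shows "\<exists>i w. section_at (truth i) (nm i) w X"
proof -
  obtain \<psi> z where X: "X = {x. sat ((\<lambda>_. z)(0 := x)) \<psi>}" "fv \<psi> \<subseteq> {0, 1}"
    using assms unfolding definable_classes_def by blast
  let ?i = "Suc (size \<psi>)"
  have "slice (truth ?i) (nm ?i) (assignment2 x z) (code \<psi>) \<longleftrightarrow> sat ((\<lambda>_. z)(0 := x)) \<psi>" for x
    by (rule truth_sat) (use X(2) in \<open>auto simp: assignment2_def simp del: nm.simps\<close>)
  then have "section_at (truth ?i) (nm ?i) (opair z (code \<psi>)) X"
    unfolding section_at_def X(1) by blast
  then show ?thesis by blast
qed

text \<open>The value of a class is the least level \<open>n\<close> of the truth hierarchy on which the class occurs,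
  together with the set of all its indices of least stage.\<close>

definition value_witness :: "'a set \<Rightarrow> 'a set \<Rightarrow> 'a \<Rightarrow> bool" where
  "value_witness T X y \<longleftrightarrow> (\<exists>n N. y = opair n N \<and> n \<in>\<^sub>U om \<and> truth_levels n T \<and>
     (\<forall>k. k \<in>\<^sub>U n \<longrightarrow> (\<forall>w. \<not> section_at T k w X)) \<and> (\<exists>w. section_at T n w X) \<and>
     N = least_stage (\<lambda>w. section_at T n w X))"

lemma df_value_witness: "df True (\<lambda>e E. value_witness (E 0) (E (Suc 0)) (e 0))"
  unfolding value_witness_def truth_levels_def truth_step_def section_at_def least_stage_def
  by (intro dfs)

text \<open>By \<open>mem_nm\<close> a standard numeral has only standard members, so the least
  level found by \<open>LEAST\<close> in HOL is also the least one in the sense of the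
  model.\<close>

lemma value_witness_ex:
  assumes "X \<in> definable_classes"
  shows "\<exists>y. \<exists>T \<in> definable_classes. value_witness T X y"
proof -
  define i where "i = (LEAST i. \<exists>w. section_at (truth i) (nm i) w X)"
  have i: "\<exists>w. section_at (truth i) (nm i) w X"
    unfolding i_def using definable_class_is_section[OF assms] by (rule LeastI_ex)
  have "\<not> section_at (truth i) k w X" if "k \<in>\<^sub>U nm i" for k w
  proof -
    obtain j where j: "j < i" "k = nm j" using \<open>k \<in>\<^sub>U nm i\<close> unfolding mem_nm by blast
    then have "\<not> section_at (truth j) (nm j) w X" unfolding i_def using not_less_Least by blast
    then show ?thesis unfolding section_at_def using truth_stable[of j i] j by simp
  qed
  then have "value_witness (truth i) X (opair (nm i) (least_stage (\<lambda>w. section_at (truth i) (nm i) w X)))"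
    unfolding value_witness_def using i truth_levels_truth[of i] nm_om by blast
  then show ?thesis using truth_definable by blast
qed

lemma section_at_unique:
  assumes "T \<in> definable_classes" "T' \<in> definable_classes" "n \<in>\<^sub>U om"
    "truth_levels n T" "truth_levels n T'" "k \<in>\<^sub>U suc n"
  shows "section_at T k w X = section_at T' k w X"
  unfolding section_at_def truth_levels_unique[OF assms] ..

lemma value_witness_unique:
  assumes "T \<in> definable_classes" "T' \<in> definable_classes"
    "value_witness T X y" "value_witness T' X y'"
  shows "y = y'"
proof -
  obtain n where n: "n \<in>\<^sub>U om" "truth_levels n T"
     "\<forall>k. k \<in>\<^sub>U n \<longrightarrow> (\<forall>w. \<not> section_at T k w X)" "\<exists>w. section_at T n w X"
     "y = opair n (least_stage (\<lambda>w. section_at T n w X))"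
    using assms(3) unfolding value_witness_def by blast
  obtain n' where n': "n' \<in>\<^sub>U om" "truth_levels n' T'"
     "\<forall>k. k \<in>\<^sub>U n' \<longrightarrow> (\<forall>w. \<not> section_at T' k w X)" "\<exists>w. section_at T' n' w X"
     "y' = opair n' (least_stage (\<lambda>w. section_at T' n' w X))"
    using assms(4) unfolding value_witness_def by blast
  \<comment> \<open>If X occurred in S on a level m below m', it would occur on that level in S'
    too, as both classes obey Tarski's clauses up to m. But X is absent from S' below m'.\<close>
  have *: "m \<notin> {m. m \<in>\<^sub>U m'}"
    if "S \<in> definable_classes" "S' \<in> definable_classes" "m \<in>\<^sub>U om" "m' \<in>\<^sub>U om"
      "truth_levels m S" "truth_levels m' S'" "\<exists>w. section_at S m w X"
      "\<forall>k. k \<in>\<^sub>U m' \<longrightarrow> (\<forall>w. \<not> section_at S' k w X)" for S S' m m'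
  proof
    assume "m \<in> {m. m \<in>\<^sub>U m'}"
    then have m: "m \<in>\<^sub>U m'" by simp
    have "truth_levels m S'" by (rule truth_levels_mono[OF that(6,4) m])
    from section_at_unique[OF that(1,2,3,5) this] have "section_at S m w X = section_at S' m w X" for w
      by simp
    then show False using that(7,8) m by blast
  qed
  have "\<not> n \<in>\<^sub>U n'" using *[OF assms(1,2) n(1) n'(1) n(2) n'(2) n(4) n'(3)] by simp
  moreover have "\<not> n' \<in>\<^sub>U n" using *[OF assms(2,1) n'(1) n(1) n'(2) n(2) n'(4) n(3)] by simp
  ultimately have "n = n'" using nat_linear[OF n(1) n'(1)] by blast
  then have "section_at T n w X = section_at T' n w X" for w
    using n'(2) by (intro section_at_unique[OF assms(1,2) n(1,2)]) auto
  then show ?thesis using n(5) n'(5) \<open>n = n'\<close> by simp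
qed

text \<open>The set of urelements enters here: it makes \<open>least_stage\<close> nonempty, so that
  equal values have a common index \<open>w\<close>, and an index on a given level determines the
  class.\<close>

lemma value_witness_inj:
  assumes "T \<in> definable_classes" "T' \<in> definable_classes" urelements_form_set
    "X \<in> definable_classes" "X' \<in> definable_classes"
    "value_witness T X y" "value_witness T' X' y"
  shows "X = X'"
proof -
  obtain n where n: "n \<in>\<^sub>U om" "truth_levels n T" "\<exists>w. section_at T n w X"
     "y = opair n (least_stage (\<lambda>w. section_at T n w X))"
    using assms(6) unfolding value_witness_def by blast
  obtain n' where n': "n' \<in>\<^sub>U om" "truth_levels n' T'" "\<exists>w. section_at T' n' w X'"
     "y = opair n' (least_stage (\<lambda>w. section_at T' n' w X'))"
    using assms(7) unfolding value_witness_def by blast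
  have eq: "n' = n" "least_stage (\<lambda>w. section_at T n w X) = least_stage (\<lambda>w. section_at T' n w X')"
    using n(4) n'(4) opair_inject by metis+
  have df: "df False (\<lambda>e E. section_at S n (e 0) Y)" if "S \<in> definable_classes" "Y \<in> definable_classes" for S Y
    unfolding section_at_def by (intro dfs df_const_class[OF that(1)] df_const_class[OF that(2)])
  obtain w where w: "w \<in>\<^sub>U least_stage (\<lambda>w. section_at T n w X)"
    using least_stage(2)[OF assms(3) df[OF assms(1,4)]] n(3) by blast
  have "section_at T n w X"
    using least_stage(1)[OF assms(3) df[OF assms(1,4)]] n(3) w by blast
  moreover have "section_at T' n w X'"
    using least_stage(1)[OF assms(3) df[OF assms(2,5)]] n'(3) w unfolding eq by blast
  then have "section_at T n w X'"
    using section_at_unique[OF assms(1,2) n(1,2) n'(2)[unfolded eq(1)], of n] by simp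
  ultimately show ?thesis unfolding section_at_def by auto
qed

lemma definable_map_THE:
  assumes "df True (\<lambda>e E. V (E 0) (E (Suc 0)) (e 0))"
    "\<And>X. X \<in> definable_classes \<Longrightarrow> \<exists>!y. \<exists>T \<in> definable_classes. V T X y"
  shows "definable_map (\<lambda>X. THE y. \<exists>T \<in> definable_classes. V T X y)"
proof -
  obtain \<phi> where 1: "elementary \<phi>"
    "\<And>e E p' P'. V (E 0) (E (Suc 0)) (e 0) = sat2 (mix e p') (mix E P') \<phi>"
    using assms(1) unfolding df_def by blast
  \<comment> \<open>In the mixed assignment T is at position 0 and X at position 2. T becomes class
    variable 1, to be bound; every other position becomes the argument variable 0. This may include
    the parameter positions, because the flag \<open>True\<close> makes their content
    irrelevant.\<close>
  let ?h = "\<lambda>n::nat. if n = 0 then 1 else 0 :: nat"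
  obtain \<phi>' where 2: "fv_obj \<phi>' \<subseteq> (\<lambda>_. 0) ` fv_obj \<phi>" "fv_cl \<phi>' \<subseteq> ?h ` fv_cl \<phi>"
    "\<And>e E. sat2 e E \<phi>' = sat2 (\<lambda>_. e 0) (\<lambda>n. E (?h n)) \<phi>"
    using sat2_rename[of \<phi> "\<lambda>_. 0" ?h] by blast
  have 3: "sat2 (\<lambda>_. y) (\<lambda>_. X) (ExCl 1 \<phi>') \<longleftrightarrow> (\<exists>T \<in> definable_classes. V T X y)" for X y
  proof -
    have "(\<lambda>n. ((\<lambda>_. X)(1 := T)) (?h n)) = mix (case_nat T (\<lambda>_. X)) (\<lambda>_. X)" for T
    proof
      fix n show "((\<lambda>_. X)(1 := T)) (?h n) = mix (case_nat T (\<lambda>_. X)) (\<lambda>_. X) n"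
        by (cases "n div 2") (auto simp: mix_def)
    qed
    moreover have "(\<lambda>_. y) = mix (\<lambda>_. y) (\<lambda>_. y)" by (auto simp: mix_def)
    ultimately have "sat2 (\<lambda>_. y) ((\<lambda>_. X)(1 := T)) \<phi>' = V T X y" for T
      unfolding 2(3) using 1(2)[of "case_nat T (\<lambda>_. X)" "\<lambda>_. y" "\<lambda>_. y" "\<lambda>_. X"] by simp
    then show ?thesis by simp
  qed
  have "fv_obj (ExCl 1 \<phi>') \<subseteq> {0}" "fv_cl (ExCl 1 \<phi>') \<subseteq> {0}" using 2(1,2) by (auto split: if_splits)
  moreover have "(THE y. \<exists>T \<in> definable_classes. V T X y) = y \<longleftrightarrow> (\<exists>T \<in> definable_classes. V T X y)"
    if "X \<in> definable_classes" for X y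
    using theI'[OF assms(2)[OF that]] the1_equality[OF assms(2)[OF that]] by blast
  ultimately show ?thesis unfolding definable_map_def using 3 by blast
qed

lemma law_V_if_ur_set:
  assumes urelements_form_set
  shows "\<exists>\<epsilon>. definable_map \<epsilon> \<and> basic_law_V \<epsilon>"
proof -
  let ?\<epsilon> = "\<lambda>X. THE y. \<exists>T \<in> definable_classes. value_witness T X y"
  have ex1: "\<exists>!y. \<exists>T \<in> definable_classes. value_witness T X y" if "X \<in> definable_classes" for X
    using value_witness_ex[OF that] value_witness_unique by blast
  have "X = Y" if "X \<in> definable_classes" "Y \<in> definable_classes" "?\<epsilon> X = ?\<epsilon> Y" for X Y
    using theI'[OF ex1[OF that(1)]] theI'[OF ex1[OF that(2)]] that(3)
      value_witness_inj[OF _ _ assms that(1,2)] by auto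
  then have "basic_law_V ?\<epsilon>" unfolding basic_law_V_def set_eq_iff[symmetric] by blast
  then show ?thesis using definable_map_THE[OF df_value_witness ex1] by blast
qed

end

section \<open>Automorphisms\<close>

context urelement_structure
begin

text \<open>An involution is its own inverse, which makes the substitutions under object and class
  quantifiers immediate.\<close>

definition involutive_automorphism :: "('a \<Rightarrow> 'a) \<Rightarrow> bool" where
  "involutive_automorphism \<pi> \<longleftrightarrow> (\<forall>x. \<pi> (\<pi> x) = x) \<and> (\<forall>x y. \<pi> x \<in>\<^sub>U \<pi> y \<longleftrightarrow> x \<in>\<^sub>U y) \<and> (\<forall>x. ur (\<pi> x) \<longleftrightarrow> ur x)"

context
  fixes \<pi> assumes \<pi>: "involutive_automorphism \<pi>"
begin

lemma twice: "\<pi> (\<pi> x) = x" and inv_mem: "\<pi> x \<in>\<^sub>U \<pi> y \<longleftrightarrow> x \<in>\<^sub>U y" and inv_ur: "ur (\<pi> x) \<longleftrightarrow> ur x"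
  using \<pi> unfolding involutive_automorphism_def by blast+

lemma inv_inject: "\<pi> x = \<pi> y \<longleftrightarrow> x = y"
  by (metis twice)

lemma ex_inv: "(\<exists>a. P a) \<longleftrightarrow> (\<exists>a. P (\<pi> a))"
  by (metis twice)

lemma image_inv: "\<pi> ` \<pi> ` X = X"
  by (simp add: image_image twice)

lemma inv_update: "(\<lambda>n. \<pi> (e n))(i := \<pi> a) = (\<lambda>n. \<pi> ((e(i := a)) n))"
  by auto

lemma sat_inv: "sat (\<lambda>n. \<pi> (e n)) \<phi> = sat e \<phi>"
proof (induction \<phi> arbitrary: e)
  case (Ex i \<phi>)
  show ?case unfolding sat.simps ex_inv[of "\<lambda>a. sat ((\<lambda>n. \<pi> (e n))(i := a)) \<phi>"] inv_update Ex ..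
qed (simp_all add: inv_mem inv_ur inv_inject)

lemma mem_image_inv: "\<pi> x \<in> \<pi> ` X \<longleftrightarrow> x \<in> X"
  by (metis image_iff twice)

lemma image_inv_eqI:
  assumes "\<And>x. \<pi> x \<in> Y \<longleftrightarrow> x \<in> X"
  shows "\<pi> ` X = Y"
proof (rule set_eqI)
  fix y
  show "y \<in> \<pi> ` X \<longleftrightarrow> y \<in> Y"
    using mem_image_inv[of "\<pi> y" X] assms[of "\<pi> y"] unfolding twice by simp
qed

text \<open>The same formula defines the image from the moved parameter. Hence automorphisms permute
  the definable classes, which makes class quantifiers invariant as well.\<close>

lemma image_definable:
  assumes "X \<in> definable_classes"
  shows "\<pi> ` X \<in> definable_classes"
proof -
  obtain \<psi> z where X: "X = {x. sat ((\<lambda>_. z)(0 := x)) \<psi>}" "fv \<psi> \<subseteq> {0, 1}"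
    using assms unfolding definable_classes_def by blast
  have "sat ((\<lambda>_. \<pi> z)(0 := \<pi> x)) \<psi> = sat ((\<lambda>_. z)(0 := x)) \<psi>" for x
    using sat_inv[of "(\<lambda>_. z)(0 := x)" \<psi>] unfolding inv_update[of "\<lambda>_. z" 0 x, symmetric] .
  then have "\<pi> x \<in> {x. sat ((\<lambda>_. \<pi> z)(0 := x)) \<psi>} \<longleftrightarrow> x \<in> X" for x unfolding X(1) by blast
  then have "\<pi> ` X = {x. sat ((\<lambda>_. \<pi> z)(0 := x)) \<psi>}" by (rule image_inv_eqI)
  then show ?thesis unfolding definable_classes_def using X(2) by blast
qed

lemma ex_class_inv:
  "(\<exists>X \<in> definable_classes. P X) \<longleftrightarrow> (\<exists>X \<in> definable_classes. P (\<pi> ` X))"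
  by (metis image_definable image_inv)

lemma image_inv_update: "(\<lambda>k. \<pi> ` E k)(i := \<pi> ` X) = (\<lambda>k. \<pi> ` (E(i := X)) k)"
  by (rule ext) simp

lemma sat2_inv: "sat2 (\<lambda>n. \<pi> (e n)) (\<lambda>k. \<pi> ` E k) \<phi> = sat2 e E \<phi>"
proof (induction \<phi> arbitrary: e E)
  case (ExObj i \<phi>)
  show ?case
    unfolding sat2.simps ex_inv[of "\<lambda>a. sat2 ((\<lambda>n. \<pi> (e n))(i := a)) (\<lambda>k. \<pi> ` E k) \<phi>"] inv_update ExObj ..
next
  case (ExCl i \<phi>)
  show ?case
    unfolding sat2.simps ex_class_inv[of "\<lambda>X. sat2 (\<lambda>n. \<pi> (e n)) ((\<lambda>k. \<pi> ` E k)(i := X)) \<phi>"]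
      image_inv_update ExCl ..
qed (simp_all add: inv_mem inv_ur inv_inject mem_image_inv)

end

text \<open>\<open>p\<close> is the object parameter behind the class parameter \<open>P\<close>.
  Fixing \<open>p\<close> fixes \<open>P\<close>, so the map commutes with \<pi>; Basic Law V then
  turns equality of values into equality of classes.\<close>

lemma law_V_stabilizer:
  assumes "parametrically_definable_map \<epsilon>" "basic_law_V \<epsilon>"
  shows "\<exists>p. \<forall>\<pi> X. involutive_automorphism \<pi> \<longrightarrow> \<pi> p = p \<longrightarrow> X \<in> definable_classes \<longrightarrow>
    (\<pi> ` X = X \<longleftrightarrow> \<pi> (\<epsilon> X) = \<epsilon> X)"
proof -
  obtain \<phi> P where \<epsilon>: "P \<in> definable_classes"
    "\<And>X y. X \<in> definable_classes \<Longrightarrow> \<epsilon> X = y \<longleftrightarrow> sat2 (\<lambda>_. y) ((\<lambda>_. P)(0 := X)) \<phi>"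
    using assms(1) unfolding parametrically_definable_map_def by blast
  obtain \<psi> p where P: "P = {x. sat ((\<lambda>_. p)(0 := x)) \<psi>}"
    using \<epsilon>(1) unfolding definable_classes_def by blast
  have "\<pi> ` X = X \<longleftrightarrow> \<pi> (\<epsilon> X) = \<epsilon> X"
    if \<pi>: "involutive_automorphism \<pi>" and p: "\<pi> p = p" and X: "X \<in> definable_classes" for \<pi> X
  proof -
    have X': "\<pi> ` X \<in> definable_classes" by (rule image_definable[OF \<pi> X])
    have "sat ((\<lambda>_. p)(0 := \<pi> x)) \<psi> = sat ((\<lambda>_. p)(0 := x)) \<psi>" for x
      using sat_inv[OF \<pi>, of "(\<lambda>_. p)(0 := x)" \<psi>]
      unfolding inv_update[OF \<pi>, of "\<lambda>_. p" 0 x, symmetric] p .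
    then have "\<pi> x \<in> P \<longleftrightarrow> x \<in> P" for x unfolding P by blast
    then have "\<pi> ` P = P" by (rule image_inv_eqI[OF \<pi>])
    then have upd: "(\<lambda>k. \<pi> ` ((\<lambda>_. P)(0 := X)) k) = (\<lambda>_. P)(0 := \<pi> ` X)" by (intro ext) simp
    have "sat2 (\<lambda>_. \<epsilon> X) ((\<lambda>_. P)(0 := X)) \<phi>" using \<epsilon>(2)[OF X, of "\<epsilon> X"] by simp
    then have "sat2 (\<lambda>_. \<pi> (\<epsilon> X)) ((\<lambda>_. P)(0 := \<pi> ` X)) \<phi>"
      using sat2_inv[OF \<pi>, of "\<lambda>_. \<epsilon> X" "(\<lambda>_. P)(0 := X)" \<phi>] unfolding upd by blast
    then have "\<epsilon> (\<pi> ` X) = \<pi> (\<epsilon> X)" using \<epsilon>(2)[OF X', of "\<pi> (\<epsilon> X)"] by simp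
    moreover have "\<epsilon> (\<pi> ` X) = \<epsilon> X \<longleftrightarrow> \<pi> ` X = X"
      using assms(2) X X' unfolding basic_law_V_def set_eq_iff by blast
    ultimately show ?thesis by simp
  qed
  then show ?thesis by blast
qed

end

context zfu
begin

section \<open>Extending involutions of the urelements to the model\<close>

definition extend_step :: "('a \<Rightarrow> 'a) \<Rightarrow> 'a \<Rightarrow> 'a \<Rightarrow> 'a" where
  "extend_step \<theta> x r = (if ur x then \<theta> x else r)"

definition extend :: "('a \<Rightarrow> 'a) \<Rightarrow> 'a \<Rightarrow> 'a" where
  "extend \<theta> = rec (extend_step \<theta>)"

text \<open>Definability is part of the notion because \<open>extend\<close> arises by recursion,
  and its properties by induction, inside the model.\<close>

definition urelement_involution :: "('a \<Rightarrow> 'a) \<Rightarrow> bool" where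
  "urelement_involution \<theta> \<longleftrightarrow> dt False (\<lambda>e E. \<theta> (e 0)) \<and> (\<forall>a. ur a \<longrightarrow> ur (\<theta> a)) \<and> (\<forall>a. ur a \<longrightarrow> \<theta> (\<theta> a) = a)"

context
  fixes \<theta>
  assumes involution: "urelement_involution \<theta>"
begin

lemma \<theta>: "dt False (\<lambda>e E. \<theta> (e 0))" "ur a \<Longrightarrow> ur (\<theta> a)" "ur a \<Longrightarrow> \<theta> (\<theta> a) = a"
  using involution unfolding urelement_involution_def by blast+

lemma dt_extend_step: "dt False (\<lambda>e E. extend_step \<theta> (e 0) (e (Suc 0)))"
  unfolding extend_step_def by (intro dfs dt_app1[of False "\<lambda>x E. \<theta> x", OF \<theta>(1)])

lemma dt_extend: "dt False t \<Longrightarrow> dt False (\<lambda>e E. extend \<theta> (t e E))"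
  unfolding extend_def by (rule dt_rec[OF dt_extend_step])

lemma extend_eq: "extend \<theta> x = (if ur x then \<theta> x else img (extend \<theta>) x)"
  using rec_eq[OF dt_extend_step, of x] unfolding extend_def extend_step_def .

lemma extend_ur: "ur (extend \<theta> x) \<longleftrightarrow> ur x"
  using extend_eq[of x] \<theta>(2) is_set_img[of "extend \<theta>" x] unfolding is_set_def by metis

lemma mem_extend:
  assumes "is_set x"
  shows "v \<in>\<^sub>U extend \<theta> x \<longleftrightarrow> (\<exists>u. u \<in>\<^sub>U x \<and> v = extend \<theta> u)"
proof -
  have dx: "dt False (\<lambda>e E. extend \<theta> (e 0))" by (rule dt_extend, rule dt_var)
  have "\<not> ur x" using assms unfolding is_set_def .
  then have "extend \<theta> x = img (extend \<theta>) x" using extend_eq[of x] by (simp only: if_False)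
  then show ?thesis using mem_img[OF dx, of v x] by (simp only:)
qed

lemma extend_involutive: "extend \<theta> (extend \<theta> x) = x"
proof (rule mem_induct[where P = "\<lambda>x. extend \<theta> (extend \<theta> x) = x"])
  fix x assume IH: "\<And>y. y \<in>\<^sub>U x \<Longrightarrow> extend \<theta> (extend \<theta> y) = y"
  show "extend \<theta> (extend \<theta> x) = x"
  proof (cases "ur x")
    case True
    then show ?thesis using extend_eq[of x] extend_eq[of "\<theta> x"] \<theta>(2,3) by simp
  next
    case False
    then have x: "is_set x" "is_set (extend \<theta> x)" "is_set (extend \<theta> (extend \<theta> x))"
      unfolding is_set_def using extend_ur by blast+
    show ?thesis
    proof (rule set_extI[OF x(3,1)])
      fix v
      show "v \<in>\<^sub>U extend \<theta> (extend \<theta> x) \<longleftrightarrow> v \<in>\<^sub>U x"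
        unfolding mem_extend[OF x(2)] mem_extend[OF x(1)] using IH by metis
    qed
  qed
qed (intro dfs dt_extend)

lemma extend_automorphism: "involutive_automorphism (extend \<theta>)"
proof -
  have 1: "extend \<theta> x \<in>\<^sub>U extend \<theta> y" if "x \<in>\<^sub>U y" for x y
    using mem_extend[OF mem_is_set[OF that]] that by blast
  have "extend \<theta> x \<in>\<^sub>U extend \<theta> y \<longleftrightarrow> x \<in>\<^sub>U y" for x y
    using 1 1[of "extend \<theta> x" "extend \<theta> y"] extend_involutive by auto
  then show ?thesis
    unfolding involutive_automorphism_def using extend_involutive extend_ur by blast
qed

lemma extend_fixes:
  assumes "transitive t" "\<And>a. ur a \<Longrightarrow> a \<in>\<^sub>U t \<Longrightarrow> \<theta> a = a" "x \<in>\<^sub>U t"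
  shows "extend \<theta> x = x"
proof -
  have "x \<in>\<^sub>U t \<longrightarrow> extend \<theta> x = x"
  proof (rule mem_induct[where P = "\<lambda>x. x \<in>\<^sub>U t \<longrightarrow> extend \<theta> x = x"])
    fix x assume IH: "\<And>y. y \<in>\<^sub>U x \<Longrightarrow> y \<in>\<^sub>U t \<longrightarrow> extend \<theta> y = y"
    show "x \<in>\<^sub>U t \<longrightarrow> extend \<theta> x = x"
    proof
      assume x: "x \<in>\<^sub>U t"
      show "extend \<theta> x = x"
      proof (cases "ur x")
        case True
        then show ?thesis using extend_eq[of x] assms(2) x by simp
      next
        case False
        then have s: "is_set x" "is_set (extend \<theta> x)"
          unfolding is_set_def using extend_ur by blast+
        have "extend \<theta> y = y" if "y \<in>\<^sub>U x" for y
          using IH[OF that] assms(1) x that unfolding transitive_def by blast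
        then have "v \<in>\<^sub>U extend \<theta> x \<longleftrightarrow> v \<in>\<^sub>U x" for v
          unfolding mem_extend[OF s(1)] by metis
        then show ?thesis by (rule set_extI[OF s(2,1)])
      qed
    qed
  qed (intro dfs dt_extend)
  then show ?thesis using assms(3) by blast
qed

end

text \<open>The closure contains \<open>x\<close> itself, so the urelements in \<open>tc x\<close>
  are the support of \<open>x\<close> even if \<open>x\<close> is a urelement.\<close>

definition tc :: "'a \<Rightarrow> 'a" where
  "tc x = col (\<lambda>z. \<forall>t. x \<in>\<^sub>U t \<longrightarrow> transitive t \<longrightarrow> z \<in>\<^sub>U t)"

lemma mem_tc: "z \<in>\<^sub>U tc x \<longleftrightarrow> (\<forall>t. x \<in>\<^sub>U t \<longrightarrow> transitive t \<longrightarrow> z \<in>\<^sub>U t)"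
proof -
  obtain t where "x \<in>\<^sub>U t" "transitive t" using transitive_superset by blast
  then have "small (\<lambda>z. \<forall>t. x \<in>\<^sub>U t \<longrightarrow> transitive t \<longrightarrow> z \<in>\<^sub>U t)"
    by (intro small_sep[of _ t] dfs) blast
  from mem_col[OF this] show ?thesis unfolding tc_def .
qed

lemma tc_self: "x \<in>\<^sub>U tc x"
  unfolding mem_tc by blast

lemma tc_transitive: "transitive (tc x)"
  unfolding transitive_def mem_tc by blast

text \<open>To place the image of \<open>a\<close> in a transitive \<open>t\<close>, test
  \<open>a\<close> against the image of \<open>t\<close>, which is again transitive and contains
  \<open>x\<close>.\<close>

lemma tc_invariant:
  assumes "involutive_automorphism \<pi>" "\<pi> x = x" "a \<in>\<^sub>U tc x"
  shows "\<pi> a \<in>\<^sub>U tc x"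
  unfolding mem_tc
proof (intro allI impI)
  fix t assume t: "x \<in>\<^sub>U t" "transitive t"
  note inv = twice[OF assms(1)] inv_mem[OF assms(1)]
  have "transitive (\<pi> t)"
    unfolding transitive_def
  proof (intro allI impI)
    fix y z assume "y \<in>\<^sub>U \<pi> t" "z \<in>\<^sub>U y"
    then have "\<pi> y \<in>\<^sub>U t" "\<pi> z \<in>\<^sub>U \<pi> y" using inv by metis+
    then have "\<pi> z \<in>\<^sub>U t" using t(2) unfolding transitive_def by blast
    then show "z \<in>\<^sub>U \<pi> t" using inv by metis
  qed
  moreover have "x \<in>\<^sub>U \<pi> t" using t(1) assms(2) inv by metis
  ultimately have "a \<in>\<^sub>U \<pi> t" using assms(3) unfolding mem_tc by blast
  then show "\<pi> a \<in>\<^sub>U t" using inv by metis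
qed

section \<open>Sequences of urelements\<close>

text \<open>Only the pairs of \<open>f\<close> with first entry in \<open>n\<close> count, so a
  larger \<open>f\<close> needs no trimming. The target is a predicate because it may be a proper
  class.\<close>

definition inj_into :: "'a \<Rightarrow> 'a \<Rightarrow> ('a \<Rightarrow> bool) \<Rightarrow> bool" where
  "inj_into n f Q \<longleftrightarrow>
     (\<forall>x. x \<in>\<^sub>U n \<longrightarrow> (\<exists>y. opair x y \<in>\<^sub>U f)) \<and>
     (\<forall>x y. x \<in>\<^sub>U n \<longrightarrow> opair x y \<in>\<^sub>U f \<longrightarrow> Q y) \<and>
     (\<forall>x y y'. x \<in>\<^sub>U n \<longrightarrow> opair x y \<in>\<^sub>U f \<longrightarrow> opair x y' \<in>\<^sub>U f \<longrightarrow> y = y') \<and>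
     (\<forall>x x' y. x \<in>\<^sub>U n \<longrightarrow> x' \<in>\<^sub>U n \<longrightarrow> opair x y \<in>\<^sub>U f \<longrightarrow> opair x' y \<in>\<^sub>U f \<longrightarrow> x = x')"

definition at_least :: "'a \<Rightarrow> 'a \<Rightarrow> bool" where
  "at_least n S \<longleftrightarrow> (\<exists>f. inj_into n f (\<lambda>y. y \<in>\<^sub>U S))"

lemma df_at_least [dfs]: "dt b t \<Longrightarrow> dt b u \<Longrightarrow> df b (\<lambda>e E. at_least (t e E) (u e E))"
  by (rule df_app2[of b "\<lambda>x y E. at_least x y"], unfold at_least_def inj_into_def, intro dfs)

lemma opair_mem_pow: "x \<in>\<^sub>U a \<Longrightarrow> y \<in>\<^sub>U b \<Longrightarrow> opair x y \<in>\<^sub>U pow (pow (bcup a b))"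
  unfolding opair_def by auto

lemma mem_un_un: "opair x y \<in>\<^sub>U f \<Longrightarrow> y \<in>\<^sub>U un (un f)"
  unfolding mem_un opair_def by (metis mem_upair)

text \<open>Pigeonhole by repair: restrict an injection of n + 1 to n and, if some x in n is sent to
  a, send it to the former value at n instead. \<open>R\<close> is the repaired map.\<close>

lemma not_at_least_ins:
  assumes "\<not> at_least n F"
  shows "\<not> at_least (suc n) (ins a F)"
proof
  assume "at_least (suc n) (ins a F)"
  then obtain g where "inj_into (suc n) g (\<lambda>y. y \<in>\<^sub>U ins a F)" unfolding at_least_def by blast
  then have g: "\<And>x. x \<in>\<^sub>U suc n \<Longrightarrow> \<exists>y. opair x y \<in>\<^sub>U g"
    "\<And>x y. x \<in>\<^sub>U suc n \<Longrightarrow> opair x y \<in>\<^sub>U g \<Longrightarrow> y \<in>\<^sub>U F \<or> y = a"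
    "\<And>x y y'. x \<in>\<^sub>U suc n \<Longrightarrow> opair x y \<in>\<^sub>U g \<Longrightarrow> opair x y' \<in>\<^sub>U g \<Longrightarrow> y = y'"
    "\<And>x x' y. x \<in>\<^sub>U suc n \<Longrightarrow> x' \<in>\<^sub>U suc n \<Longrightarrow> opair x y \<in>\<^sub>U g \<Longrightarrow> opair x' y \<in>\<^sub>U g \<Longrightarrow> x = x'"
    unfolding inj_into_def mem_ins by blast+
  define R where "R x y \<longleftrightarrow> x \<in>\<^sub>U n \<and> y \<in>\<^sub>U F \<and> y \<noteq> a \<and>
     (opair x y \<in>\<^sub>U g \<or> opair x a \<in>\<^sub>U g \<and> opair n y \<in>\<^sub>U g)" for x y
  have "small (\<lambda>p. \<exists>x y. p = opair x y \<and> R x y)"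
  proof (rule small_sep[of _ "pow (pow (bcup n F))"])
    show "df False (\<lambda>e E. \<exists>x y. e 0 = opair x y \<and> R x y)" unfolding R_def by (intro dfs)
    show "p \<in>\<^sub>U pow (pow (bcup n F))" if "\<exists>x y. p = opair x y \<and> R x y" for p
      using that opair_mem_pow unfolding R_def by blast
  qed
  then obtain f where f0: "\<forall>p. p \<in>\<^sub>U f \<longleftrightarrow> (\<exists>x y. p = opair x y \<and> R x y)" unfolding small_def by blast
  have f: "opair x y \<in>\<^sub>U f \<longleftrightarrow> R x y" for x y using f0[rule_format, of "opair x y"] by auto
  have n: "x \<noteq> n" if "x \<in>\<^sub>U n" for x using that by auto
  have s: "n \<in>\<^sub>U suc n" "\<And>x. x \<in>\<^sub>U n \<Longrightarrow> x \<in>\<^sub>U suc n" by simp_all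
  have "inj_into n f (\<lambda>y. y \<in>\<^sub>U F)"
    unfolding inj_into_def f
  proof (intro conjI allI impI)
    fix x assume x: "x \<in>\<^sub>U n"
    obtain y where y: "opair x y \<in>\<^sub>U g" using g(1) s(2)[OF x] by blast
    obtain z where z: "opair n z \<in>\<^sub>U g" using g(1) s(1) by blast
    show "\<exists>y. R x y"
    proof (cases "y = a")
      case True
      then have "z \<noteq> a" using g(4)[OF s(2)[OF x] s(1) y] z n[OF x] by blast
      then show ?thesis unfolding R_def using x y z True g(2)[OF s(1) z] by blast
    next
      case False
      then show ?thesis unfolding R_def using x y g(2)[OF s(2)[OF x] y] by blast
    qed
  next
    fix x y assume "R x y" then show "y \<in>\<^sub>U F" unfolding R_def by blast
  next
    fix x y y' assume x: "x \<in>\<^sub>U n" and "R x y" "R x y'"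
    then show "y = y'" unfolding R_def using g(3)[OF s(2)[OF x]] g(3)[OF s(1)] by blast
  next
    fix x x' y assume x: "x \<in>\<^sub>U n" "x' \<in>\<^sub>U n" and R: "R x y" "R x' y"
    note g4 = g(4)[OF s(2)[OF x(1)] s(2)[OF x(2)]] g(4)[OF s(2)[OF x(1)] s(1)] g(4)[OF s(2)[OF x(2)] s(1)]
    show "x = x'" using R g4 n x unfolding R_def by blast
  qed
  then show False using assms unfolding at_least_def by blast
qed

lemma not_at_least_emp: "\<not> at_least (suc emp) emp"
  unfolding at_least_def inj_into_def by auto

text \<open>Finiteness in the sense of the model, stated as the failure of some n to embed. This is
  closed under \<open>ins\<close> by \<open>not_at_least_ins\<close> and is refuted by any injective
  sequence in F.\<close>

definition fin :: "'a \<Rightarrow> bool" where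
  "fin F \<longleftrightarrow> (\<exists>n. n \<in>\<^sub>U om \<and> \<not> at_least n F)"

lemma fin_emp: "fin emp"
  unfolding fin_def using not_at_least_emp suc_om[OF emp_om] by blast

lemma fin_ins: "fin F \<Longrightarrow> fin (ins a F)"
  unfolding fin_def using not_at_least_ins suc_om by blast

context
  assumes not_set: "\<not> urelements_form_set"
begin

lemma fresh_urelement: "\<exists>a. ur a \<and> \<not> a \<in>\<^sub>U B"
proof (rule ccontr)
  assume "\<not> ?thesis"
  then have "small ur" by (intro small_sep[of ur B] dfs) blast
  then show False using not_set unfolding small_def urelements_form_set_def by blast
qed

lemma ex_inj_into:
  assumes "n \<in>\<^sub>U om"
  shows "\<exists>f. inj_into n f (\<lambda>y. ur y \<and> \<not> y \<in>\<^sub>U B)"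
proof (rule om_induct[where P = "\<lambda>n. \<exists>f. inj_into n f (\<lambda>y. ur y \<and> \<not> y \<in>\<^sub>U B)", OF _ assms])
  show "df False (\<lambda>e E. \<exists>f. inj_into (e 0) f (\<lambda>y. ur y \<and> \<not> y \<in>\<^sub>U B))"
    unfolding inj_into_def by (intro dfs)
  show "\<exists>f. inj_into emp f (\<lambda>y. ur y \<and> \<not> y \<in>\<^sub>U B)" unfolding inj_into_def by simp
next
  fix n assume "\<exists>f. inj_into n f (\<lambda>y. ur y \<and> \<not> y \<in>\<^sub>U B)"
  then obtain f where f: "inj_into n f (\<lambda>y. ur y \<and> \<not> y \<in>\<^sub>U B)" by blast
  obtain a where a: "ur a" "\<not> a \<in>\<^sub>U bcup B (un (un f))" using fresh_urelement by blast
  have a': "\<not> opair x a \<in>\<^sub>U f" for x using a(2) mem_un_un unfolding mem_bcup by blast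
  have u: "opair x y \<in>\<^sub>U upd f n a \<longleftrightarrow> x = n \<and> y = a \<or> opair x y \<in>\<^sub>U f \<and> x \<noteq> n" for x y
    unfolding mem_upd by auto
  have "inj_into (suc n) (upd f n a) (\<lambda>y. ur y \<and> \<not> y \<in>\<^sub>U B)"
    unfolding inj_into_def u mem_suc
  proof (intro conjI allI impI)
    fix x assume "x \<in>\<^sub>U n \<or> x = n"
    then show "\<exists>y. x = n \<and> y = a \<or> opair x y \<in>\<^sub>U f \<and> x \<noteq> n" using f unfolding inj_into_def by blast
  next
    fix x y assume "x \<in>\<^sub>U n \<or> x = n" "x = n \<and> y = a \<or> opair x y \<in>\<^sub>U f \<and> x \<noteq> n"
    then show "ur y" "\<not> y \<in>\<^sub>U B" using f a unfolding inj_into_def mem_bcup by blast+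
  next
    fix x y y' assume "x \<in>\<^sub>U n \<or> x = n" "x = n \<and> y = a \<or> opair x y \<in>\<^sub>U f \<and> x \<noteq> n"
      "x = n \<and> y' = a \<or> opair x y' \<in>\<^sub>U f \<and> x \<noteq> n"
    then show "y = y'" using f unfolding inj_into_def by blast
  next
    fix x x' y assume "x \<in>\<^sub>U n \<or> x = n" "x' \<in>\<^sub>U n \<or> x' = n"
      "x = n \<and> y = a \<or> opair x y \<in>\<^sub>U f \<and> x \<noteq> n" "x' = n \<and> y = a \<or> opair x' y \<in>\<^sub>U f \<and> x' \<noteq> n"
    then show "x = x'" using f a' unfolding inj_into_def by blast
  qed
  then show "\<exists>f. inj_into (suc n) f (\<lambda>y. ur y \<and> \<not> y \<in>\<^sub>U B)" by blast
qed

lemma maps_iff: "maps f x y \<longleftrightarrow> opair x y \<in>\<^sub>U f"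
  unfolding maps_def is_opair_iff by blast

text \<open>For a given n the injections may form a proper class, to which countable choice does not
  apply. Collection confines a sufficient supply of them to a set \<open>w\<close>.\<close>

lemma choose_injections:
  "\<exists>q. dt False (\<lambda>e E. q (e 0)) \<and> (\<forall>n. n \<in>\<^sub>U om \<longrightarrow> inj_into n (q n) (\<lambda>y. ur y \<and> \<not> y \<in>\<^sub>U B))"
proof -
  let ?I = "\<lambda>n f. inj_into n f (\<lambda>y. ur y \<and> \<not> y \<in>\<^sub>U B)"
  have I: "df False (\<lambda>e E. ?I (e 0) (e (Suc 0)))" unfolding inj_into_def by (intro dfs)
  note I2 = df_app2[of False "\<lambda>x y E. ?I x y", OF I]
  have "\<exists>w. \<forall>n. n \<in>\<^sub>U om \<longrightarrow> (\<exists>f. f \<in>\<^sub>U w \<and> ?I n f)"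
    by (rule collect[OF I ex_inj_into])
  then obtain w where w: "\<forall>n. n \<in>\<^sub>U om \<longrightarrow> (\<exists>f. f \<in>\<^sub>U w \<and> ?I n f)" by blast
  \<comment> \<open>One \<open>f\<close> can serve for several n. Tagging it with n makes
    \<open>F\<close> injective on \<open>om\<close>, so that its inverse \<open>h\<close> shows the
    family to be countable.\<close>
  define F where "F n = col (\<lambda>p. \<exists>f. f \<in>\<^sub>U w \<and> p = opair n f \<and> ?I n f)" for n
  have F: "p \<in>\<^sub>U F n \<longleftrightarrow> (\<exists>f. f \<in>\<^sub>U w \<and> p = opair n f \<and> ?I n f)" for p n
  proof -
    have dt: "dt False (\<lambda>e E. opair n (e 0))" by (intro dfs)
    have "small (\<lambda>p. \<exists>f. f \<in>\<^sub>U w \<and> p = opair n f \<and> ?I n f)"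
      by (rule small_sep[of _ "img (opair n) w"], intro dfs I2) (unfold mem_img[OF dt], blast)
    from mem_col[OF this] show ?thesis unfolding F_def .
  qed
  have dF0: "dt False (\<lambda>e E. F (e 0))" unfolding F_def by (intro dfs I2)
  note dF = dt_app1[of False "\<lambda>x E. F x", OF dF0]
  have F_inj: "n = m" if n: "n \<in>\<^sub>U om" and eq: "F n = F m" for n m
  proof -
    obtain f where "f \<in>\<^sub>U w" "?I n f" using w n by blast
    then have "opair n f \<in>\<^sub>U F n" unfolding F by blast
    then show ?thesis unfolding eq F by auto
  qed
  define s where "s = img F om"
  have s: "x \<in>\<^sub>U s \<longleftrightarrow> (\<exists>n. n \<in>\<^sub>U om \<and> x = F n)" for x unfolding s_def by (rule mem_img[OF dF0])
  define h where "h = img (\<lambda>n. opair (F n) n) om"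
  have h0: "p \<in>\<^sub>U h \<longleftrightarrow> (\<exists>n. n \<in>\<^sub>U om \<and> p = opair (F n) n)" for p
    unfolding h_def by (rule mem_img) (intro dfs dF)
  have h: "opair x y \<in>\<^sub>U h \<longleftrightarrow> y \<in>\<^sub>U om \<and> x = F y" for x y unfolding h0 by auto
  have "is_function_on h s"
    unfolding is_function_on_def maps_iff is_opair_iff h
  proof (intro conjI allI impI)
    show "is_set h" unfolding h_def by simp
    show "\<exists>x y. x \<in>\<^sub>U s \<and> p = opair x y" if "p \<in>\<^sub>U h" for p using that unfolding h0 s by blast
    show "\<exists>!y. y \<in>\<^sub>U om \<and> x = F y" if "x \<in>\<^sub>U s" for x using that F_inj unfolding s by blast
  qed
  then have "is_countable s"
    unfolding is_countable_def maps_iff h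
    by (intro exI[of _ om] exI[of _ h]) (use is_omega_om maps_iff h in auto)
  moreover have "is_set x \<and> (\<exists>y. y \<in>\<^sub>U x)" if x: "x \<in>\<^sub>U s" for x
  proof -
    obtain n where n: "n \<in>\<^sub>U om" "x = F n" using x unfolding s by blast
    obtain f where "f \<in>\<^sub>U w" "?I n f" using w n(1) by blast
    then have "opair n f \<in>\<^sub>U x" unfolding n(2) F by blast
    then show ?thesis using mem_is_set by blast
  qed
  moreover have "is_set s" unfolding s_def by simp
  ultimately obtain c where c: "is_function_on c s" "\<forall>x y. maps c x y \<longrightarrow> y \<in>\<^sub>U x"
    using ac unfolding AC_omega_def by blast
  define q where "q n = pick (\<lambda>f. opair (F n) (opair n f) \<in>\<^sub>U c)" for n
  have "?I n (q n)" if n: "n \<in>\<^sub>U om" for n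
  proof -
    have "F n \<in>\<^sub>U s" unfolding s using n by blast
    then have c1: "\<exists>!y. opair (F n) y \<in>\<^sub>U c" using c(1) unfolding is_function_on_def maps_iff by blast
    then obtain y where y: "opair (F n) y \<in>\<^sub>U c" by blast
    have cF: "y \<in>\<^sub>U F n" if "opair (F n) y \<in>\<^sub>U c" for y using c(2) that unfolding maps_iff by blast
    obtain f where "y = opair n f" using cF[OF y] unfolding F by blast
    then have "opair (F n) (opair n f) \<in>\<^sub>U c" using y by simp
    then have "opair (F n) (opair n (q n)) \<in>\<^sub>U c"
      unfolding q_def by (rule pickI) (use c1 in \<open>metis opair_inject\<close>)
    then have "opair n (q n) \<in>\<^sub>U F n" by (rule cF)
    then show ?thesis unfolding F by auto
  qed
  moreover have "dt False (\<lambda>e E. q (e 0))" unfolding q_def by (intro dfs dF)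
  ultimately show ?thesis by blast
qed

lemma urelement_sequence:
  "\<exists>s. dt False (\<lambda>e E. s (e 0)) \<and> (\<forall>n. n \<in>\<^sub>U om \<longrightarrow> ur (s n) \<and> \<not> s n \<in>\<^sub>U B) \<and>
     (\<forall>n m. n \<in>\<^sub>U om \<longrightarrow> m \<in>\<^sub>U om \<longrightarrow> s n = s m \<longrightarrow> n = m)"
proof -
  obtain q where dq0: "dt False (\<lambda>e E. q (e 0))"
    and q: "\<forall>n. n \<in>\<^sub>U om \<longrightarrow> inj_into n (q n) (\<lambda>y. ur y \<and> \<not> y \<in>\<^sub>U B)"
    using choose_injections by blast
  note dq = dt_app1[of False "\<lambda>x E. q x", OF dq0]
  define new where "new n r a \<longleftrightarrow> (\<exists>i. i \<in>\<^sub>U suc n \<and> opair i a \<in>\<^sub>U q (suc n) \<and> \<not> a \<in>\<^sub>U r \<and>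
     (\<forall>j. j \<in>\<^sub>U i \<longrightarrow> (\<forall>b. opair j b \<in>\<^sub>U q (suc n) \<longrightarrow> b \<in>\<^sub>U r)))" for n r a
  define G where "G n r = pick (new n r)" for n r
  have dG: "dt False (\<lambda>e E. G (e 0) (e (Suc 0)))" unfolding G_def new_def by (intro dfs dq)
  define s where "s = rec G"
  have ds: "dt False (\<lambda>e E. s (e 0))" unfolding s_def by (intro dt_rec[OF dG] dfs)
  note ds' = dt_app1[of False "\<lambda>x E. s x", OF ds]
  have s: "s n = pick (new n (img s n))" for n
    using rec_eq[OF dG, of n] unfolding s_def G_def .
  \<comment> \<open>The counting needs no injectivity of \<open>s\<close>: each step adds one value
    to the image, so n + 1 can never be embedded in it.\<close>
  have bound: "\<not> at_least (suc n) (img s n)" if n: "n \<in>\<^sub>U om" for n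
  proof (rule om_induct[where P = "\<lambda>n. \<not> at_least (suc n) (img s n)", OF _ n])
    show "df False (\<lambda>e E. \<not> at_least (suc (e 0)) (img s (e 0)))"
      by (intro dfs dt_img[OF ds])
    have "img s emp = emp" by (rule emp_eqI) (auto simp: mem_img[OF ds])
    then show "\<not> at_least (suc emp) (img s emp)" using not_at_least_emp by simp
  next
    fix n assume "\<not> at_least (suc n) (img s n)"
    moreover have "img s (suc n) = ins (s n) (img s n)"
      by (rule set_extI) (auto simp: mem_img[OF ds])
    ultimately show "\<not> at_least (suc (suc n)) (img s (suc n))"
      using not_at_least_ins by simp
  qed
  have new: "new n (img s n) (s n)" if n: "n \<in>\<^sub>U om" for n
  proof -
    let ?r = "img s n" and ?q = "q (suc n)"
    have sn: "suc n \<in>\<^sub>U om" using n by simp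
    have I: "inj_into (suc n) ?q (\<lambda>y. ur y \<and> \<not> y \<in>\<^sub>U B)" using q sn by blast
    have "\<not> inj_into (suc n) ?q (\<lambda>y. y \<in>\<^sub>U ?r)" using bound[OF n] unfolding at_least_def by blast
    then have ex: "\<exists>i. i \<in>\<^sub>U suc n \<and> (\<exists>a. opair i a \<in>\<^sub>U ?q \<and> \<not> a \<in>\<^sub>U ?r)"
      using I unfolding inj_into_def by blast
    have "small (\<lambda>i. i \<in>\<^sub>U suc n \<and> (\<exists>a. opair i a \<in>\<^sub>U ?q \<and> \<not> a \<in>\<^sub>U ?r))"
      by (rule small_sep[of _ "suc n"]) (intro dfs, blast)
    then obtain M where M: "\<forall>i. i \<in>\<^sub>U M \<longleftrightarrow> i \<in>\<^sub>U suc n \<and> (\<exists>a. opair i a \<in>\<^sub>U ?q \<and> \<not> a \<in>\<^sub>U ?r)"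
      unfolding small_def by blast
    then obtain i0 where "i0 \<in>\<^sub>U M" using ex by blast
    then obtain i where i: "i \<in>\<^sub>U M" "\<And>j. j \<in>\<^sub>U M \<Longrightarrow> \<not> j \<in>\<^sub>U i" using minimal_mem by blast
    then obtain a where a: "i \<in>\<^sub>U suc n" "opair i a \<in>\<^sub>U ?q" "\<not> a \<in>\<^sub>U ?r" using M by blast
    have "b \<in>\<^sub>U ?r" if "j \<in>\<^sub>U i" "opair j b \<in>\<^sub>U ?q" for j b
      using i(2)[of j] that nat_trans[OF sn a(1)] M by blast
    then have "new n ?r a" unfolding new_def using a by blast
    then show ?thesis unfolding s[of n]
    proof (rule pickI)
      fix z z' assume "new n ?r z" "new n ?r z'"
      then obtain i i' where
        i: "i \<in>\<^sub>U suc n" "opair i z \<in>\<^sub>U ?q" "\<not> z \<in>\<^sub>U ?r" "\<forall>j. j \<in>\<^sub>U i \<longrightarrow> (\<forall>b. opair j b \<in>\<^sub>U ?q \<longrightarrow> b \<in>\<^sub>U ?r)" and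
        i': "i' \<in>\<^sub>U suc n" "opair i' z' \<in>\<^sub>U ?q" "\<not> z' \<in>\<^sub>U ?r" "\<forall>j. j \<in>\<^sub>U i' \<longrightarrow> (\<forall>b. opair j b \<in>\<^sub>U ?q \<longrightarrow> b \<in>\<^sub>U ?r)"
        unfolding new_def by blast
      have "i = i'" using nat_linear[OF om_mem[OF sn i(1)] om_mem[OF sn i'(1)]] i i' by blast
      then show "z = z'" using I i(1,2) i'(2) unfolding inj_into_def by blast
    qed
  qed
  have "ur (s n) \<and> \<not> s n \<in>\<^sub>U B" if n: "n \<in>\<^sub>U om" for n
    using new[OF n] q[rule_format, OF suc_om[OF n]] unfolding new_def inj_into_def by blast
  moreover have "s n \<noteq> s m" if "n \<in>\<^sub>U om" "m \<in>\<^sub>U n" for n m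
    using new[OF that(1)] that(2) unfolding new_def mem_img[OF ds] by metis
  then have "n = m" if "n \<in>\<^sub>U om" "m \<in>\<^sub>U om" "s n = s m" for n m
    using nat_linear[OF that(1,2)] that by metis
  ultimately show ?thesis using ds by blast
qed

end

section \<open>From Basic Law V to a set of urelements\<close>

lemma ur_set_if_law_V:
  assumes "parametrically_definable_map \<epsilon>" "basic_law_V \<epsilon>"
  shows urelements_form_set
proof (rule ccontr)
  assume not_set: "\<not> urelements_form_set"
  obtain p where stab: "\<And>\<pi> X. involutive_automorphism \<pi> \<Longrightarrow> \<pi> p = p \<Longrightarrow> X \<in> definable_classes \<Longrightarrow>
    \<pi> ` X = X \<longleftrightarrow> \<pi> (\<epsilon> X) = \<epsilon> X"
    using law_V_stabilizer[OF assms] by blast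
  obtain s where ds: "dt False (\<lambda>e E. s (e 0))"
    and s: "\<And>n. n \<in>\<^sub>U om \<Longrightarrow> ur (s n)" "\<And>n. n \<in>\<^sub>U om \<Longrightarrow> \<not> s n \<in>\<^sub>U tc p"
      "\<And>n m. n \<in>\<^sub>U om \<Longrightarrow> m \<in>\<^sub>U om \<Longrightarrow> s n = s m \<Longrightarrow> n = m"
    using urelement_sequence[OF not_set, of "tc p"] by blast
  define S where "S = img s om"
  have S: "x \<in>\<^sub>U S \<longleftrightarrow> (\<exists>n. n \<in>\<^sub>U om \<and> x = s n)" for x unfolding S_def by (rule mem_img[OF ds])
  obtain t where dt: "dt False (\<lambda>e E. t (e 0))"
    and t: "\<And>n. n \<in>\<^sub>U om \<Longrightarrow> ur (t n)" "\<And>n. n \<in>\<^sub>U om \<Longrightarrow> \<not> t n \<in>\<^sub>U bcup (tc p) S"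
      "\<And>n m. n \<in>\<^sub>U om \<Longrightarrow> m \<in>\<^sub>U om \<Longrightarrow> t n = t m \<Longrightarrow> n = m"
    using urelement_sequence[OF not_set, of "bcup (tc p) S"] by blast
  have st: "s n \<noteq> t m" if "n \<in>\<^sub>U om" "m \<in>\<^sub>U om" for n m
    using t(2)[OF that(2)] that unfolding mem_bcup S by metis
  note ds' = dt_app1[of False "\<lambda>x E. s x", OF ds] and dt' = dt_app1[of False "\<lambda>x E. t x", OF dt]

  define X where "X = {C. \<exists>F. fin F \<and> (\<forall>k. k \<in>\<^sub>U om \<longrightarrow> s k \<in>\<^sub>U C \<or> s k \<in>\<^sub>U F)}"
  have X: "X \<in> definable_classes"
    unfolding X_def fin_def by (rule df_imp_definable[OF _ axioms(4)]) (intro dfs ds')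
  define y where "y = \<epsilon> X"

  have tc_y: "a \<in>\<^sub>U tc p" if a: "ur a" "a \<in>\<^sub>U tc y" for a
  proof (rule ccontr)
    \<comment> \<open>The partner \<open>c\<close> of \<open>a\<close> is chosen outside
      \<open>tc y\<close> as well, so that exchanging them carries \<open>a\<close> out of the
      support of \<open>y\<close>.\<close>
    assume ap: "\<not> a \<in>\<^sub>U tc p"
    obtain c where c: "ur c" "\<not> c \<in>\<^sub>U bcup (tc p) (tc y)" using fresh_urelement[OF not_set] by blast
    define \<theta> where "\<theta> x = (if x = a then c else if x = c then a else x)" for x
    have "dt False (\<lambda>e E. \<theta> (e 0))" unfolding \<theta>_def by (intro dfs)
    then have \<theta>: "urelement_involution \<theta>"
      unfolding urelement_involution_def using a(1) c(1) by (simp add: \<theta>_def)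
    note \<pi> = extend_automorphism[OF \<theta>]
    have swap: "extend \<theta> C \<in> X" if C: "C \<in> X" for C
    proof -
      obtain F where F: "fin F" "\<forall>k. k \<in>\<^sub>U om \<longrightarrow> s k \<in>\<^sub>U C \<or> s k \<in>\<^sub>U F" using C unfolding X_def by blast
      \<comment> \<open>The exchange moves \<open>s k\<close> only if it is \<open>a\<close> or
        \<open>c\<close>, so two further exceptions suffice.\<close>
      have "s k \<in>\<^sub>U extend \<theta> C \<or> s k \<in>\<^sub>U ins a (ins c F)" if k: "k \<in>\<^sub>U om" for k
      proof (cases "s k = a \<or> s k = c \<or> s k \<in>\<^sub>U F")
        case False
        then have "s k \<in>\<^sub>U C" using F(2) k by blast
        then have "extend \<theta> (s k) \<in>\<^sub>U extend \<theta> C" using inv_mem[OF \<pi>] by blast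
        moreover have "extend \<theta> (s k) = s k"
          using extend_eq[OF \<theta>, of "s k"] s(1)[OF k] False unfolding \<theta>_def by simp
        ultimately show ?thesis by simp
      qed auto
      then show ?thesis unfolding X_def using fin_ins[OF fin_ins[OF F(1)]] by blast
    qed
    have "extend \<theta> C \<in> X \<longleftrightarrow> C \<in> X" for C
      using swap[of C] swap[of "extend \<theta> C"] twice[OF \<pi>, of C] by auto
    then have "extend \<theta> ` X = X" by (rule image_inv_eqI[OF \<pi>])
    moreover have "extend \<theta> p = p"
    proof (rule extend_fixes[OF \<theta> tc_transitive _ tc_self])
      fix b assume "b \<in>\<^sub>U tc p"
      then show "\<theta> b = b" unfolding \<theta>_def using ap c(2) unfolding mem_bcup by metis
    qed
    ultimately have "extend \<theta> y = y" using stab[OF \<pi> _ X] unfolding y_def by blast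
    from tc_invariant[OF \<pi> this a(2)] have "extend \<theta> a \<in>\<^sub>U tc y" .
    moreover have "extend \<theta> a = c" using extend_eq[OF \<theta>, of a] a(1) unfolding \<theta>_def by simp
    ultimately show False using c(2) by simp
  qed

  \<comment> \<open>The simultaneous exchange is described by a formula in the two definable
    sequences and extracted with \<open>pick\<close>, which keeps \<open>\<theta>\<close>
    definable.\<close>
  define R where "R x z \<longleftrightarrow> (\<exists>k. k \<in>\<^sub>U om \<and> (x = s k \<and> z = t k \<or> x = t k \<and> z = s k)) \<or>
    (z = x \<and> \<not> (\<exists>k. k \<in>\<^sub>U om \<and> (x = s k \<or> x = t k)))" for x z
  define \<theta> where "\<theta> x = pick (R x)" for x
  have R_unique: "z = z'" if "R x z" "R x z'" for x z z'
    using that s(3) t(3) st unfolding R_def by metis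
  have \<theta>_eq: "\<theta> x = z" if "R x z" for x z
    unfolding \<theta>_def using that R_unique by (intro pick_eq) blast+
  have \<theta>s: "\<theta> (s k) = t k" "\<theta> (t k) = s k" if "k \<in>\<^sub>U om" for k
    by (rule \<theta>_eq, use that in \<open>unfold R_def, blast\<close>)+
  have \<theta>_id: "\<theta> x = x" if "\<not> (\<exists>k. k \<in>\<^sub>U om \<and> (x = s k \<or> x = t k))" for x
    by (rule \<theta>_eq, use that in \<open>unfold R_def, blast\<close>)
  have \<theta>: "urelement_involution \<theta>"
    unfolding urelement_involution_def
  proof (intro conjI allI impI)
    show "dt False (\<lambda>e E. \<theta> (e 0))" unfolding \<theta>_def R_def by (intro dfs ds' dt')
    show "ur (\<theta> x)" if "ur x" for x using that \<theta>s \<theta>_id s(1) t(1) by metis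
    show "\<theta> (\<theta> x) = x" for x using \<theta>s \<theta>_id by metis
  qed
  note \<pi> = extend_automorphism[OF \<theta>]
  have fix_p: "\<theta> b = b" if "b \<in>\<^sub>U tc p" for b
    using \<theta>_id[of b] that s(2) t(2) unfolding mem_bcup by metis
  have "extend \<theta> p = p"
    by (rule extend_fixes[OF \<theta> tc_transitive fix_p tc_self])
  \<comment> \<open>By \<open>tc_y\<close> the urelements in the closure of \<open>y\<close> belong
    to that of \<open>p\<close>, which both sequences avoid.\<close>
  moreover have "extend \<theta> y = y"
    by (rule extend_fixes[OF \<theta> tc_transitive _ tc_self]) (use fix_p tc_y in blast)
  ultimately have image_X: "extend \<theta> ` X = X" using stab[OF \<pi> _ X] unfolding y_def by blast
  \<comment> \<open>\<open>S\<close> contains every \<open>s k\<close>, so the empty set of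
    exceptions will do; its image consists of the \<open>t k\<close> and misses every
    \<open>s k\<close>.\<close>
  have "S \<in> X" unfolding X_def using fin_emp S by blast
  then have "extend \<theta> S \<in> X" using image_X by blast
  then obtain F where F: "fin F" "\<forall>k. k \<in>\<^sub>U om \<longrightarrow> s k \<in>\<^sub>U extend \<theta> S \<or> s k \<in>\<^sub>U F"
    unfolding X_def by blast
  have sF: "s k \<in>\<^sub>U F" if k: "k \<in>\<^sub>U om" for k
  proof -
    have "\<not> s k \<in>\<^sub>U extend \<theta> S"
    proof
      assume "s k \<in>\<^sub>U extend \<theta> S"
      then have "extend \<theta> (s k) \<in>\<^sub>U S" using inv_mem[OF \<pi>, of "s k" "extend \<theta> S"] twice[OF \<pi>] by metis
      moreover have "extend \<theta> (s k) = t k" using extend_eq[OF \<theta>, of "s k"] s(1)[OF k] \<theta>s(1)[OF k] by simp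
      ultimately show False using st k unfolding S by metis
    qed
    then show ?thesis using F(2) k by blast
  qed
  \<comment> \<open>All \<open>s k\<close> are now exceptions, so the sequence embeds every n in the
    supposedly finite \<open>F\<close>.\<close>
  obtain n where n: "n \<in>\<^sub>U om" "\<not> at_least n F" using F(1) unfolding fin_def by blast
  define f where "f = img (\<lambda>k. opair k (s k)) om"
  have f0: "p \<in>\<^sub>U f \<longleftrightarrow> (\<exists>k. k \<in>\<^sub>U om \<and> p = opair k (s k))" for p
    unfolding f_def by (rule mem_img) (intro dfs ds')
  have f: "opair k z \<in>\<^sub>U f \<longleftrightarrow> k \<in>\<^sub>U om \<and> z = s k" for k z unfolding f0 by auto
  have "inj_into n f (\<lambda>y. y \<in>\<^sub>U F)"
    unfolding inj_into_def f using om_mem[OF n(1)] sF s(3) by blast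
  then show False using n(2) unfolding at_least_def by blast
qed

lemma parametrically_definable_if_definable:
  assumes "definable_map \<epsilon>"
  shows "parametrically_definable_map \<epsilon>"
proof -
  obtain \<phi> where \<phi>: "fv_obj \<phi> \<subseteq> {0}" "fv_cl \<phi> \<subseteq> {0}"
    "\<And>X y. X \<in> definable_classes \<Longrightarrow> \<epsilon> X = y \<longleftrightarrow> sat2 (\<lambda>_. y) (\<lambda>_. X) \<phi>"
    using assms unfolding definable_map_def by blast
  have "sat2 (\<lambda>_. y) ((\<lambda>_. UNIV)(0 := X)) \<phi> = sat2 (\<lambda>_. y) (\<lambda>_. X) \<phi>" for X y
    by (rule sat2_cong) (use \<phi>(2) in auto)
  then have "\<forall>X \<in> definable_classes. \<forall>y. \<epsilon> X = y \<longleftrightarrow> sat2 (\<lambda>_. y) ((\<lambda>_. UNIV)(0 := X)) \<phi>"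
    using \<phi>(3) by blast
  moreover have "fv_cl \<phi> \<subseteq> {0, 1}" using \<phi>(2) by blast
  ultimately show ?thesis
    unfolding parametrically_definable_map_def using \<phi>(1) UNIV_definable by blast
qed

end

theorem theorem3:
  fixes mem :: "'a \<Rightarrow> 'a \<Rightarrow> bool" and ur :: "'a \<Rightarrow> bool"
  assumes "urelement_structure.ZFU_R mem ur"
    and "urelement_structure.collection mem ur"
    and "urelement_structure.AC_omega mem ur"
  shows "(urelement_structure.urelements_form_set mem ur \<longleftrightarrow>
           (\<exists>\<epsilon>. urelement_structure.definable_map mem ur \<epsilon> \<and>
                urelement_structure.basic_law_V mem ur \<epsilon>)) \<and>
         ((\<exists>\<epsilon>. urelement_structure.definable_map mem ur \<epsilon> \<and>
                urelement_structure.basic_law_V mem ur \<epsilon>) \<longleftrightarrow>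
           (\<exists>\<epsilon>. urelement_structure.parametrically_definable_map mem ur \<epsilon> \<and>
                urelement_structure.basic_law_V mem ur \<epsilon>))"
proof -
  interpret zfu mem ur by unfold_locales fact+
  show ?thesis
    using law_V_if_ur_set ur_set_if_law_V parametrically_definable_if_definable by blast
qed

end
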